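(* Let $G$ be a finite connected graph (possibly with loops and multiple edges) containing at least one edge. Let $p(G)$ be the number of pendant vertices of $G$ and let $\beta(G)$ be its Betti number. Then for every integer $j \ge 1$, $$\Lambda_j(G) \le \left( j - 1 + 2\beta(G) + \frac{p(G)}{2} \right)^2 \pi^2 .$$
   Context: A pendant vertex is a vertex of degree one (a loop contributes two to the degree). The Betti number of a finite connected graph with $m(G)$ edges and $n(G)$ vertices is $\beta(G)=m(G)-n(G)+1$. A metric on a finite connected graph $G$ with edge set $E \neq \emptyset$ is a function $\ell : E \to (0,\infty)$; the pair $(G,\ell)$ is a finite metric graph, in which each edge $e$ is identified with an interval in $\mathbb{R}$ of length $\ell(e)$. Its length is $L(G,\ell)=\sum_{e\in E}\ell(e)$. The (Neumann) eigenvalues of $(G,\ell)$ are the numbers $\lambda$ for which there is a nonzero continuous function $f$ on $G$ with $-f''=\lambda f$ on each edge and $\sum_{e\sim v} f'(v)=0$ at each vertex $v$, where the sum is over edges incident to $v$ and derivatives are taken in the direction away from $v$ into the edge (a loop at $v$ contributes two terms, one in each direction). Counted with multiplicity they are indexed as $0=\lambda_0(G,\ell)<\lambda_1(G,\ell)\le\lambda_2(G,\ell)\le\dots$. Equivalently, $\lambda_j(G,\ell)=\min_W\max_{0\ne f\in W}\frac{\int_G|f'|^2}{\int_G|f|^2}$, the minimum over all $(j+1)$-dimensional subspaces $W$ of $H^1(G,\ell)$, the space of continuous functions $f:G\to\mathbb{R}$ that are in $H^1$ over each edge. $\Lambda_j(G)$ is the smallest number such that $\lambda_j(G,\ell)\le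 \Lambda_j(G)/L(G,\ell)^2$ for all metrics $\ell$ on $G$. *)

theory Defs
  imports
    "HOL-Analysis.Analysis"
    "HOL-Library.Function_Algebras"
    "Graph_Theory.Graph_Theory"
begin

text \<open>
  A finite graph with loops and multiple edges is a \<^locale>\<open>fin_digraph\<close> whose arcs are the
  edges. The direction of an arc is only a choice of parametrisation: the edge \<open>e\<close> is identified
  with the interval \<open>[0, l e]\<close>, where \<open>0\<close> corresponds to \<open>tail G e\<close> and \<open>l e\<close> to
  \<open>head G e\<close>. None of the notions below depends on that choice. In particular,
  \<open>Digraph_Component.connected\<close> is connectedness of the underlying undirected graph.
\<close>

text \<open>A loop is both an in-arc and an out-arc of its vertex, so it contributes two.\<close>

definition vertex_degree :: "('v, 'e) pre_digraph \<Rightarrow> 'v \<Rightarrow> nat" where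
  "vertex_degree G v = out_degree G v + in_degree G v"

definition num_pendant :: "('v, 'e) pre_digraph \<Rightarrow> nat" where
  "num_pendant G = card {v \<in> verts G. vertex_degree G v = 1}"

definition betti :: "('v, 'e) pre_digraph \<Rightarrow> int" where
  "betti G = int (card (arcs G)) - int (card (verts G)) + 1"

definition graph_metric :: "('v, 'e) pre_digraph \<Rightarrow> ('e \<Rightarrow> real) \<Rightarrow> bool" where
  "graph_metric G l \<longleftrightarrow> (\<forall>e \<in> arcs G. l e > 0)"

definition graph_length :: "('v, 'e) pre_digraph \<Rightarrow> ('e \<Rightarrow> real) \<Rightarrow> real" where
  "graph_length G l = (\<Sum>e \<in> arcs G. l e)"

text \<open>
  A real function on the metric graph is given by its restrictions \<open>f e\<close> to the edges. The
  requirement that \<open>f e\<close> vanishes off \<open>[0, l e]\<close> (and everywhere if \<open>e\<close> is not an edge) makes this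
  representation unique, so that dimensions of spaces of such functions are the intended ones.
  Continuity at the vertices means that the values at the edge ends come from a function \<open>g\<close> on
  the vertices.
\<close>

definition continuous_graph_fun ::
    "('v, 'e) pre_digraph \<Rightarrow> ('e \<Rightarrow> real) \<Rightarrow> ('e \<Rightarrow> real \<Rightarrow> real) \<Rightarrow> bool" where
  "continuous_graph_fun G l f \<longleftrightarrow>
     (\<forall>e x. e \<notin> arcs G \<or> x \<notin> {0..l e} \<longrightarrow> f e x = 0) \<and>
     (\<forall>e \<in> arcs G. continuous_on {0..l e} (f e)) \<and>
     (\<exists>g :: 'v \<Rightarrow> real. \<forall>e \<in> arcs G. f e 0 = g (tail G e) \<and> f e (l e) = g (head G e))"

text \<open>
  Here \<open>f'\<close> is the edgewise derivative (one-sided at the ends of an edge). The derivative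
  in the direction away from the vertex is \<open>f' e 0\<close> at the tail and \<open>- f' e (l e)\<close> at the head.
\<close>

definition neumann_eigenspace ::
    "('v, 'e) pre_digraph \<Rightarrow> ('e \<Rightarrow> real) \<Rightarrow> real \<Rightarrow> ('e \<Rightarrow> real \<Rightarrow> real) set" where
  "neumann_eigenspace G l \<mu> =
     {f. continuous_graph_fun G l f \<and>
         (\<exists>f' :: 'e \<Rightarrow> real \<Rightarrow> real.
            (\<forall>e \<in> arcs G. \<forall>x \<in> {0..l e}.
               (f e has_real_derivative f' e x) (at x within {0..l e}) \<and>
               (f' e has_real_derivative - \<mu> * f e x) (at x within {0..l e})) \<and>
            (\<forall>v \<in> verts G.
               (\<Sum>e \<in> out_arcs G v. f' e 0) + (\<Sum>e \<in> in_arcs G v. - f' e (l e)) = 0))}"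

definition neumann_eigenvalue ::
    "('v, 'e) pre_digraph \<Rightarrow> ('e \<Rightarrow> real) \<Rightarrow> real \<Rightarrow> bool" where
  "neumann_eigenvalue G l \<mu> \<longleftrightarrow> (\<exists>f \<in> neumann_eigenspace G l \<mu>. f \<noteq> 0)"

definition graph_fun_scale :: "real \<Rightarrow> ('e \<Rightarrow> real \<Rightarrow> real) \<Rightarrow> 'e \<Rightarrow> real \<Rightarrow> real" where
  "graph_fun_scale c f = (\<lambda>e x. c * f e x)"

global_interpretation graph_fun: vector_space graph_fun_scale
  by unfold_locales (auto simp: graph_fun_scale_def fun_eq_iff algebra_simps)

definition eigenvalue_multiplicity ::
    "('v, 'e) pre_digraph \<Rightarrow> ('e \<Rightarrow> real) \<Rightarrow> real \<Rightarrow> nat" where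
  "eigenvalue_multiplicity G l \<mu> = graph_fun.dim (neumann_eigenspace G l \<mu>)"

definition neumann_spectrum ::
    "('v, 'e) pre_digraph \<Rightarrow> ('e \<Rightarrow> real) \<Rightarrow> (nat \<Rightarrow> real) \<Rightarrow> bool" where
  "neumann_spectrum G l s \<longleftrightarrow>
     incseq s \<and> range s = {\<mu>. neumann_eigenvalue G l \<mu>} \<and>
     (\<forall>\<mu>. neumann_eigenvalue G l \<mu> \<longrightarrow>
        finite {j. s j = \<mu>} \<and> card {j. s j = \<mu>} = eigenvalue_multiplicity G l \<mu>)"

text \<open>
  The enumeration is unique: all multiplicities are finite, and two nondecreasing sequences
  with the same finite fibre sizes coincide.
\<close>

definition neumann_ev :: "('v, 'e) pre_digraph \<Rightarrow> nat \<Rightarrow> ('e \<Rightarrow> real) \<Rightarrow> real" where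
  "neumann_ev G j l = (THE s. neumann_spectrum G l s) j"

text \<open>
  Taken in the extended reals, where the least bound exists even if no finite bound is known.
  A bound by a real number thus includes the finiteness of \<open>Lambda_bound G j\<close>.
\<close>

definition Lambda_bound :: "('v, 'e) pre_digraph \<Rightarrow> nat \<Rightarrow> ereal" where
  "Lambda_bound G j =
     (LEAST c :: ereal. \<forall>l. graph_metric G l \<longrightarrow>
        ereal (neumann_ev G j l) \<le> c / ereal ((graph_length G l)\<^sup>2))"

end

theory Submission
  imports Defs "HOL-Complex_Analysis.Great_Picard"
begin

text \<open>
  The theorem is a count of test functions. Fix a metric of total length \<open>L\<close> and define \<open>k\<close> by
  \<open>k L = (j - 1 + 2 \<beta> + p / 2) \<pi>\<close>. By the min-max principle \<open>\<lambda>\<^sub>j \<le> k\<^sup>2\<close> follows once, for any \<open>j\<close> linear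
  functionals, some nonzero \<open>f\<close> in \<open>H\<^sup>1\<close> is annihilated by all of them and satisfies
  \<open>\<integral>f'\<^sup>2 \<le> k\<^sup>2 \<integral>f\<^sup>2\<close>.

  Suppose first that the graph is a tree, and solve \<open>f'' = - k\<^sup>2 f\<close> from the leaves towards a root.
  Along an edge the phase \<open>\<theta>\<close> with \<open>f' / f = k cot \<theta>\<close> grows at rate \<open>k\<close>. Whenever it
  passes a multiple of \<open>\<pi>\<close> the solution vanishes, and what lies behind the zero is a test function
  of Rayleigh quotient \<open>k\<^sup>2\<close>, supported away from everything that follows. Where branches meet, a
  common value is prescribed and the slopes \<open>f' / f\<close> add up, so the branches continue as
  one branch whose phase has the sum of the cotangents as its cotangent. As
  \<open>cot \<theta> + cot \<rho> \<le> cot (\<theta> + \<rho>)\<close> for phases below \<open>\<pi>\<close> with \<open>\<theta> + \<rho> > \<pi>\<close>, merging two branches loses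
  at most \<open>\<pi>\<close> of phase. A pendant vertex starts a branch with phase \<open>\<pi> / 2\<close>. Adding up,
  the number of independent test functions exceeds \<open>k L / \<pi> + 1 - p / 2\<close>. In general, \<open>\<beta>\<close> edges are
  cut at one end, which leaves a tree. Each cut creates at most two new pendant vertices and
  imposes one linear condition, the continuity at the cut; this replaces \<open>p\<close> by \<open>p + 2 \<beta>\<close> and
  \<open>j\<close> by \<open>j + \<beta>\<close> and gives the stated bound.

  The part of the graph that has already been processed acts on the rest only through a Robin condition
  at the vertices where it is attached. The count is therefore an induction over connected graphs with
  phases attached to the vertices (\<open>test_exists_count\<close>). Its steps rest on \<open>attach_branch\<close>, which adds
  one edge, and on \<open>merge_angle_ge\<close>, which bounds the loss of phase.

  The eigenvalues are defined by an enumeration of the solutions of the differential equation, so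
  this enumeration has to be shown to exist and to satisfy the min-max principle. The solution operator of
  \<open>- u'' + u = f\<close> is a compact positive symmetric operator on the edgewise continuous functions with the
  \<open>L\<^sup>2\<close> inner product. For such operators the spectral theorem is proved by successive maximisation of
  the Rayleigh quotient, which only needs that images of bounded sequences have limits, not that
  the space is complete (\<open>eigenbasis_exists\<close>). The result is \<open>neumann_ev_variational\<close>.
\<close>

section \<open>Solvability of underdetermined linear systems, and enumerations\<close>

text \<open>
  If every system of at most \<open>B\<close> equations from \<open>Lin\<close> has a solution in \<open>Y\<close>, then with \<open>card J\<close>
  additional scalar unknowns \<open>card J\<close> additional equations can be satisfied, by Gaussian elimination of
  one unknown at a time. In the second alternative the scalars are a nontrivial solution by themselves.
  For \<open>B = -1\<close> the hypothesis on \<open>Y\<close> is vacuous and the statement concerns the scalars only. The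
  bound is real because it will be a quantity such as \<open>k L / \<pi>\<close>.
\<close>

lemma elimination:
  fixes Lin :: "('y \<Rightarrow> real) set" and Y :: "'y set" and B :: real
  assumes fin: "finite J"
    and closed: "\<And>T T' c. T \<in> Lin \<Longrightarrow> T' \<in> Lin \<Longrightarrow> (\<lambda>y. T y - c * T' y) \<in> Lin"
    and kernel: "\<And>Ts. set Ts \<subseteq> Lin \<Longrightarrow> real (length Ts) \<le> B \<Longrightarrow> \<exists>y\<in>Y. \<forall>T\<in>set Ts. T y = 0"
  shows "\<forall>(T, b)\<in>set ps. T \<in> Lin \<Longrightarrow> real (length ps) \<le> B + real (card J) \<Longrightarrow>
    (\<exists>y\<in>Y. \<exists>a. \<forall>(T, b)\<in>set ps. T y + (\<Sum>j\<in>J. a j * b j) = 0) \<or>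
    (\<exists>a. (\<exists>j\<in>J. a j \<noteq> 0) \<and> (\<forall>(T, b)\<in>set ps. (\<Sum>j\<in>J. a j * b j) = 0))"
  using fin
proof (induction J arbitrary: ps rule: finite_induct)
  case empty
  have "\<exists>y\<in>Y. \<forall>T\<in>set (map fst ps). T y = 0"
    using empty by (intro kernel) auto
  then show ?case by fastforce
next
  case (insert i J)
  show ?case
  proof (cases "\<forall>(T, b)\<in>set ps. b i = 0")
    case True
    have "\<forall>(T, b)\<in>set ps. (\<Sum>j\<in>insert i J. (if j = i then 1 else 0) * b j) = 0"
    proof clarify
      fix T b assume Tb: "(T, b) \<in> set ps"
      then have "b i = 0" using True by auto
      moreover have "(\<Sum>j\<in>J. (if j = i then 1 else 0) * b j) = 0"
        using insert.hyps by (intro sum.neutral) auto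
      ultimately show "(\<Sum>j\<in>insert i J. (if j = i then 1 else 0) * b j) = 0"
        using insert.hyps by simp
    qed
    then show ?thesis
      by (intro disjI2 exI[of _ "\<lambda>j. if j = i then 1 else 0"]) auto
  next
    case False
    then obtain T0 b0 where p0: "(T0, b0) \<in> set ps" and b0: "b0 i \<noteq> 0" by auto
    define red where "red = (\<lambda>(T, b). (\<lambda>y. T y - b i / b0 i * T0 y, \<lambda>j. b j - b i / b0 i * b0 j))"
    define qs where "qs = map red (remove1 (T0, b0) ps)"
    have qs_sub: "set qs \<subseteq> red ` set ps"
      unfolding qs_def using set_remove1_subset[of "(T0, b0)" ps] by auto
    have lin: "\<forall>(T, b)\<in>set qs. T \<in> Lin"
    proof clarify
      fix T b assume "(T, b) \<in> set qs"
      with qs_sub obtain T' b' where T': "(T', b') \<in> set ps" "(T, b) = red (T', b')"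
        by auto
      have "T' \<in> Lin" "T0 \<in> Lin" using insert.prems(1) T'(1) p0 by auto
      then show "T \<in> Lin" using T'(2) closed[of T' T0 "b' i / b0 i"] by (simp add: red_def)
    qed
    have "length ps \<noteq> 0" using p0 by auto
    then have "length qs + 1 = length ps"
      using p0 by (simp add: qs_def length_remove1)
    then have len: "real (length qs) \<le> B + real (card J)"
      using insert.prems(2) insert.hyps by simp
    \<comment> \<open>The coefficient of the pivot index \<open>i\<close> is chosen to satisfy the pivot equation; all
      other equations then hold because their reduced forms do.\<close>
    have extend: "\<forall>(T, b)\<in>set ps. z * T y + (\<Sum>j\<in>insert i J. a' j * b j) = 0"
      if sol: "\<forall>(T, b)\<in>set qs. z * T y + (\<Sum>j\<in>J. a j * b j) = 0"
        and a': "a' = a(i := - (z * T0 y + (\<Sum>j\<in>J. a j * b0 j)) / b0 i)"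
      for z y a a'
    proof clarify
      fix T b assume Tb: "(T, b) \<in> set ps"
      have J: "(\<Sum>j\<in>insert i J. a' j * b j) = a' i * b i + (\<Sum>j\<in>J. a j * b j)" for b
      proof -
        have "(\<Sum>j\<in>J. a' j * b j) = (\<Sum>j\<in>J. a j * b j)"
          using insert.hyps by (intro sum.cong) (auto simp: a')
        then show ?thesis using insert.hyps by simp
      qed
      show "z * T y + (\<Sum>j\<in>insert i J. a' j * b j) = 0"
      proof (cases "(T, b) = (T0, b0)")
        case True
        then show ?thesis unfolding J using b0 by (simp add: a')
      next
        case False
        then have "(T, b) \<in> set (remove1 (T0, b0) ps)"
          using Tb by (simp add: in_set_remove1)
        then have "red (T, b) \<in> set qs" by (simp add: qs_def)
        with sol have "z * (T y - b i / b0 i * T0 y) + (\<Sum>j\<in>J. a j * (b j - b i / b0 i * b0 j)) = 0"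
          by (auto simp: red_def)
        moreover have "(\<Sum>j\<in>J. a j * (b j - b i / b0 i * b0 j)) =
            (\<Sum>j\<in>J. a j * b j) - b i / b0 i * (\<Sum>j\<in>J. a j * b0 j)"
          by (simp add: sum_distrib_left algebra_simps sum_subtractf)
        ultimately show ?thesis
          unfolding J using b0 by (simp add: a' field_simps)
      qed
    qed
    from insert.IH[OF lin len] show ?thesis
    proof
      assume "\<exists>y\<in>Y. \<exists>a. \<forall>(T, b)\<in>set qs. T y + (\<Sum>j\<in>J. a j * b j) = 0"
      then obtain y a where y: "y \<in> Y" "\<forall>(T, b)\<in>set qs. 1 * T y + (\<Sum>j\<in>J. a j * b j) = 0"
        by auto
      define a' where "a' = a(i := - (1 * T0 y + (\<Sum>j\<in>J. a j * b0 j)) / b0 i)"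
      have "\<forall>(T, b)\<in>set ps. T y + (\<Sum>j\<in>insert i J. a' j * b j) = 0"
        using extend[OF y(2) a'_def] by simp
      then show ?thesis using y(1) by blast
    next
      assume "\<exists>a. (\<exists>j\<in>J. a j \<noteq> 0) \<and> (\<forall>(T, b)\<in>set qs. (\<Sum>j\<in>J. a j * b j) = 0)"
      then obtain a where a: "\<exists>j\<in>J. a j \<noteq> 0"
        "\<forall>(T, b)\<in>set qs. 0 * T undefined + (\<Sum>j\<in>J. a j * b j) = 0" by auto
      define a' where "a' = a(i := - (0 * T0 undefined + (\<Sum>j\<in>J. a j * b0 j)) / b0 i)"
      have "\<forall>(T, b)\<in>set ps. (\<Sum>j\<in>insert i J. a' j * b j) = 0"
        using extend[OF a(2) a'_def] by simp
      moreover have "\<exists>j\<in>insert i J. a' j \<noteq> 0"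
        using a(1) insert.hyps by (auto simp: a'_def)
      ultimately show ?thesis by blast
    qed
  qed
qed

lemma underdetermined_system:
  fixes T :: "'i \<Rightarrow> ('j \<Rightarrow> real) \<Rightarrow> real"
  assumes finJ: "finite J" and finI: "finite I" and card: "card I < card J"
    and lin: "\<And>i a b c. i \<in> I \<Longrightarrow> T i (\<lambda>j. a j + c * b j) = T i a + c * T i b"
  shows "\<exists>a. (\<forall>j. j \<notin> J \<longrightarrow> a j = 0) \<and> (\<exists>j\<in>J. a j \<noteq> 0) \<and> (\<forall>i\<in>I. T i a = 0)"
proof -
  define unit :: "'j \<Rightarrow> 'j \<Rightarrow> real" where "unit = (\<lambda>j j'. if j' = j then 1 else 0)"
  obtain xs where xs: "set xs = I" "distinct xs" using finI finite_distinct_list by blast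
  define ps where "ps = map (\<lambda>i. (\<lambda>y::unit. 0::real, \<lambda>j. T i (unit j))) xs"
  have "length xs < card J" using xs card distinct_card by fastforce
  then have "(\<exists>y\<in>{}. \<exists>a. \<forall>(S, b)\<in>set ps. S y + (\<Sum>j\<in>J. a j * b j) = 0) \<or>
    (\<exists>a. (\<exists>j\<in>J. a j \<noteq> 0) \<and> (\<forall>(S, b)\<in>set ps. (\<Sum>j\<in>J. a j * b j) = 0))"
    by (intro elimination[where Lin = "{\<lambda>_. 0}" and B = "-1"] finJ) (auto simp: ps_def)
  then obtain a where a: "\<exists>j\<in>J. a j \<noteq> 0" "\<forall>i\<in>I. (\<Sum>j\<in>J. a j * T i (unit j)) = 0"
    using xs by (auto simp: ps_def)
  have T0: "T i (\<lambda>_. 0) = 0" if "i \<in> I" for i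
    using lin[OF that, of "\<lambda>_. 0" "-1" "\<lambda>_. 0"] by simp
  have expand: "T i (\<lambda>j. if j \<in> F then a j else 0) = (\<Sum>j\<in>F. a j * T i (unit j))"
    if "i \<in> I" "finite F" for i F
    using that(2)
  proof (induction F)
    case (insert k F)
    have "(\<lambda>j. if j \<in> insert k F then a j else 0) = (\<lambda>j. (if j \<in> F then a j else 0) + a k * unit k j)"
      using insert.hyps by (auto simp: unit_def fun_eq_iff)
    then show ?case using insert lin[OF that(1)] by simp
  qed (simp add: T0 that)
  show ?thesis
    using a expand finJ by (intro exI[of _ "\<lambda>j. if j \<in> J then a j else 0"]) auto
qed

lemma nondecreasing_enumeration_unique:
  fixes s t :: "nat \<Rightarrow> real"
  assumes s: "incseq s" and t: "incseq t" and range: "range s = range t"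
    and fin: "\<And>x. finite {j. s j = x}" "\<And>x. finite {j. t j = x}"
    and card: "\<And>x. card {j. s j = x} = card {j. t j = x}"
  shows "s = t"
proof -
  have le: "s n \<le> t n" if s: "incseq s" and t: "incseq t" and range: "range s = range t"
    and fin: "\<And>x. finite {j. s j = x}" "\<And>x. finite {j. t j = x}"
    and card: "\<And>x. card {j. s j = x} = card {j. t j = x}" for s t :: "nat \<Rightarrow> real" and n
  proof (rule ccontr)
    assume "\<not> s n \<le> t n"
    then have lt: "t n < s n" by simp
    have sub: "{j. s j \<le> t n} \<subseteq> {..<n}"
    proof
      fix j assume "j \<in> {j. s j \<le> t n}"
      then have "s j < s n" using lt by simp
      then show "j \<in> {..<n}" using incseqD[OF s, of n j] by (auto simp: not_less[symmetric])
    qed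
    define R where "R = s ` {j. s j \<le> t n}"
    have R: "finite R" unfolding R_def using sub by (auto intro: finite_subset)
    have Rt: "R = t ` {j. t j \<le> t n}"
    proof -
      have "R = {x \<in> range s. x \<le> t n}" by (auto simp: R_def)
      then show ?thesis unfolding range by auto
    qed
    have "card {j. s j \<le> t n} = card (\<Union>x\<in>R. {j. s j = x})"
      by (rule arg_cong[of _ _ card]) (auto simp: R_def)
    also have "\<dots> = (\<Sum>x\<in>R. card {j. s j = x})"
      using R fin by (intro card_UN_disjoint) auto
    also have "\<dots> = (\<Sum>x\<in>R. card {j. t j = x})" by (simp add: card)
    also have "\<dots> = card (\<Union>x\<in>R. {j. t j = x})"
      using R fin by (intro card_UN_disjoint[symmetric]) auto
    finally have "card {j. s j \<le> t n} = card (\<Union>x\<in>R. {j. t j = x})" .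
    moreover have "{..n} \<subseteq> (\<Union>x\<in>R. {j. t j = x})"
      using incseqD[OF t] by (auto simp: Rt)
    then have "card {..n} \<le> card (\<Union>x\<in>R. {j. t j = x})"
      using R fin by (intro card_mono) auto
    moreover have "card {j. s j \<le> t n} \<le> card {..<n}"
      using sub by (intro card_mono) auto
    ultimately show False by simp
  qed
  show ?thesis
    using le[OF assms] le[OF t s range[symmetric] fin(2) fin(1) card[symmetric]]
    by (auto intro: antisym simp: fun_eq_iff)
qed

section \<open>Compact positive operators on a pre-Hilbert space\<close>

lemma discriminant_nonneg_form:
  fixes a b c :: real
  assumes nonneg: "\<And>t. 0 \<le> a + 2 * t * b + t\<^sup>2 * c" and c: "0 \<le> c"
  shows "b\<^sup>2 \<le> a * c"
proof (cases "c = 0")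
  case True
  have "b = 0"
  proof (rule ccontr)
    assume "b \<noteq> 0"
    then show False
      using nonneg[of "- (a + 1) / (2 * b)"] True by (simp add: field_simps)
  qed
  then show ?thesis using True by simp
next
  case False
  then have c: "c > 0" using c by simp
  show ?thesis
    using nonneg[of "- b / c"] c by (simp add: field_simps power2_eq_square)
qed

text \<open>
  The set \<open>H\<close> with \<open>ip\<close> is only a pre-Hilbert space, and the topology stays implicit: compactness of \<open>K\<close>
  means that the image of a bounded sequence has a subsequence that converges in the norm of
  \<open>ip\<close> to an element of \<open>H\<close>. This suffices because an eigenvector is a limit of images \<open>K x\<close>, never
  of the vectors \<open>x\<close> themselves. The bound 1 on the operator is a normalisation.
\<close>

locale compact_positive_operator = vector_space scale
  for scale :: "real \<Rightarrow> 'a::ab_group_add \<Rightarrow> 'a" (infixr "*s" 75) +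
  fixes H :: "'a set" and ip :: "'a \<Rightarrow> 'a \<Rightarrow> real" and K :: "'a \<Rightarrow> 'a"
  assumes subspace_H: "subspace H"
    and ip_add: "\<And>x y z. x \<in> H \<Longrightarrow> y \<in> H \<Longrightarrow> z \<in> H \<Longrightarrow> ip (x + y) z = ip x z + ip y z"
    and ip_scale: "\<And>c x z. x \<in> H \<Longrightarrow> z \<in> H \<Longrightarrow> ip (c *s x) z = c * ip x z"
    and ip_sym: "\<And>x y. x \<in> H \<Longrightarrow> y \<in> H \<Longrightarrow> ip x y = ip y x"
    and ip_pos: "\<And>x. x \<in> H \<Longrightarrow> x \<noteq> 0 \<Longrightarrow> 0 < ip x x"
    and K_mem: "\<And>x. x \<in> H \<Longrightarrow> K x \<in> H"
    and K_add: "\<And>x y. x \<in> H \<Longrightarrow> y \<in> H \<Longrightarrow> K (x + y) = K x + K y"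
    and K_scale: "\<And>c x. x \<in> H \<Longrightarrow> K (c *s x) = c *s K x"
    and K_sym: "\<And>x y. x \<in> H \<Longrightarrow> y \<in> H \<Longrightarrow> ip (K x) y = ip x (K y)"
    and K_pos: "\<And>x. x \<in> H \<Longrightarrow> x \<noteq> 0 \<Longrightarrow> 0 < ip (K x) x"
    and K_bound: "\<And>x. x \<in> H \<Longrightarrow> ip (K x) x \<le> ip x x"
    and K_compact: "\<And>X :: nat \<Rightarrow> 'a. (\<And>n. X n \<in> H) \<Longrightarrow> (\<And>n. ip (X n) (X n) \<le> 1) \<Longrightarrow>
      \<exists>r y. strict_mono (r :: nat \<Rightarrow> nat) \<and> y \<in> H \<and>
        (\<lambda>n. ip (K (X (r n)) - y) (K (X (r n)) - y)) \<longlonglongrightarrow> 0"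
    and infinite_dim: "\<And>F. finite F \<Longrightarrow> F \<subseteq> H \<Longrightarrow> \<exists>x\<in>H. x \<noteq> 0 \<and> (\<forall>y\<in>F. ip x y = 0)"
begin

lemma H_closed [simp, intro]:
  "0 \<in> H" "x \<in> H \<Longrightarrow> y \<in> H \<Longrightarrow> x + y \<in> H" "x \<in> H \<Longrightarrow> y \<in> H \<Longrightarrow> x - y \<in> H" "x \<in> H \<Longrightarrow> c *s x \<in> H"
  "x \<in> H \<Longrightarrow> - x \<in> H"
  using subspace_H by (auto intro: subspace_neg subspace_0 subspace_add subspace_diff subspace_scale)

lemma H_sum: "(\<And>i. i \<in> A \<Longrightarrow> f i \<in> H) \<Longrightarrow> sum f A \<in> H"
  using subspace_H by (rule subspace_sum)

lemma ip_add_right: "x \<in> H \<Longrightarrow> y \<in> H \<Longrightarrow> z \<in> H \<Longrightarrow> ip x (y + z) = ip x y + ip x z"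
  by (simp add: ip_sym[of x] ip_add)

lemma ip_scale_right: "x \<in> H \<Longrightarrow> y \<in> H \<Longrightarrow> ip x (c *s y) = c * ip x y"
  by (simp add: ip_sym[of x] ip_scale)

lemma ip_zero: "x \<in> H \<Longrightarrow> ip 0 x = 0" "x \<in> H \<Longrightarrow> ip x 0 = 0"
  using ip_scale[of x x 0] ip_scale_right[of x x 0] by simp_all

lemma ip_diff:
  assumes "x \<in> H" "y \<in> H" "z \<in> H"
  shows "ip (x - y) z = ip x z - ip y z" "ip z (x - y) = ip z x - ip z y"
proof -
  have "x - y = x + (-1) *s y" by simp
  then show "ip (x - y) z = ip x z - ip y z"
    using assms ip_add[of x "(-1) *s y" z] ip_scale[of y z "-1"] by simp
  then show "ip z (x - y) = ip z x - ip z y"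
    using assms by (simp add: ip_sym[of z])
qed

lemma K_diff: "x \<in> H \<Longrightarrow> y \<in> H \<Longrightarrow> K (x - y) = K x - K y"
proof -
  assume "x \<in> H" "y \<in> H"
  moreover have "x - y = x + (-1) *s y" by simp
  ultimately show "K (x - y) = K x - K y"
    using K_add[of x "(-1) *s y"] K_scale[of y "-1"] by simp
qed

lemma ip_nonneg: "x \<in> H \<Longrightarrow> 0 \<le> ip x x"
  using ip_pos[of x] ip_zero[of x] by (cases "x = 0") auto

lemma K_zero [simp]: "K 0 = 0"
  using K_scale[of 0 0] by simp

lemma K_nonneg: "x \<in> H \<Longrightarrow> 0 \<le> ip (K x) x"
  using K_pos[of x] by (cases "x = 0") (auto simp: ip_zero)

lemma ip_sum: "finite A \<Longrightarrow> (\<And>i. i \<in> A \<Longrightarrow> f i \<in> H) \<Longrightarrow> x \<in> H \<Longrightarrow> ip (sum f A) x = (\<Sum>i\<in>A. ip (f i) x)"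
  by (induction A rule: finite_induct) (auto simp: ip_zero ip_add H_sum)

lemma cauchy_schwarz:
  assumes "x \<in> H" "y \<in> H"
  shows "(ip x y)\<^sup>2 \<le> ip x x * ip y y"
proof (rule discriminant_nonneg_form)
  fix t :: real
  have "0 \<le> ip (x + t *s y) (x + t *s y)" using assms by (intro ip_nonneg) auto
  also have "\<dots> = ip x x + 2 * t * ip x y + t\<^sup>2 * ip y y"
    using assms by (simp add: ip_add ip_add_right ip_scale_right ip_scale ip_sym[of y x] power2_eq_square algebra_simps)
  finally show "0 \<le> ip x x + 2 * t * ip x y + t\<^sup>2 * ip y y" .
qed (use assms ip_nonneg in auto)

lemma cauchy_schwarz_K:
  assumes "x \<in> H" "y \<in> H"
  shows "(ip (K x) y)\<^sup>2 \<le> ip (K x) x * ip (K y) y"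
proof (rule discriminant_nonneg_form)
  fix t :: real
  have "0 \<le> ip (K (x + t *s y)) (x + t *s y)" using assms by (intro K_nonneg) auto
  also have "\<dots> = ip (K x) x + 2 * t * ip (K x) y + t\<^sup>2 * ip (K y) y"
  proof -
    have "ip (K y) x = ip (K x) y" using assms by (simp add: K_sym K_mem ip_sym[of y])
    then show ?thesis
      using assms
      by (simp add: ip_add ip_add_right ip_scale_right ip_scale K_mem K_add K_scale power2_eq_square algebra_simps)
  qed
  finally show "0 \<le> ip (K x) x + 2 * t * ip (K x) y + t\<^sup>2 * ip (K y) y" .
qed (use assms K_nonneg in auto)

lemma parallelogram_bound:
  assumes "x \<in> H" "y \<in> H"
  shows "ip (x - y) (x - y) \<le> 2 * ip x x + 2 * ip y y"
proof -
  have "0 \<le> ip (x + y) (x + y)" using assms by (intro ip_nonneg) auto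
  then show ?thesis using assms by (simp add: ip_add ip_add_right ip_scale_right ip_diff ip_sym[of y x])
qed

text \<open>
  The inequality of Cauchy and Schwarz for the form \<open>ip (K x) y\<close>, applied to \<open>x\<close> and \<open>K x\<close>.
\<close>

lemma norm_K_le:
  assumes x: "x \<in> H" and le: "ip (K (K x)) (K x) \<le> \<kappa> * ip (K x) (K x)"
  shows "ip (K x) (K x) \<le> \<kappa> * ip (K x) x"
proof (cases "K x = 0")
  case True then show ?thesis using x by (simp add: ip_zero)
next
  case False
  define N where "N = ip (K x) (K x)"
  have N: "N > 0" unfolding N_def using x False by (intro ip_pos) (auto intro: K_mem)
  have "N * N \<le> ip (K x) x * ip (K (K x)) (K x)"
    using cauchy_schwarz_K[of x "K x"] x by (simp add: N_def K_mem power2_eq_square)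
  also have "\<dots> \<le> ip (K x) x * (\<kappa> * N)"
    using le K_nonneg[OF x] by (intro mult_left_mono) (auto simp: N_def)
  finally have "N * N \<le> (\<kappa> * ip (K x) x) * N" by (simp add: algebra_simps)
  then show ?thesis using N by (simp add: N_def)
qed

lemma norm_K_le_norm: "x \<in> H \<Longrightarrow> ip (K x) (K x) \<le> ip x x"
  using norm_K_le[of x 1] K_bound[of x] K_bound[of "K x"] by (simp add: K_mem)

text \<open>
  On the orthogonal complement of finitely many eigenvectors, \<open>K\<close> attains the supremum \<open>\<kappa>\<close> of its Rayleigh
  quotient at an eigenvector. Indeed \<open>norm_K_le\<close> gives
  \<open>\<parallel>K x - \<kappa> x\<parallel>\<^sup>2 \<le> \<kappa> (\<kappa> - ip (K x) x)\<close> for unit vectors \<open>x\<close>, so along a maximising sequence \<open>\<kappa> x\<close> has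
  the same limit points as \<open>K x\<close>, and these exist by compactness.
\<close>

lemma top_eigenvector:
  assumes F: "finite F" "F \<subseteq> H" and eig: "\<And>y. y \<in> F \<Longrightarrow> \<exists>c. K y = c *s y"
  defines "M \<equiv> {x \<in> H. \<forall>y\<in>F. ip x y = 0}"
  shows "\<exists>e \<kappa>. e \<in> M \<and> ip e e = 1 \<and> 0 < \<kappa> \<and> K e = \<kappa> *s e \<and> (\<forall>x\<in>M. ip (K x) x \<le> \<kappa> * ip x x)"
proof -
  have MH: "x \<in> H" if "x \<in> M" for x using that by (simp add: M_def)
  have KM: "K x \<in> M" if "x \<in> M" for x
  proof -
    have "ip (K x) y = 0" if "y \<in> F" for y
    proof -
      obtain c where "K y = c *s y" using eig[OF \<open>y \<in> F\<close>] by blast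
      then show ?thesis using \<open>x \<in> M\<close> \<open>y \<in> F\<close> F by (auto simp: M_def K_sym ip_scale_right subset_iff)
    qed
    then show ?thesis using that by (simp add: M_def K_mem)
  qed
  have scaleM: "c *s x \<in> M" if "x \<in> M" for x c
    using that F by (auto simp: M_def ip_scale subset_iff)
  define unit where "unit = {x \<in> M. ip x x = 1}"
  have normalise: "(1 / sqrt (ip x x)) *s x \<in> unit" if "x \<in> M" "x \<noteq> 0" for x
  proof -
    have "ip x x > 0" "x \<in> H" using that MH ip_pos by auto
    then have "ip ((1 / sqrt (ip x x)) *s x) ((1 / sqrt (ip x x)) *s x) = 1"
      by (simp add: ip_scale ip_scale_right)
    then show ?thesis using scaleM[OF that(1)] by (simp add: unit_def)
  qed
  define \<kappa> where "\<kappa> = (SUP x\<in>unit. ip (K x) x)"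
  have bdd: "bdd_above ((\<lambda>x. ip (K x) x) ` unit)"
  proof (rule bdd_aboveI2)
    fix x assume "x \<in> unit"
    then show "ip (K x) x \<le> 1" using K_bound[of x] MH[of x] by (simp add: unit_def)
  qed
  obtain x0 where "x0 \<in> M" "x0 \<noteq> 0"
    using infinite_dim[OF F] by (auto simp: M_def)
  then obtain x1 where x1: "x1 \<in> unit" using normalise by blast
  have "x1 \<noteq> 0" "x1 \<in> H" using x1 MH by (auto simp: unit_def ip_zero)
  then have "0 < ip (K x1) x1" by (intro K_pos)
  also have "\<dots> \<le> \<kappa>" unfolding \<kappa>_def using bdd x1 by (intro cSUP_upper)
  finally have \<kappa>: "0 < \<kappa>" .
  have le: "ip (K x) x \<le> \<kappa> * ip x x" if "x \<in> M" for x
  proof (cases "x = 0")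
    case True then show ?thesis by (simp add: ip_zero)
  next
    case False
    then have pos: "0 < ip x x" using MH[OF that] by (intro ip_pos)
    define s where "s = 1 / sqrt (ip x x)"
    have "ip (K (s *s x)) (s *s x) \<le> \<kappa>"
      unfolding \<kappa>_def s_def using bdd normalise[OF that False] by (intro cSUP_upper)
    then have "s * s * ip (K x) x \<le> \<kappa>"
      using MH[OF that] by (simp add: K_scale ip_scale ip_scale_right K_mem)
    moreover have "s * s = 1 / ip x x" using pos by (simp add: s_def)
    ultimately show ?thesis using pos by (simp add: field_simps)
  qed
  have "\<exists>x\<in>unit. \<kappa> - 1 / real (Suc n) < ip (K x) x" for n
    using less_cSUP_iff[of unit "\<lambda>x. ip (K x) x" "\<kappa> - 1 / real (Suc n)"] bdd x1
    by (auto simp: \<kappa>_def)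
  then obtain X where X: "\<And>n. X n \<in> unit" "\<And>n. \<kappa> - 1 / real (Suc n) < ip (K (X n)) (X n)"
    by metis
  have XM: "X n \<in> M" "X n \<in> H" "ip (X n) (X n) = 1" for n
    using X(1)[of n] MH by (auto simp: unit_def)
  have "\<exists>r y. strict_mono (r :: nat \<Rightarrow> nat) \<and> y \<in> H \<and>
        (\<lambda>n. ip (K (X (r n)) - y) (K (X (r n)) - y)) \<longlonglongrightarrow> 0"
    using XM by (intro K_compact) auto
  then obtain r y where r: "strict_mono (r :: nat \<Rightarrow> nat)" and y: "y \<in> H"
    and lim: "(\<lambda>n. ip (K (X (r n)) - y) (K (X (r n)) - y)) \<longlonglongrightarrow> 0" by blast
  \<comment> \<open>A maximising sequence consists of approximate eigenvectors.\<close>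
  have approx: "(\<lambda>n. ip (K (X n) - \<kappa> *s X n) (K (X n) - \<kappa> *s X n)) \<longlonglongrightarrow> 0"
  proof (rule tendsto_sandwich[OF _ _ tendsto_const])
    show "\<forall>\<^sub>F n in sequentially. 0 \<le> ip (K (X n) - \<kappa> *s X n) (K (X n) - \<kappa> *s X n)"
      using XM by (auto intro!: always_eventually ip_nonneg K_mem)
    have "ip (K (X n) - \<kappa> *s X n) (K (X n) - \<kappa> *s X n) \<le> \<kappa> * (1 / real (Suc n))" for n
    proof -
      have "ip (K (X n) - \<kappa> *s X n) (K (X n) - \<kappa> *s X n) =
          ip (K (X n)) (K (X n)) - 2 * \<kappa> * ip (K (X n)) (X n) + \<kappa>\<^sup>2"
        using XM[of n] ip_sym[of "X n" "K (X n)"]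
        by (simp add: ip_diff ip_scale ip_scale_right K_mem power2_eq_square algebra_simps)
      moreover have "ip (K (X n)) (K (X n)) \<le> \<kappa> * ip (K (X n)) (X n)"
        using XM le KM by (intro norm_K_le) auto
      ultimately have "ip (K (X n) - \<kappa> *s X n) (K (X n) - \<kappa> *s X n) \<le> \<kappa> * (\<kappa> - ip (K (X n)) (X n))"
        by (simp add: algebra_simps power2_eq_square)
      also have "\<dots> \<le> \<kappa> * (1 / real (Suc n))"
        using X(2)[of n] \<kappa> by (intro mult_left_mono) auto
      finally show ?thesis .
    qed
    then show "\<forall>\<^sub>F n in sequentially.
        ip (K (X n) - \<kappa> *s X n) (K (X n) - \<kappa> *s X n) \<le> \<kappa> * (1 / real (Suc n))"
      by (rule always_eventually[rule_format])
    show "(\<lambda>n. \<kappa> * (1 / real (Suc n))) \<longlonglongrightarrow> 0"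
      using tendsto_mult[OF tendsto_const LIMSEQ_inverse_real_of_nat, of \<kappa>]
      by (simp add: inverse_eq_divide)
  qed
  define d where "d = (\<lambda>n. \<kappa> *s X (r n) - y)"
  have dH: "d n \<in> H" for n using XM y by (auto simp: d_def)
  have d0: "(\<lambda>n. ip (d n) (d n)) \<longlonglongrightarrow> 0"
  proof (rule tendsto_sandwich[OF _ _ tendsto_const])
    show "\<forall>\<^sub>F n in sequentially. 0 \<le> ip (d n) (d n)"
      using dH by (auto intro!: always_eventually ip_nonneg)
    have "ip (d n) (d n) \<le> 2 * ip (K (X (r n)) - y) (K (X (r n)) - y) +
        2 * ip (K (X (r n)) - \<kappa> *s X (r n)) (K (X (r n)) - \<kappa> *s X (r n))" for n
      using parallelogram_bound[of "K (X (r n)) - y" "K (X (r n)) - \<kappa> *s X (r n)"] XM y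
      by (simp add: d_def K_mem)
    then show "\<forall>\<^sub>F n in sequentially. ip (d n) (d n) \<le> 2 * ip (K (X (r n)) - y) (K (X (r n)) - y) +
        2 * ip (K (X (r n)) - \<kappa> *s X (r n)) (K (X (r n)) - \<kappa> *s X (r n))"
      by (rule always_eventually[rule_format])
    show "(\<lambda>n. 2 * ip (K (X (r n)) - y) (K (X (r n)) - y) +
        2 * ip (K (X (r n)) - \<kappa> *s X (r n)) (K (X (r n)) - \<kappa> *s X (r n))) \<longlonglongrightarrow> 0"
      using tendsto_add[OF tendsto_mult[OF tendsto_const lim, of 2]
          tendsto_mult[OF tendsto_const LIMSEQ_subseq_LIMSEQ[OF approx r], of 2]]
      by (simp add: o_def)
  qed
  have y0: "y \<noteq> 0"
  proof
    assume "y = 0"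
    then have "ip (d n) (d n) = \<kappa>\<^sup>2" for n
      using XM by (simp add: d_def ip_scale ip_scale_right power2_eq_square)
    then show False using d0 \<kappa> by (simp add: LIMSEQ_const_iff)
  qed
  have yM: "y \<in> M"
  proof -
    have "ip y f = 0" if f: "f \<in> F" for f
    proof -
      have fH: "f \<in> H" using f F by auto
      have "(ip y f)\<^sup>2 \<le> ip (d n) (d n) * ip f f" for n
      proof -
        have "ip (d n) f = - ip y f"
          using XM(1)[of "r n"] XM(2) y fH f by (simp add: d_def ip_diff ip_scale M_def)
        then show ?thesis using cauchy_schwarz[OF dH fH, of n] by simp
      qed
      then have "(ip y f)\<^sup>2 \<le> 0 * ip f f"
        by (intro LIMSEQ_le_const[OF tendsto_mult[OF d0 tendsto_const]]) auto
      then show ?thesis by simp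
    qed
    then show ?thesis using y by (simp add: M_def)
  qed
  have Ky: "K y = \<kappa> *s y"
  proof (rule ccontr)
    assume "K y \<noteq> \<kappa> *s y"
    define z where "z = K y - \<kappa> *s y"
    have zH: "z \<in> H" "z \<noteq> 0" using y \<open>K y \<noteq> \<kappa> *s y\<close> by (auto simp: z_def K_mem)
    have "ip z z \<le> 2 * (\<kappa>\<^sup>2 * ip (K (X (r n)) - y) (K (X (r n)) - y)) + 2 * ip (d n) (d n)" for n
    proof -
      have "z = \<kappa> *s (K (X (r n)) - y) - K (d n)"
        using XM y by (simp add: z_def d_def K_diff K_scale scale_right_diff_distrib)
      then have "ip z z \<le> 2 * ip (\<kappa> *s (K (X (r n)) - y)) (\<kappa> *s (K (X (r n)) - y)) + 2 * ip (K (d n)) (K (d n))"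
        using parallelogram_bound[of "\<kappa> *s (K (X (r n)) - y)" "K (d n)"] XM y dH by (simp add: K_mem)
      then show ?thesis
        using norm_K_le_norm[OF dH, of n] XM y
        by (simp add: ip_scale ip_scale_right K_mem power2_eq_square)
    qed
    then have "ip z z \<le> 2 * (\<kappa>\<^sup>2 * 0) + 2 * 0"
      by (intro LIMSEQ_le_const[OF tendsto_add[OF tendsto_mult[OF tendsto_const
          tendsto_mult[OF tendsto_const lim]] tendsto_mult[OF tendsto_const d0]]]) auto
    then show False using ip_pos[OF zH] by simp
  qed
  define e where "e = (1 / sqrt (ip y y)) *s y"
  have "e \<in> unit" unfolding e_def using yM y0 by (rule normalise)
  moreover have "K e = \<kappa> *s e" using y by (simp add: e_def K_scale Ky mult.commute)
  ultimately show ?thesis using \<kappa> le by (auto simp: unit_def)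
qed

theorem eigenbasis_exists:
  "\<exists>e \<kappa>. (\<forall>n. e n \<in> H \<and> K (e n) = \<kappa> n *s e n \<and> 0 < \<kappa> n) \<and>
    (\<forall>m n. ip (e m) (e n) = (if m = n then 1 else 0)) \<and> decseq \<kappa> \<and>
    (\<forall>n x. x \<in> H \<longrightarrow> (\<forall>i<n. ip x (e i) = 0) \<longrightarrow> ip (K x) x \<le> \<kappa> n * ip x x)"
proof -
  define top where "top = (\<lambda>F p. (\<forall>y\<in>F. ip (fst p) y = 0) \<and> fst p \<in> H \<and> ip (fst p) (fst p) = 1 \<and>
    0 < snd p \<and> K (fst p) = snd p *s fst p \<and>
    (\<forall>x\<in>H. (\<forall>y\<in>F. ip x y = 0) \<longrightarrow> ip (K x) x \<le> snd p * ip x x))"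
  define pick where "pick = (\<lambda>F. SOME p. top F p)"
  define F where "F = rec_nat {} (\<lambda>n A. insert (fst (pick A)) A)"
  define e where "e = (\<lambda>n. fst (pick (F n)))"
  define \<kappa> where "\<kappa> = (\<lambda>n. snd (pick (F n)))"
  have F_Suc: "F (Suc n) = insert (e n) (F n)" and F_0: "F 0 = {}" for n
    by (simp_all add: F_def e_def)
  have F_image: "F n = e ` {..<n}" for n
    by (induction n) (simp_all add: F_0 F_Suc lessThan_Suc)
  have top: "top (F n) (pick (F n))"
    if n: "finite (F n)" "F n \<subseteq> H" "\<And>y. y \<in> F n \<Longrightarrow> \<exists>c. K y = c *s y" for n
  proof -
    obtain x k where "x \<in> {x \<in> H. \<forall>y\<in>F n. ip x y = 0}" "ip x x = 1" "0 < k" "K x = k *s x"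
      "\<forall>z\<in>{x \<in> H. \<forall>y\<in>F n. ip x y = 0}. ip (K z) z \<le> k * ip z z"
      using top_eigenvector[OF n] by blast
    then have "top (F n) (x, k)" unfolding top_def by simp
    then show ?thesis unfolding pick_def by (rule someI)
  qed
  have good: "finite (F n) \<and> F n \<subseteq> H \<and> (\<forall>y\<in>F n. \<exists>c. K y = c *s y)" for n
  proof (induction n)
    case (Suc n)
    then have "top (F n) (pick (F n))" by (intro top) auto
    with Suc show ?case by (auto simp: F_Suc top_def e_def)
  qed (simp add: F_0)
  have T: "top (F n) (e n, \<kappa> n)" for n
    using top[of n] good[of n] by (simp add: e_def \<kappa>_def)
  have e: "e n \<in> H \<and> K (e n) = \<kappa> n *s e n \<and> 0 < \<kappa> n" and norm: "ip (e n) (e n) = 1"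
    and orth: "i < n \<Longrightarrow> ip (e n) (e i) = 0"
    and max: "x \<in> H \<Longrightarrow> (\<forall>i<n. ip x (e i) = 0) \<Longrightarrow> ip (K x) x \<le> \<kappa> n * ip x x" for n i x
    using T[of n] by (auto simp: top_def F_image)
  have "ip (e m) (e n) = (if m = n then 1 else 0)" for m n
    using norm[of n] orth[of m n] orth[of n m] ip_sym[of "e m" "e n"] e
    by (cases m n rule: linorder_cases) auto
  moreover have "decseq \<kappa>"
  proof (rule decseq_SucI)
    fix n
    have "ip (K (e (Suc n))) (e (Suc n)) \<le> \<kappa> n * ip (e (Suc n)) (e (Suc n))"
      using e orth by (intro max) auto
    then show "\<kappa> (Suc n) \<le> \<kappa> n" using e norm by (simp add: ip_scale)
  qed
  ultimately show ?thesis using e max by (intro exI[of _ e] exI[of _ \<kappa>]) auto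
qed

end

locale compact_positive_eigenbasis = compact_positive_operator +
  fixes e :: "nat \<Rightarrow> 'a" and \<kappa> :: "nat \<Rightarrow> real"
  assumes e_mem: "\<And>n. e n \<in> H" and K_e: "\<And>n. K (e n) = \<kappa> n *s e n" and \<kappa>_pos: "\<And>n. 0 < \<kappa> n"
    and orthonormal: "\<And>m n. ip (e m) (e n) = (if m = n then 1 else 0)"
    and decseq_\<kappa>: "decseq \<kappa>"
    and K_le: "\<And>n x. x \<in> H \<Longrightarrow> (\<And>i. i < n \<Longrightarrow> ip x (e i) = 0) \<Longrightarrow> ip (K x) x \<le> \<kappa> n * ip x x"
begin

text \<open>
  Orthonormal eigenvectors with eigenvalues at least \<open>c\<close> have images at mutual distance at least
  \<open>sqrt 2 * c\<close>, which contradicts compactness.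
\<close>

lemma eventually_\<kappa>_less:
  assumes c: "c > 0"
  shows "\<exists>n. \<kappa> n < c"
proof (rule ccontr)
  assume "\<not> ?thesis"
  then have ge: "\<kappa> n \<ge> c" for n by (simp add: not_less)
  have "\<exists>r y. strict_mono (r :: nat \<Rightarrow> nat) \<and> y \<in> H \<and>
      (\<lambda>n. ip (K (e (r n)) - y) (K (e (r n)) - y)) \<longlonglongrightarrow> 0"
    by (intro K_compact) (auto simp: e_mem orthonormal)
  then obtain r y where r: "strict_mono (r :: nat \<Rightarrow> nat)" and y: "y \<in> H"
    and lim: "(\<lambda>n. ip (K (e (r n)) - y) (K (e (r n)) - y)) \<longlonglongrightarrow> 0" by blast
  have "2 * c\<^sup>2 \<le> 2 * ip (K (e (r n)) - y) (K (e (r n)) - y) +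
      2 * ip (K (e (r (Suc n))) - y) (K (e (r (Suc n))) - y)" for n
  proof -
    have ne: "r n \<noteq> r (Suc n)" using strict_monoD[OF r, of n "Suc n"] by simp
    have "2 * c\<^sup>2 \<le> \<kappa> (r n) * \<kappa> (r n) + \<kappa> (r (Suc n)) * \<kappa> (r (Suc n))"
      using ge[of "r n"] ge[of "r (Suc n)"] c
      mult_mono[of c "\<kappa> (r n)" c "\<kappa> (r n)"]
      mult_mono[of c "\<kappa> (r (Suc n))" c "\<kappa> (r (Suc n))"] by (auto simp: power2_eq_square)
    also have "\<dots> = ip (K (e (r n)) - K (e (r (Suc n)))) (K (e (r n)) - K (e (r (Suc n))))"
      using ne by (simp add: K_e ip_diff ip_scale ip_scale_right e_mem orthonormal)
    also have "\<dots> \<le> 2 * ip (K (e (r n)) - y) (K (e (r n)) - y) +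
      2 * ip (K (e (r (Suc n))) - y) (K (e (r (Suc n))) - y)"
      using parallelogram_bound[of "K (e (r n)) - y" "K (e (r (Suc n))) - y"] y
      by (simp add: K_mem e_mem)
    finally show ?thesis .
  qed
  then have "2 * c\<^sup>2 \<le> 2 * 0 + 2 * 0"
    by (intro LIMSEQ_le_const[OF tendsto_add[OF tendsto_mult[OF tendsto_const lim]
        tendsto_mult[OF tendsto_const LIMSEQ_Suc[OF lim]]]]) auto
  then show False using c by simp
qed

lemma finite_\<kappa>_ge: "c > 0 \<Longrightarrow> finite {n. c \<le> \<kappa> n}"
proof -
  assume "c > 0"
  then obtain m where m: "\<kappa> m < c" using eventually_\<kappa>_less by blast
  have "{n. c \<le> \<kappa> n} \<subseteq> {..<m}"
  proof
    fix n assume "n \<in> {n. c \<le> \<kappa> n}"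
    then show "n \<in> {..<m}" using m decseqD[OF decseq_\<kappa>, of m n] by (cases "n < m") auto
  qed
  then show ?thesis by (rule finite_subset) simp
qed

lemma finite_\<kappa>_eq: "finite {n. \<kappa> n = c}"
proof (cases "c > 0")
  case True
  then show ?thesis using finite_subset[OF _ finite_\<kappa>_ge[OF True], of "{n. \<kappa> n = c}"] by auto
next
  case False
  then have "{n. \<kappa> n = c} = {}" using \<kappa>_pos by auto
  then show ?thesis by simp
qed

text \<open>
  The eigenvectors found by maximisation are all there are: what remains of an eigenvector after projection
  is orthogonal to every \<open>e n\<close>, so its eigenvalue would be at most every \<open>\<kappa> n\<close>, and these tend to zero.
\<close>

lemma eigenspace_eq_span:
  assumes c: "c > 0"
  shows "{x \<in> H. K x = c *s x} = span (e ` {n. \<kappa> n = c})"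
proof
  show "span (e ` {n. \<kappa> n = c}) \<subseteq> {x \<in> H. K x = c *s x}"
  proof (rule span_minimal)
    show "subspace {x \<in> H. K x = c *s x}"
      by (auto simp: subspace_def K_add K_scale scale_right_distrib mult.commute)
  qed (auto simp: e_mem K_e)
  show "{x \<in> H. K x = c *s x} \<subseteq> span (e ` {n. \<kappa> n = c})"
  proof clarify
    fix x assume x: "x \<in> H" "K x = c *s x"
    define S where "S = {n. \<kappa> n = c}"
    have S: "finite S" by (simp add: S_def finite_\<kappa>_eq)
    define p where "p = (\<Sum>n\<in>S. ip x (e n) *s e n)"
    have p_span: "p \<in> span (e ` S)"
      unfolding p_def by (intro span_sum span_scale span_base) auto
    have p: "p \<in> H" unfolding p_def by (intro H_sum H_closed e_mem)
    have Kp: "K p = c *s p"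
      using \<open>span (e ` {n. \<kappa> n = c}) \<subseteq> _\<close> p_span by (auto simp: S_def)
    define z where "z = x - p"
    have z: "z \<in> H" "K z = c *s z"
      using x p Kp by (simp_all add: z_def K_diff scale_right_diff_distrib)
    have "ip z (e i) = 0" for i
    proof (cases "i \<in> S")
      case True
      have "ip p (e i) = (\<Sum>n\<in>S. if n = i then ip x (e n) else 0)"
        unfolding p_def using S by (subst ip_sum) (auto simp: e_mem ip_scale orthonormal if_distrib cong: if_cong intro!: sum.cong)
      then show ?thesis using True S x p by (simp add: z_def ip_diff e_mem)
    next
      case False
      have "c * ip z (e i) = \<kappa> i * ip z (e i)"
        using K_sym[of z "e i"] z e_mem[of i] by (simp add: K_e ip_scale ip_scale_right)
      then show ?thesis using False by (simp add: S_def)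
    qed
    then have "c * ip z z \<le> \<kappa> n * ip z z" for n
      using K_le[of z n] z by (simp add: ip_scale)
    moreover obtain n where "\<kappa> n < c" using eventually_\<kappa>_less[OF c] by blast
    ultimately have "\<not> 0 < ip z z" by (metis linorder_not_less mult_less_cancel_right_pos)
    then have "z = 0" using ip_pos z(1) by blast
    then show "x \<in> span (e ` {n. \<kappa> n = c})" using p_span by (simp add: z_def S_def)
  qed
qed

lemma inj_e: "inj e"
  by (rule injI) (metis orthonormal zero_neq_one)

lemma e_nonzero: "e n \<noteq> 0"
  using orthonormal[of n n] by (auto simp: ip_zero)

lemma independent_e: "finite A \<Longrightarrow> independent (e ` A)"
proof (rule independent_if_scalars_zero)
  fix f x assume A: "finite A" and sum: "(\<Sum>x\<in>e ` A. f x *s x) = 0" and "x \<in> e ` A"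
  then obtain n where n: "n \<in> A" "x = e n" by auto
  have "0 = ip (\<Sum>m\<in>A. f (e m) *s e m) (e n)"
    using sum by (simp add: sum.reindex inj_on_subset[OF inj_e] ip_zero e_mem)
  also have "\<dots> = (\<Sum>m\<in>A. if m = n then f (e m) else 0)"
    using A by (subst ip_sum) (auto simp: e_mem ip_scale orthonormal if_distrib cong: if_cong intro!: sum.cong)
  also have "\<dots> = f x" using A n by simp
  finally show "f x = 0" by simp
qed simp

lemma dim_eigenspace:
  assumes "c > 0"
  shows "dim {x \<in> H. K x = c *s x} = card {n. \<kappa> n = c}"
proof -
  have "dim {x \<in> H. K x = c *s x} = card (e ` {n. \<kappa> n = c})"
    unfolding eigenspace_eq_span[OF assms]
    by (intro dim_span_eq_card_independent independent_e finite_\<kappa>_eq)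
  also have "\<dots> = card {n. \<kappa> n = c}"
    by (intro card_image inj_on_subset[OF inj_e]) auto
  finally show ?thesis .
qed

lemma eigenvalue_iff:
  assumes "c > 0"
  shows "(\<exists>x\<in>H. K x = c *s x \<and> x \<noteq> 0) \<longleftrightarrow> c \<in> range \<kappa>"
proof
  assume "c \<in> range \<kappa>"
  then show "\<exists>x\<in>H. K x = c *s x \<and> x \<noteq> 0" using e_mem K_e e_nonzero by auto
next
  assume "\<exists>x\<in>H. K x = c *s x \<and> x \<noteq> 0"
  then obtain x where "x \<in> span (e ` {n. \<kappa> n = c})" "x \<noteq> 0"
    using eigenspace_eq_span[OF assms] by blast
  then have "{n. \<kappa> n = c} \<noteq> {}" by (metis image_empty empty_iff insertE span_empty)
  then show "c \<in> range \<kappa>" by auto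
qed

end

section \<open>The Neumann problem on a metric graph\<close>

text \<open>
  Connectedness enters the spectral theory only through \<open>incident\<close>: a function on the vertices is
  determined by the function on the edges that it bounds.
\<close>

locale metric_graph = fin_digraph G for G :: "('v, 'e) pre_digraph" +
  fixes l :: "'e \<Rightarrow> real"
  assumes metric: "graph_metric G l"
    and arcs_nonempty: "arcs G \<noteq> {}"
    and incident: "\<And>v. v \<in> verts G \<Longrightarrow> \<exists>e\<in>arcs G. tail G e = v \<or> head G e = v"
begin

lemma l_pos: "e \<in> arcs G \<Longrightarrow> 0 < l e"
  using metric by (simp add: graph_metric_def)

text \<open>
  The operators act on functions that are continuous on each edge, with no condition at the vertices.
  Continuity across the vertices is a property of the solutions.
\<close>

definition edge_fun :: "('e \<Rightarrow> real \<Rightarrow> real) set" where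
  "edge_fun = {f. (\<forall>e x. e \<notin> arcs G \<or> x \<notin> {0..l e} \<longrightarrow> f e x = 0) \<and>
     (\<forall>e\<in>arcs G. continuous_on {0..l e} (f e))}"

definition ip :: "('e \<Rightarrow> real \<Rightarrow> real) \<Rightarrow> ('e \<Rightarrow> real \<Rightarrow> real) \<Rightarrow> real" where
  "ip f g = (\<Sum>e\<in>arcs G. integral {0..l e} (\<lambda>x. f e x * g e x))"

definition dirichlet :: "('e \<Rightarrow> real \<Rightarrow> real) \<Rightarrow> real" where
  "dirichlet f' = (\<Sum>e\<in>arcs G. integral {0..l e} (\<lambda>x. (f' e x)\<^sup>2))"

text \<open>
  The problem \<open>- u'' + u = f\<close> with continuity and Kirchhoff conditions at the vertices. With
  \<open>f = (1 + \<mu>) u\<close> it is the eigenvalue equation \<open>- u'' = \<mu> u\<close>.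
\<close>

definition solves :: "('e \<Rightarrow> real \<Rightarrow> real) \<Rightarrow> ('e \<Rightarrow> real \<Rightarrow> real) \<Rightarrow> ('e \<Rightarrow> real \<Rightarrow> real) \<Rightarrow> bool" where
  "solves f u u' \<longleftrightarrow> continuous_graph_fun G l u \<and>
     (\<forall>e\<in>arcs G. \<forall>x\<in>{0..l e}.
        (u e has_real_derivative u' e x) (at x within {0..l e}) \<and>
        (u' e has_real_derivative u e x - f e x) (at x within {0..l e})) \<and>
     (\<forall>v\<in>verts G. (\<Sum>e\<in>out_arcs G v. u' e 0) + (\<Sum>e\<in>in_arcs G v. - u' e (l e)) = 0)"

text \<open>
  The class of \<open>H\<^sup>1\<close> functions used for testing. The square integrability of \<open>f'\<close> has to be required, since
  the derivative may be unbounded near an exceptional point.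
\<close>

definition piecewise_deriv :: "('e \<Rightarrow> real \<Rightarrow> real) \<Rightarrow> ('e \<Rightarrow> real \<Rightarrow> real) \<Rightarrow> bool" where
  "piecewise_deriv f f' \<longleftrightarrow> continuous_graph_fun G l f \<and>
     (\<forall>e\<in>arcs G. (\<lambda>x. (f' e x)\<^sup>2) integrable_on {0..l e} \<and>
        (\<exists>S. finite S \<and> (\<forall>x\<in>{0<..<l e} - S. (f e has_real_derivative f' e x) (at x))))"

lemma continuous_graph_fun_edge: "continuous_graph_fun G l f \<Longrightarrow> f \<in> edge_fun"
  by (auto simp: continuous_graph_fun_def edge_fun_def)

lemma edge_funD:
  assumes "f \<in> edge_fun"
  shows "e \<in> arcs G \<Longrightarrow> continuous_on {0..l e} (f e)"
    and "e \<notin> arcs G \<or> x \<notin> {0..l e} \<Longrightarrow> f e x = 0"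
  using assms unfolding edge_fun_def by blast+

lemma edge_fun_mult_integrable:
  assumes "f \<in> edge_fun" "g \<in> edge_fun" "e \<in> arcs G"
  shows "(\<lambda>x. f e x * g e x) integrable_on {0..l e}"
  using assms by (intro integrable_continuous_real continuous_intros edge_funD(1))

lemma continuous_graph_funI:
  assumes "f \<in> edge_fun"
    and "\<And>e. e \<in> arcs G \<Longrightarrow> f e 0 = g (tail G e)" "\<And>e. e \<in> arcs G \<Longrightarrow> f e (l e) = g (head G e)"
  shows "continuous_graph_fun G l f"
  unfolding continuous_graph_fun_def
proof (intro conjI exI[of _ g])
  show "\<forall>e x. e \<notin> arcs G \<or> x \<notin> {0..l e} \<longrightarrow> f e x = 0" using edge_funD(2)[OF assms(1)] by blast
  show "\<forall>e\<in>arcs G. continuous_on {0..l e} (f e)" using edge_funD(1)[OF assms(1)] by blast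
  show "\<forall>e\<in>arcs G. f e 0 = g (tail G e) \<and> f e (l e) = g (head G e)" using assms(2,3) by blast
qed

lemma subspace_edge_fun: "graph_fun.subspace edge_fun"
  unfolding graph_fun.subspace_def
proof (intro conjI ballI allI)
  fix f g c assume f: "f \<in> edge_fun" and g: "g \<in> edge_fun"
  have "continuous_on {0..l e} (\<lambda>x. f e x + g e x)" if "e \<in> arcs G" for e
    using f g that by (intro continuous_intros edge_funD(1))
  moreover have "f e + g e = (\<lambda>x. f e x + g e x)" for e by (simp add: fun_eq_iff)
  ultimately show "f + g \<in> edge_fun"
    using edge_funD(2)[OF f] edge_funD(2)[OF g] by (simp add: edge_fun_def)
next
  fix f c assume f: "f \<in> edge_fun"
  have "continuous_on {0..l e} (\<lambda>x. c * f e x)" if "e \<in> arcs G" for e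
    using f that by (intro continuous_intros edge_funD(1))
  then show "graph_fun_scale c f \<in> edge_fun"
    using edge_funD(2)[OF f] by (simp add: edge_fun_def graph_fun_scale_def)
qed (simp add: edge_fun_def)

lemma ip_add: "f \<in> edge_fun \<Longrightarrow> g \<in> edge_fun \<Longrightarrow> h \<in> edge_fun \<Longrightarrow> ip (f + g) h = ip f h + ip g h"
  by (simp add: ip_def distrib_right integral_add edge_fun_mult_integrable sum.distrib)

lemma ip_scale: "ip (graph_fun_scale c f) h = c * ip f h"
  by (simp add: ip_def graph_fun_scale_def mult.assoc sum_distrib_left)

lemma ip_sym: "ip f g = ip g f"
  by (simp add: ip_def mult.commute)

lemma ip_nonneg: "f \<in> edge_fun \<Longrightarrow> 0 \<le> ip f f"
  unfolding ip_def by (intro sum_nonneg integral_nonneg edge_fun_mult_integrable) auto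

lemma ip_square_add:
  assumes f: "f \<in> edge_fun" and g: "g \<in> edge_fun"
  shows "ip (f + graph_fun_scale c g) (f + graph_fun_scale c g) = ip f f + 2 * c * ip f g + c\<^sup>2 * ip g g"
proof -
  have cg: "graph_fun_scale c g \<in> edge_fun" "f + graph_fun_scale c g \<in> edge_fun"
    using f g subspace_edge_fun by (auto intro!: graph_fun.subspace_add graph_fun.subspace_scale)
  have "ip (f + graph_fun_scale c g) h = ip f h + c * ip g h" if "h \<in> edge_fun" for h
    using that cg f by (simp add: ip_add ip_scale)
  from this[OF cg(2)] this[OF f] this[OF g] show ?thesis
    by (simp add: ip_sym[of f "f + graph_fun_scale c g"] ip_sym[of g "f + graph_fun_scale c g"] ip_sym[of g f] power2_eq_square algebra_simps)
qed

lemma ip_pos: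
  assumes f: "f \<in> edge_fun" and "f \<noteq> 0"
  shows "0 < ip f f"
proof -
  from \<open>f \<noteq> 0\<close> obtain e x where "f e x \<noteq> 0" by (auto simp: fun_eq_iff)
  then have e: "e \<in> arcs G" and x: "x \<in> {0..l e}" using edge_funD(2)[OF f] by blast+
  have int: "(\<lambda>x. f e x * f e x) integrable_on {0..l e}"
    using f f e by (rule edge_fun_mult_integrable)
  have "integral {0..l e} (\<lambda>x. f e x * f e x) \<noteq> 0"
  proof
    assume "integral {0..l e} (\<lambda>x. f e x * f e x) = 0"
    then have "((\<lambda>x. f e x * f e x) has_integral 0) (cbox 0 (l e))"
      using int by (simp add: has_integral_iff)
    moreover have "continuous_on (cbox 0 (l e)) (\<lambda>x. f e x * f e x)"
      using edge_funD(1)[OF f e] by (auto intro!: continuous_intros)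
    ultimately have "f e x * f e x = 0"
      using x l_pos[OF e] by (intro has_integral_0_cbox_imp_0[of 0 "l e" "\<lambda>x. f e x * f e x"]) auto
    then show False using \<open>f e x \<noteq> 0\<close> by simp
  qed
  moreover have "0 \<le> integral {0..l e} (\<lambda>x. f e x * f e x)"
    using int by (intro integral_nonneg) auto
  ultimately have "0 < integral {0..l e} (\<lambda>x. f e x * f e x)" by linarith
  moreover have "0 \<le> integral {0..l e'} (\<lambda>x. f e' x * f e' x)" if "e' \<in> arcs G" for e'
    using edge_fun_mult_integrable[OF f f that] by (intro integral_nonneg) auto
  ultimately show ?thesis
    unfolding ip_def using e by (intro sum_pos2[of _ e]) auto
qed

lemma solves_edge_fun: "solves f u u' \<Longrightarrow> u \<in> edge_fun"
  by (simp add: solves_def continuous_graph_fun_edge)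

lemma solves_deriv:
  assumes "solves f u u'" "e \<in> arcs G" "x \<in> {0..l e}"
  shows "(u e has_real_derivative u' e x) (at x within {0..l e})"
    and "(u' e has_real_derivative u e x - f e x) (at x within {0..l e})"
  using assms unfolding solves_def by blast+

lemma solves_continuous:
  assumes "solves f u u'" "e \<in> arcs G"
  shows "continuous_on {0..l e} (u' e)" and "continuous_on {0..l e} (u e)"
  by (rule DERIV_continuous_on, rule solves_deriv(2)[OF assms], assumption)
    (rule DERIV_continuous_on, rule solves_deriv(1)[OF assms], assumption)

lemma solves_piecewise_deriv:
  assumes "solves f u u'"
  shows "piecewise_deriv u u'"
  unfolding piecewise_deriv_def
proof (intro conjI ballI)
  show "continuous_graph_fun G l u" using assms by (simp add: solves_def)
next
  fix e assume e: "e \<in> arcs G"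
  show "(\<lambda>x. (u' e x)\<^sup>2) integrable_on {0..l e}"
    using solves_continuous(1)[OF assms e] by (intro integrable_continuous_real continuous_intros)
  have "(u e has_real_derivative u' e x) (at x)" if "x \<in> {0<..<l e}" for x
    using solves_deriv(1)[OF assms e, of x] that by (simp add: at_within_Icc_at)
  then show "\<exists>S. finite S \<and> (\<forall>x\<in>{0<..<l e} - S. (u e has_real_derivative u' e x) (at x))"
    by (intro exI[of _ "{}"]) auto
qed

lemma sum_over_ends:
  fixes a b :: "'e \<Rightarrow> real" and g :: "'v \<Rightarrow> real"
  shows "(\<Sum>e\<in>arcs G. b e * g (head G e) - a e * g (tail G e)) =
    - (\<Sum>v\<in>verts G. ((\<Sum>e\<in>out_arcs G v. a e) + (\<Sum>e\<in>in_arcs G v. - b e)) * g v)"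
proof -
  have tail: "(\<Sum>e\<in>arcs G. a e * g (tail G e)) = (\<Sum>v\<in>verts G. (\<Sum>e\<in>out_arcs G v. a e) * g v)"
  proof -
    have "(\<Sum>e\<in>arcs G. a e * g (tail G e)) = (\<Sum>v\<in>verts G. \<Sum>e\<in>{e \<in> arcs G. tail G e = v}. a e * g (tail G e))"
      by (rule sum.group[symmetric]) auto
    also have "\<dots> = (\<Sum>v\<in>verts G. (\<Sum>e\<in>out_arcs G v. a e) * g v)"
      unfolding out_arcs_def sum_distrib_right by (intro sum.cong refl) auto
    finally show ?thesis .
  qed
  have head: "(\<Sum>e\<in>arcs G. b e * g (head G e)) = (\<Sum>v\<in>verts G. (\<Sum>e\<in>in_arcs G v. b e) * g v)"
  proof -
    have "(\<Sum>e\<in>arcs G. b e * g (head G e)) = (\<Sum>v\<in>verts G. \<Sum>e\<in>{e \<in> arcs G. head G e = v}. b e * g (head G e))"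
      by (rule sum.group[symmetric]) auto
    also have "\<dots> = (\<Sum>v\<in>verts G. (\<Sum>e\<in>in_arcs G v. b e) * g v)"
      unfolding in_arcs_def sum_distrib_right by (intro sum.cong refl) auto
    finally show ?thesis .
  qed
  have "(\<Sum>v\<in>verts G. ((\<Sum>e\<in>out_arcs G v. a e) + (\<Sum>e\<in>in_arcs G v. - b e)) * g v) =
      (\<Sum>v\<in>verts G. (\<Sum>e\<in>out_arcs G v. a e) * g v) - (\<Sum>v\<in>verts G. (\<Sum>e\<in>in_arcs G v. b e) * g v)"
    by (simp add: sum_negf left_diff_distrib sum_subtractf)
  then show ?thesis by (simp only: sum_subtractf tail head minus_diff_eq)
qed

text \<open>
  Integration by parts on each edge. The boundary terms collect at the vertices to the Kirchhoff sums of \<open>u\<close>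
  times the vertex values of \<open>v\<close>. The integrability of \<open>u' v'\<close> comes out of the same computation.
\<close>

lemma green:
  assumes f: "f \<in> edge_fun" and u: "solves f u u'" and v: "piecewise_deriv v v'"
  shows "e \<in> arcs G \<Longrightarrow> (\<lambda>x. u' e x * v' e x) integrable_on {0..l e}"
    and "(\<Sum>e\<in>arcs G. integral {0..l e} (\<lambda>x. u' e x * v' e x)) + ip u v = ip f v"
proof -
  have v_edge: "v \<in> edge_fun" using v by (simp add: piecewise_deriv_def continuous_graph_fun_edge)
  have u_edge: "u \<in> edge_fun" using u by (rule solves_edge_fun)
  obtain g where g: "\<And>e. e \<in> arcs G \<Longrightarrow> v e 0 = g (tail G e) \<and> v e (l e) = g (head G e)"
    using v by (auto simp: piecewise_deriv_def continuous_graph_fun_def)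
  have uf: "((\<lambda>x. u e x * v e x - f e x * v e x) has_integral
      integral {0..l e} (\<lambda>x. u e x * v e x) - integral {0..l e} (\<lambda>x. f e x * v e x)) {0..l e}"
    if "e \<in> arcs G" for e
    using that u_edge f v_edge
    by (intro has_integral_diff integrable_integral edge_fun_mult_integrable)
  have parts: "((\<lambda>x. u' e x * v' e x) has_integral
      (u' e (l e) * v e (l e) - u' e 0 * v e 0) -
      (integral {0..l e} (\<lambda>x. u e x * v e x) - integral {0..l e} (\<lambda>x. f e x * v e x))) {0..l e}"
    if e: "e \<in> arcs G" for e
  proof -
    obtain S where S: "finite S" "\<And>x. x \<in> {0<..<l e} - S \<Longrightarrow> (v e has_real_derivative v' e x) (at x)"
      using v e by (auto simp: piecewise_deriv_def)
    have "((\<lambda>x. u' e x * v' e x + (u e x * v e x - f e x * v e x)) has_integral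
        u' e (l e) * v e (l e) - u' e 0 * v e 0) {0..l e}"
    proof (rule fundamental_theorem_of_calculus_interior_strong[OF S(1)])
      show "0 \<le> l e" using l_pos[OF e] by simp
      show "continuous_on {0..l e} (\<lambda>x. u' e x * v e x)"
        using solves_continuous(1)[OF u e] edge_funD(1)[OF v_edge e] by (intro continuous_intros)
      fix x assume x: "x \<in> {0<..<l e} - S"
      then have "(u' e has_real_derivative u e x - f e x) (at x)"
        using solves_deriv(2)[OF u e, of x] by (simp add: at_within_Icc_at)
      from DERIV_mult[OF this S(2)[OF x]]
      show "((\<lambda>x. u' e x * v e x) has_vector_derivative
          u' e x * v' e x + (u e x * v e x - f e x * v e x)) (at x)"
        by (simp add: has_real_derivative_iff_has_vector_derivative[symmetric] algebra_simps)
    qed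
    from has_integral_diff[OF this uf[OF e]] show ?thesis by simp
  qed
  show "(\<lambda>x. u' e x * v' e x) integrable_on {0..l e}" if "e \<in> arcs G"
    using parts[OF that] by blast
  have "(\<Sum>e\<in>arcs G. integral {0..l e} (\<lambda>x. u' e x * v' e x)) =
      (\<Sum>e\<in>arcs G. u' e (l e) * v e (l e) - u' e 0 * v e 0) - (ip u v - ip f v)"
    using integral_unique[OF parts] by (simp add: sum_subtractf ip_def cong: sum.cong)
  also have "(\<Sum>e\<in>arcs G. u' e (l e) * v e (l e) - u' e 0 * v e 0) =
      (\<Sum>e\<in>arcs G. u' e (l e) * g (head G e) - u' e 0 * g (tail G e))"
    using g by (intro sum.cong) auto
  also have "\<dots> = - (\<Sum>w\<in>verts G. ((\<Sum>e\<in>out_arcs G w. u' e 0) + (\<Sum>e\<in>in_arcs G w. - u' e (l e))) * g w)"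
    by (rule sum_over_ends)
  also have "\<dots> = 0" using u by (simp add: solves_def)
  finally show "(\<Sum>e\<in>arcs G. integral {0..l e} (\<lambda>x. u' e x * v' e x)) + ip u v = ip f v" by simp
qed

lemma green_self:
  assumes "f \<in> edge_fun" "solves f u u'"
  shows "dirichlet u' + ip u u = ip f u"
  using green(2)[OF assms solves_piecewise_deriv[OF assms(2)]]
  by (simp add: dirichlet_def power2_eq_square)

lemma dirichlet_nonneg:
  assumes "\<And>e. e \<in> arcs G \<Longrightarrow> (\<lambda>x. (f' e x)\<^sup>2) integrable_on {0..l e}"
  shows "0 \<le> dirichlet f'"
  unfolding dirichlet_def using assms by (intro sum_nonneg integral_nonneg) auto

lemma dirichlet_nonneg_solves: "solves f u u' \<Longrightarrow> 0 \<le> dirichlet u'"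
  using solves_piecewise_deriv by (intro dirichlet_nonneg) (auto simp: piecewise_deriv_def)

text \<open>
  This is \<open>0 \<le> a (u - t f, u - t f)\<close> for the energy form \<open>a (v, w) = \<integral>v' w' + v w\<close>, where
  \<open>a (u, f) = ip f f\<close> and \<open>a (u, u) = ip f u\<close> by Green's formula. It bounds the energy of \<open>f\<close> from
  below by quantities that involve only the solution operator.
\<close>

lemma energy_variation:
  assumes f: "piecewise_deriv f f'" and u: "solves f u u'"
  shows "0 \<le> ip f u - 2 * t * ip f f + t\<^sup>2 * (dirichlet f' + ip f f)"
proof -
  have f_edge: "f \<in> edge_fun" using f by (simp add: piecewise_deriv_def continuous_graph_fun_edge)
  have u_edge: "u \<in> edge_fun" using u by (rule solves_edge_fun)
  note green = green[OF f_edge u f]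
  have int_u: "(\<lambda>x. (u' e x)\<^sup>2) integrable_on {0..l e}" if "e \<in> arcs G" for e
    using solves_piecewise_deriv[OF u] that by (auto simp: piecewise_deriv_def)
  have int_f: "(\<lambda>x. (f' e x)\<^sup>2) integrable_on {0..l e}" if "e \<in> arcs G" for e
    using f that by (auto simp: piecewise_deriv_def)
  have "0 \<le> (\<Sum>e\<in>arcs G. integral {0..l e} (\<lambda>x. (u' e x)\<^sup>2) -
      2 * t * integral {0..l e} (\<lambda>x. u' e x * f' e x) + t\<^sup>2 * integral {0..l e} (\<lambda>x. (f' e x)\<^sup>2))"
  proof (rule sum_nonneg)
    fix e assume e: "e \<in> arcs G"
    have I: "((\<lambda>x. (u' e x)\<^sup>2 - 2 * t * (u' e x * f' e x) + t\<^sup>2 * (f' e x)\<^sup>2) has_integral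
      integral {0..l e} (\<lambda>x. (u' e x)\<^sup>2) -
      2 * t * integral {0..l e} (\<lambda>x. u' e x * f' e x) + t\<^sup>2 * integral {0..l e} (\<lambda>x. (f' e x)\<^sup>2)) {0..l e}"
      using int_u[OF e] int_f[OF e] green(1)[OF e]
      by (intro has_integral_add has_integral_diff has_integral_mult_right integrable_integral)
    have "0 \<le> (u' e x)\<^sup>2 - 2 * t * (u' e x * f' e x) + t\<^sup>2 * (f' e x)\<^sup>2" for x
    proof -
      have "0 \<le> (u' e x - t * f' e x)\<^sup>2" by simp
      then show ?thesis by (simp add: power2_eq_square algebra_simps)
    qed
    then show "0 \<le> integral {0..l e} (\<lambda>x. (u' e x)\<^sup>2) -
      2 * t * integral {0..l e} (\<lambda>x. u' e x * f' e x) + t\<^sup>2 * integral {0..l e} (\<lambda>x. (f' e x)\<^sup>2)"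
      by (intro has_integral_nonneg[OF I]) auto
  qed
  also have "\<dots> = dirichlet u' - 2 * t * (ip f f - ip u f) + t\<^sup>2 * dirichlet f'"
    using green(2) by (simp add: sum.distrib sum_subtractf sum_distrib_left[symmetric] dirichlet_def)
  finally have 1: "0 \<le> dirichlet u' - 2 * t * (ip f f - ip u f) + t\<^sup>2 * dirichlet f'" .
  have "graph_fun_scale (- t) f \<in> edge_fun"
    using subspace_edge_fun f_edge by (rule graph_fun.subspace_scale)
  with subspace_edge_fun u_edge have "u + graph_fun_scale (- t) f \<in> edge_fun"
    by (rule graph_fun.subspace_add)
  then have "0 \<le> ip (u + graph_fun_scale (- t) f) (u + graph_fun_scale (- t) f)"
    by (rule ip_nonneg)
  also have "\<dots> = ip u u - 2 * t * ip u f + t\<^sup>2 * ip f f"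
    using ip_square_add[OF u_edge f_edge, of "- t"] by simp
  finally show ?thesis
    using 1 green_self[OF f_edge u] by (simp add: algebra_simps)
qed

lemma solves_add_scale:
  assumes "solves f u u'" "solves g w w'"
  shows "solves (f + graph_fun_scale c g) (u + graph_fun_scale c w) (\<lambda>e x. u' e x + c * w' e x)"
  unfolding solves_def
proof (intro conjI ballI)
  obtain gu where gu: "\<forall>e\<in>arcs G. u e 0 = gu (tail G e) \<and> u e (l e) = gu (head G e)"
    using assms(1) unfolding solves_def continuous_graph_fun_def by blast
  obtain gw where gw: "\<forall>e\<in>arcs G. w e 0 = gw (tail G e) \<and> w e (l e) = gw (head G e)"
    using assms(2) unfolding solves_def continuous_graph_fun_def by blast
  have "u + graph_fun_scale c w \<in> edge_fun"
    using solves_edge_fun[OF assms(1)] solves_edge_fun[OF assms(2)] subspace_edge_fun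
    by (intro graph_fun.subspace_add graph_fun.subspace_scale)
  then show "continuous_graph_fun G l (u + graph_fun_scale c w)"
    by (rule continuous_graph_funI[where g = "\<lambda>v. gu v + c * gw v"])
      (simp_all add: gu gw graph_fun_scale_def)
next
  fix e x assume e: "e \<in> arcs G" and x: "x \<in> {0..l e}"
  note D = solves_deriv[OF assms(1) e x] solves_deriv[OF assms(2) e x]
  have eq: "(u + graph_fun_scale c w) e = (\<lambda>x. u e x + c * w e x)" for u w
    by (simp add: fun_eq_iff graph_fun_scale_def)
  show "((u + graph_fun_scale c w) e has_real_derivative u' e x + c * w' e x) (at x within {0..l e})"
    unfolding eq by (intro DERIV_add DERIV_cmult D(1) D(3))
  show "((\<lambda>x. u' e x + c * w' e x) has_real_derivative
      (u + graph_fun_scale c w) e x - (f + graph_fun_scale c g) e x) (at x within {0..l e})"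
    unfolding eq using DERIV_add[OF D(2) DERIV_cmult[OF D(4)], of c] by (simp add: algebra_simps)
next
  fix v assume v: "v \<in> verts G"
  have "(\<Sum>e\<in>out_arcs G v. u' e 0) + (\<Sum>e\<in>in_arcs G v. - u' e (l e)) = 0"
    "(\<Sum>e\<in>out_arcs G v. w' e 0) + (\<Sum>e\<in>in_arcs G v. - w' e (l e)) = 0"
    using assms v unfolding solves_def by blast+
  moreover have "(\<Sum>e\<in>out_arcs G v. u' e 0 + c * w' e 0) + (\<Sum>e\<in>in_arcs G v. - (u' e (l e) + c * w' e (l e))) =
    ((\<Sum>e\<in>out_arcs G v. u' e 0) + (\<Sum>e\<in>in_arcs G v. - u' e (l e))) +
    c * ((\<Sum>e\<in>out_arcs G v. w' e 0) + (\<Sum>e\<in>in_arcs G v. - w' e (l e)))"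
    by (simp add: sum.distrib sum_distrib_left sum_subtractf sum_negf algebra_simps)
  ultimately show "(\<Sum>e\<in>out_arcs G v. u' e 0 + c * w' e 0) + (\<Sum>e\<in>in_arcs G v. - (u' e (l e) + c * w' e (l e))) = 0"
    by simp
qed

lemma solves_zero: "solves 0 0 (\<lambda>e x. 0)"
  by (auto simp: solves_def continuous_graph_fun_def zero_fun_def)

lemma solves_scale:
  assumes "solves f u u'"
  shows "solves (graph_fun_scale c f) (graph_fun_scale c u) (\<lambda>e x. c * u' e x)"
  using solves_add_scale[OF solves_zero assms, of c] by simp

lemma solves_zero_imp_zero:
  assumes "solves 0 u u'"
  shows "u = 0"
proof (rule ccontr)
  assume "u \<noteq> 0"
  then have "0 < ip u u" using solves_edge_fun[OF assms] by (intro ip_pos)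
  moreover have "0 \<in> edge_fun" using subspace_edge_fun by (rule graph_fun.subspace_0)
  from green_self[OF this assms] have "dirichlet u' + ip u u = 0" by (simp add: ip_def)
  ultimately show False using dirichlet_nonneg_solves[OF assms] by simp
qed

lemma solves_unique:
  assumes "solves f u u'" "solves f w w'"
  shows "u = w"
proof -
  have "f + graph_fun_scale (-1) f = 0" "u + graph_fun_scale (-1) w = u - w"
    by (auto simp: graph_fun_scale_def fun_eq_iff)
  then have "u - w = 0"
    using solves_add_scale[OF assms, of "-1"] by (intro solves_zero_imp_zero) (simp only:)
  then show ?thesis by simp
qed

section \<open>The Green operator\<close>

text \<open>
  Variation of constants: \<open>p x = - \<integral>\<^sub>0\<^sup>x sinh (x - t) h t dt\<close>, with the kernel expanded by the addition theorem.
\<close>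

lemma particular_solution:
  fixes h :: "real \<Rightarrow> real"
  assumes h: "continuous_on {0..b} h"
  shows "\<exists>p p' :: real \<Rightarrow> real. p 0 = 0 \<and> p' 0 = 0 \<and>
    (\<forall>x\<in>{0..b}. (p has_real_derivative p' x) (at x within {0..b}) \<and>
      (p' has_real_derivative p x - h x) (at x within {0..b}))"
proof -
  define S where "S = (\<lambda>x. integral {0..x} (\<lambda>t. sinh t * h t))"
  define C where "C = (\<lambda>x. integral {0..x} (\<lambda>t. cosh t * h t))"
  define p where "p = (\<lambda>x. cosh x * S x - sinh x * C x)"
  define p' where "p' = (\<lambda>x. sinh x * S x - cosh x * C x)"
  have "p 0 = 0" "p' 0 = 0" by (simp_all add: p_def p'_def S_def C_def)
  moreover have "(p has_real_derivative p' x) (at x within {0..b}) \<and>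
      (p' has_real_derivative p x - h x) (at x within {0..b})" if x: "x \<in> {0..b}" for x
  proof
    have [derivative_intros]: "(S has_real_derivative sinh x * h x) (at x within {0..b})"
      unfolding S_def using h x by (intro integral_has_real_derivative continuous_intros)
    have [derivative_intros]: "(C has_real_derivative cosh x * h x) (at x within {0..b})"
      unfolding C_def using h x by (intro integral_has_real_derivative continuous_intros)
    show "(p has_real_derivative p' x) (at x within {0..b})"
      unfolding p_def p'_def by (auto intro!: derivative_eq_intros simp: algebra_simps)
    have "cosh x * (cosh x * h x) - sinh x * (sinh x * h x) = h x"
    proof -
      have "cosh x * (cosh x * h x) - sinh x * (sinh x * h x) = ((cosh x)\<^sup>2 - (sinh x)\<^sup>2) * h x"
        by (simp add: power2_eq_square algebra_simps)
      then show ?thesis by (simp add: cosh_square_eq)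
    qed
    then show "(p' has_real_derivative p x - h x) (at x within {0..b})"
      unfolding p_def p'_def by (auto intro!: derivative_eq_intros simp: algebra_simps)
  qed
  ultimately show ?thesis by blast
qed

text \<open>
  Given the values at the vertices, the equation can be solved on each edge, so only the Kirchhoff conditions
  remain: as many linear equations as vertices. If the right-hand side is allowed to be a multiple
  of \<open>f\<close>, there is one more unknown than equations, hence a nontrivial solution; by uniqueness the multiple is
  not zero.
\<close>

lemma solves_exists:
  assumes f: "f \<in> edge_fun"
  shows "\<exists>u u'. solves f u u'"
proof -
  have "\<forall>e\<in>arcs G. \<exists>p p' :: real \<Rightarrow> real. p 0 = 0 \<and> p' 0 = 0 \<and>
    (\<forall>x\<in>{0..l e}. (p has_real_derivative p' x) (at x within {0..l e}) \<and>
      (p' has_real_derivative p x - f e x) (at x within {0..l e}))"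
    using particular_solution[OF edge_funD(1)[OF f]] by blast
  then obtain p p' :: "'e \<Rightarrow> real \<Rightarrow> real" where p: "\<forall>e\<in>arcs G. p e 0 = 0 \<and> p' e 0 = 0 \<and>
    (\<forall>x\<in>{0..l e}. (p e has_real_derivative p' e x) (at x within {0..l e}) \<and>
      (p' e has_real_derivative p e x - f e x) (at x within {0..l e}))"
    by metis
  have p0: "p e 0 = 0" "p' e 0 = 0" if "e \<in> arcs G" for e
    using p that by blast+
  have p_deriv: "(p e has_real_derivative p' e x) (at x within {0..l e})"
    "(p' e has_real_derivative p e x - f e x) (at x within {0..l e})"
    if "e \<in> arcs G" "x \<in> {0..l e}" for e x
    using p that by blast+
  \<comment> \<open>The unknowns are the values at the vertices and one more, the multiple \<open>a None\<close> of \<open>f\<close> on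
    the right-hand side; the equations are the Kirchhoff conditions.\<close>
  define b where "b = (\<lambda>a :: 'v option \<Rightarrow> real. \<lambda>e.
    (a (Some (head G e)) - a None * p e (l e) - a (Some (tail G e)) * cosh (l e)) / sinh (l e))"
  define U where "U = (\<lambda>a :: 'v option \<Rightarrow> real. \<lambda>e x.
    a None * p e x + a (Some (tail G e)) * cosh x + b a e * sinh x)"
  define U' where "U' = (\<lambda>a :: 'v option \<Rightarrow> real. \<lambda>e x.
    a None * p' e x + a (Some (tail G e)) * sinh x + b a e * cosh x)"
  define kirch where "kirch = (\<lambda>v a. (\<Sum>e\<in>out_arcs G v. U' a e 0) + (\<Sum>e\<in>in_arcs G v. - U' a e (l e)))"
  have b_lin: "b (\<lambda>j. a j + c * a' j) e = b a e + c * b a' e" for a a' c e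
    by (simp add: b_def add_divide_distrib diff_divide_distrib algebra_simps)
  have U'_lin: "U' (\<lambda>j. a j + c * a' j) e x = U' a e x + c * U' a' e x" for a a' c e x
    by (simp add: U'_def b_lin algebra_simps)
  have kirch_lin: "kirch v (\<lambda>j. a j + c * a' j) = kirch v a + c * kirch v a'" for v a a' c
    by (simp add: kirch_def U'_lin sum.distrib sum_distrib_left sum_subtractf sum_negf algebra_simps)
  obtain a where a: "\<forall>j. j \<notin> insert None (Some ` verts G) \<longrightarrow> a j = 0"
    "\<exists>j\<in>insert None (Some ` verts G). a j \<noteq> 0" "\<forall>v\<in>verts G. kirch v a = 0"
    using underdetermined_system[of "insert None (Some ` verts G)" "verts G" kirch] kirch_lin
    by (auto simp: card_insert_if card_image)
  define u where "u = (\<lambda>e x. if e \<in> arcs G \<and> x \<in> {0..l e} then U a e x else 0)"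
  have U_deriv: "(U a e has_real_derivative U' a e x) (at x within {0..l e})"
    "(U' a e has_real_derivative U a e x - a None * f e x) (at x within {0..l e})"
    if "e \<in> arcs G" "x \<in> {0..l e}" for e x
    unfolding U_def U'_def
    by (auto intro!: derivative_eq_intros p_deriv[OF that] simp: algebra_simps)
  have u_deriv: "(u e has_real_derivative U' a e x) (at x within {0..l e})"
    if "e \<in> arcs G" "x \<in> {0..l e}" for e x
    by (rule has_field_derivative_transform_within[OF U_deriv(1)[OF that] zero_less_one that(2)])
      (simp add: u_def that)
  have u_ends: "u e 0 = a (Some (tail G e))" "u e (l e) = a (Some (head G e))" if e: "e \<in> arcs G" for e
  proof -
    have "sinh (l e) > 0" using l_pos[OF e] by simp
    then show "u e 0 = a (Some (tail G e))" "u e (l e) = a (Some (head G e))"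
      using l_pos[OF e] e p0[OF e] by (simp_all add: u_def U_def b_def)
  qed
  have "u \<in> edge_fun"
    unfolding edge_fun_def
  proof (intro CollectI conjI ballI allI impI)
    show "e \<notin> arcs G \<or> x \<notin> {0..l e} \<Longrightarrow> u e x = 0" for e x by (auto simp: u_def)
    show "continuous_on {0..l e} (u e)" if "e \<in> arcs G" for e
      using u_deriv[OF that] by (rule DERIV_continuous_on)
  qed
  then have cont: "continuous_graph_fun G l u"
    by (rule continuous_graph_funI[where g = "\<lambda>v. a (Some v)"]) (simp_all add: u_ends)
  have sol: "solves (graph_fun_scale (a None) f) u (U' a)"
    unfolding solves_def
  proof (intro conjI ballI)
    show "continuous_graph_fun G l u" by (rule cont)
    fix e x assume "e \<in> arcs G" "x \<in> {0..l e}"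
    then show "(u e has_real_derivative U' a e x) (at x within {0..l e})"
      "(U' a e has_real_derivative u e x - graph_fun_scale (a None) f e x) (at x within {0..l e})"
      using u_deriv U_deriv(2) by (simp_all add: u_def graph_fun_scale_def)
  next
    fix v assume "v \<in> verts G"
    then show "(\<Sum>e\<in>out_arcs G v. U' a e 0) + (\<Sum>e\<in>in_arcs G v. - U' a e (l e)) = 0"
      using a(3) by (simp add: kirch_def)
  qed
  have "a None \<noteq> 0"
  proof
    assume zero: "a None = 0"
    have "graph_fun_scale (a None) f = 0" by (simp add: zero graph_fun_scale_def fun_eq_iff)
    then have u0: "u = 0" using sol solves_zero_imp_zero by metis
    have "a (Some v) = 0" if "v \<in> verts G" for v
      using incident[OF that] u_ends by (auto simp: u0)
    then show False using a(2) zero by auto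
  qed
  then have "graph_fun_scale (1 / a None) (graph_fun_scale (a None) f) = f"
    by (simp add: graph_fun_scale_def fun_eq_iff)
  then show ?thesis using solves_scale[OF sol, of "1 / a None"] by metis
qed

definition green_op :: "('e \<Rightarrow> real \<Rightarrow> real) \<Rightarrow> 'e \<Rightarrow> real \<Rightarrow> real" where
  "green_op f = (SOME u. \<exists>u'. solves f u u')"

lemma green_op_solves: "f \<in> edge_fun \<Longrightarrow> \<exists>u'. solves f (green_op f) u'"
  unfolding green_op_def using solves_exists by (rule someI_ex)

lemma green_op_eqI: "solves f u u' \<Longrightarrow> f \<in> edge_fun \<Longrightarrow> green_op f = u"
  using green_op_solves solves_unique by blast

lemma green_op_mem: "f \<in> edge_fun \<Longrightarrow> green_op f \<in> edge_fun"
  using green_op_solves solves_edge_fun by blast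

lemma green_op_add_scale:
  assumes "f \<in> edge_fun" "g \<in> edge_fun"
  shows "green_op (f + graph_fun_scale c g) = green_op f + graph_fun_scale c (green_op g)"
proof -
  obtain u' w' where "solves f (green_op f) u'" "solves g (green_op g) w'"
    using assms green_op_solves by metis
  then have "solves (f + graph_fun_scale c g) (green_op f + graph_fun_scale c (green_op g)) (\<lambda>e x. u' e x + c * w' e x)"
    by (rule solves_add_scale)
  moreover have "f + graph_fun_scale c g \<in> edge_fun"
    using assms subspace_edge_fun by (intro graph_fun.subspace_add graph_fun.subspace_scale)
  ultimately show ?thesis by (rule green_op_eqI)
qed

lemma green_op_sym:
  assumes f: "f \<in> edge_fun" and g: "g \<in> edge_fun"
  shows "ip (green_op f) g = ip f (green_op g)"
proof -
  obtain u' w' where u: "solves f (green_op f) u'" and w: "solves g (green_op g) w'"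
    using assms green_op_solves by metis
  show ?thesis
    using green(2)[OF f u solves_piecewise_deriv[OF w]] green(2)[OF g w solves_piecewise_deriv[OF u]]
    by (simp add: ip_sym[of g] ip_sym[of "green_op g" "green_op f"] mult.commute)
qed

lemma ip_cauchy_schwarz:
  assumes f: "f \<in> edge_fun" and g: "g \<in> edge_fun"
  shows "(ip f g)\<^sup>2 \<le> ip f f * ip g g"
proof (rule discriminant_nonneg_form)
  fix t :: real
  have "f + graph_fun_scale t g \<in> edge_fun"
    using f g subspace_edge_fun by (intro graph_fun.subspace_add graph_fun.subspace_scale)
  then have "0 \<le> ip (f + graph_fun_scale t g) (f + graph_fun_scale t g)" by (rule ip_nonneg)
  also have "\<dots> = ip f f + 2 * t * ip f g + t\<^sup>2 * ip g g" using f g by (rule ip_square_add)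
  finally show "0 \<le> ip f f + 2 * t * ip f g + t\<^sup>2 * ip g g" .
qed (rule ip_nonneg[OF g])

lemma green_op_bound:
  assumes f: "f \<in> edge_fun"
  shows "ip f (green_op f) \<le> ip f f"
proof -
  obtain u' where u: "solves f (green_op f) u'" using green_op_solves[OF f] by blast
  have "ip (green_op f) (green_op f) \<le> ip f (green_op f)"
    using green_self[OF f u] dirichlet_nonneg_solves[OF u] by simp
  then have "(ip f (green_op f))\<^sup>2 \<le> ip f f * ip f (green_op f)" "0 \<le> ip f (green_op f)"
    using ip_cauchy_schwarz[OF f green_op_mem[OF f]] ip_nonneg[OF f] ip_nonneg[OF green_op_mem[OF f]]
    by (auto intro: order_trans mult_left_mono)
  then show ?thesis
    using ip_nonneg[OF f] by (cases "ip f (green_op f) = 0") (auto simp: power2_eq_square)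
qed

text \<open>
  By Green's formula \<open>ip (K f) f\<close> is the energy of \<open>K f\<close>, which is positive unless \<open>K f = 0\<close>.
\<close>

lemma green_op_pos:
  assumes f: "f \<in> edge_fun" and "f \<noteq> 0"
  shows "0 < ip (green_op f) f"
proof -
  obtain u' where u: "solves f (green_op f) u'" using green_op_solves[OF f] by blast
  have pos: "0 \<le> dirichlet u'" by (rule dirichlet_nonneg_solves[OF u])
  show ?thesis
  proof (cases "green_op f = 0")
    case False
    then show ?thesis
      using ip_pos[OF green_op_mem[OF f]] green_self[OF f u] pos by (simp add: ip_sym[of _ f])
  next
    case True
    \<comment> \<open>If the solution vanishes, so do its derivatives, and the equation gives \<open>f = 0\<close>.\<close>
    have "f e x = 0" for e x
    proof (cases "e \<in> arcs G \<and> x \<in> {0..l e}")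
      case True
      then have e: "e \<in> arcs G" and x: "x \<in> {0..l e}" by auto
      have nontriv: "at y within {0..l e} \<noteq> bot" if "y \<in> {0..l e}" for y
        using that l_pos[OF e]
        by (auto simp: trivial_limit_within intro!: islimpt_closure_open[where s = "{0<..<l e}"])
      have u'0: "u' e y = 0" if "y \<in> {0..l e}" for y
      proof -
        have "((\<lambda>x. 0) has_real_derivative u' e y) (at y within {0..l e})"
          using solves_deriv(1)[OF u e that] \<open>green_op f = 0\<close> by (simp add: zero_fun_def)
        then show ?thesis
          using has_field_derivative_unique[OF _ DERIV_const nontriv[OF that]] by blast
      qed
      have "(u' e has_real_derivative - f e x) (at x within {0..l e})"
        using solves_deriv(2)[OF u e x] \<open>green_op f = 0\<close> by simp
      then have "((\<lambda>x. 0) has_real_derivative - f e x) (at x within {0..l e})"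
        by (rule has_field_derivative_transform_within[OF _ zero_less_one x]) (simp add: u'0)
      then have "- f e x = 0"
        using has_field_derivative_unique[OF _ DERIV_const nontriv[OF x]] by blast
      then show ?thesis by simp
    next
      case False
      then show ?thesis using edge_funD(2)[OF f] by blast
    qed
    then have "f = 0" by (simp add: fun_eq_iff)
    then show ?thesis using \<open>f \<noteq> 0\<close> by simp
  qed
qed

section \<open>Compactness, the spectrum and its variational characterisation\<close>

lemma solution_energy_le:
  assumes f: "f \<in> edge_fun" "ip f f \<le> 1" and u: "solves f u u'"
  shows "dirichlet u' \<le> 1" "ip u u \<le> 1"
proof -
  have "ip f u \<le> 1" using green_op_bound[OF f(1)] green_op_eqI[OF u f(1)] f(2) by simp
  then show "dirichlet u' \<le> 1" "ip u u \<le> 1"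
    using green_self[OF f(1) u] dirichlet_nonneg_solves[OF u] ip_nonneg[OF solves_edge_fun[OF u]] by auto
qed

lemma solution_edge_energy_le:
  assumes f: "f \<in> edge_fun" "ip f f \<le> 1" and u: "solves f u u'" and e: "e \<in> arcs G"
  shows "integral {0..l e} (\<lambda>x. (u' e x)\<^sup>2) \<le> 1" "integral {0..l e} (\<lambda>x. (u e x)\<^sup>2) \<le> 1"
proof -
  have "integral {0..l e} (\<lambda>x. (u' e x)\<^sup>2) \<le> dirichlet u'"
    unfolding dirichlet_def
    using solves_piecewise_deriv[OF u] e
    by (intro member_le_sum integral_nonneg) (auto simp: piecewise_deriv_def)
  then show "integral {0..l e} (\<lambda>x. (u' e x)\<^sup>2) \<le> 1"
    using solution_energy_le(1)[OF f u] by simp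
  have "integral {0..l e} (\<lambda>x. (u e x)\<^sup>2) \<le> ip u u"
    unfolding ip_def power2_eq_square
    using edge_fun_mult_integrable[OF solves_edge_fun[OF u] solves_edge_fun[OF u]] e
    by (intro member_le_sum integral_nonneg) auto
  then show "integral {0..l e} (\<lambda>x. (u e x)\<^sup>2) \<le> 1"
    using solution_energy_le(2)[OF f u] by simp
qed

text \<open>
  The estimate \<open>\<bar>u y - u x\<bar> \<le> sqrt \<bar>y - x\<bar>\<close> in a form linear in the integrand: \<open>2 \<bar>u'\<bar> \<le> t + u'\<^sup>2 / t\<close>.
\<close>

lemma solution_equicontinuous:
  assumes f: "f \<in> edge_fun" "ip f f \<le> 1" and u: "solves f u u'" and e: "e \<in> arcs G"
    and xy: "x \<in> {0..l e}" "y \<in> {0..l e}" and t: "0 < t"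
  shows "\<bar>u e y - u e x\<bar> \<le> (t * \<bar>y - x\<bar> + 1 / t) / 2"
proof -
  have le: "\<bar>u e y - u e x\<bar> \<le> (t * (y - x) + 1 / t) / 2"
    if xy: "x \<in> {0..l e}" "y \<in> {0..l e}" "x \<le> y" for x y
  proof -
    have sub: "{x..y} \<subseteq> {0..l e}" using xy by auto
    have "(u' e has_integral (u e y - u e x)) {x..y}"
    proof (rule fundamental_theorem_of_calculus[OF xy(3)])
      fix z assume z: "z \<in> {x..y}"
      then have "(u e has_vector_derivative u' e z) (at z within {0..l e})"
        using solves_deriv(1)[OF u e, of z] sub
        by (auto simp: has_real_derivative_iff_has_vector_derivative)
      then show "(u e has_vector_derivative u' e z) (at z within {x..y})"
        using sub by (rule has_vector_derivative_within_subset)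
    qed
    then have eq: "u e y - u e x = integral {x..y} (u' e)" and int: "u' e integrable_on {x..y}"
      by (auto simp: integral_unique)
    have cont: "continuous_on {0..l e} (\<lambda>z. (u' e z)\<^sup>2)"
      using solves_continuous(1)[OF u e] by (intro continuous_intros)
    have int2: "(\<lambda>z. (u' e z)\<^sup>2) integrable_on {x..y}"
      using continuous_on_subset[OF cont sub] by (rule integrable_continuous_real)
    have "((\<lambda>z. t / 2 + (1 / (2 * t)) * (u' e z)\<^sup>2) has_integral
        (y - x) *\<^sub>R (t / 2) + (1 / (2 * t)) * integral {x..y} (\<lambda>z. (u' e z)\<^sup>2)) {x..y}"
      using int2 xy(3)
      by (intro has_integral_add has_integral_mult_right integrable_integral)
        (use has_integral_const_real[of "t / 2" x y] in simp)
    then have I: "(\<lambda>z. t / 2 + (1 / (2 * t)) * (u' e z)\<^sup>2) integrable_on {x..y}"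
      "integral {x..y} (\<lambda>z. t / 2 + (1 / (2 * t)) * (u' e z)\<^sup>2) =
        t * (y - x) / 2 + (1 / (2 * t)) * integral {x..y} (\<lambda>z. (u' e z)\<^sup>2)"
      by (auto simp: integral_unique mult.commute)
    have "norm (integral {x..y} (u' e)) \<le> integral {x..y} (\<lambda>z. t / 2 + (1 / (2 * t)) * (u' e z)\<^sup>2)"
    proof (rule integral_norm_bound_integral[OF int I(1)])
      fix z
      have "0 \<le> (t - \<bar>u' e z\<bar>)\<^sup>2" by simp
      then have "2 * t * \<bar>u' e z\<bar> \<le> t\<^sup>2 + (u' e z)\<^sup>2" by (simp add: power2_eq_square algebra_simps)
      then show "norm (u' e z) \<le> t / 2 + (1 / (2 * t)) * (u' e z)\<^sup>2"
        using t by (simp add: field_simps power2_eq_square)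
    qed
    also have "integral {x..y} (\<lambda>z. (u' e z)\<^sup>2) \<le> integral {0..l e} (\<lambda>z. (u' e z)\<^sup>2)"
      using sub int2 integrable_continuous_real[OF cont] by (intro integral_subset_le) auto
    then have "integral {x..y} (\<lambda>z. (u' e z)\<^sup>2) \<le> 1"
      using solution_edge_energy_le(1)[OF f u e] by simp
    then have "integral {x..y} (\<lambda>z. t / 2 + (1 / (2 * t)) * (u' e z)\<^sup>2) \<le> t * (y - x) / 2 + (1 / (2 * t)) * 1"
      unfolding I(2) using t by (intro add_left_mono mult_left_mono) auto
    finally show ?thesis unfolding eq using t by (simp add: field_simps)
  qed
  show ?thesis
    using le[of x y] le[of y x] xy by (cases "x \<le> y") (auto simp: abs_minus_commute)
qed

text \<open>
  Since \<open>u\<close> oscillates by at most \<open>(l e + 1) / 2\<close> on the edge, a large value at one point would make the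
  \<open>L\<^sup>2\<close> norm large.
\<close>

lemma solution_bounded:
  assumes f: "f \<in> edge_fun" "ip f f \<le> 1" and u: "solves f u u'" and e: "e \<in> arcs G"
    and x: "x \<in> {0..l e}"
  shows "\<bar>u e x\<bar> \<le> 1 + 2 / l e + (l e + 1)\<^sup>2 / 2"
proof -
  define c where "c = (l e + 1) / 2"
  have "(u e x)\<^sup>2 \<le> 2 * (u e y)\<^sup>2 + 2 * c\<^sup>2" if y: "y \<in> {0..l e}" for y
  proof -
    have "\<bar>u e x - u e y\<bar> \<le> c"
      using solution_equicontinuous[OF f u e y x, of 1] x y by (auto simp: c_def)
    then have "(u e x - u e y)\<^sup>2 \<le> c\<^sup>2" by (metis abs_ge_zero power2_abs power_mono)
    moreover have "(u e x)\<^sup>2 \<le> 2 * (u e y)\<^sup>2 + 2 * (u e x - u e y)\<^sup>2"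
    proof -
      have "0 \<le> (2 * u e y - u e x)\<^sup>2" by simp
      then show ?thesis by (simp add: power2_eq_square algebra_simps)
    qed
    ultimately show ?thesis by simp
  qed
  moreover have cont: "continuous_on {0..l e} (\<lambda>y. 2 * (u e y)\<^sup>2)"
    using solves_continuous(2)[OF u e] by (intro continuous_intros)
  ultimately have "integral {0..l e} (\<lambda>y. (u e x)\<^sup>2) \<le> integral {0..l e} (\<lambda>y. 2 * (u e y)\<^sup>2 + 2 * c\<^sup>2)"
    using solves_continuous(2)[OF u e]
    by (intro integral_le integrable_continuous_real continuous_intros) auto
  also have "\<dots> = 2 * integral {0..l e} (\<lambda>y. (u e y)\<^sup>2) + l e * (2 * c\<^sup>2)"
    using l_pos[OF e] integrable_continuous_real[OF cont] by (subst integral_add) auto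
  also have "\<dots> \<le> 2 + l e * (2 * c\<^sup>2)" using solution_edge_energy_le(2)[OF f u e] by simp
  finally have "l e * (u e x)\<^sup>2 \<le> 2 + l e * (2 * c\<^sup>2)" using l_pos[OF e] by simp
  then have "(u e x)\<^sup>2 \<le> 2 / l e + 2 * c\<^sup>2" using l_pos[OF e] by (simp add: field_simps)
  moreover have "2 * c\<^sup>2 = (l e + 1)\<^sup>2 / 2" by (simp add: c_def power_divide)
  moreover have "\<bar>u e x\<bar> \<le> 1 + (u e x)\<^sup>2"
  proof -
    have "0 \<le> (\<bar>u e x\<bar> - 1)\<^sup>2" by simp
    then show ?thesis by (simp add: power2_eq_square algebra_simps)
  qed
  ultimately show ?thesis by simp
qed

lemma green_op_subsequence_edge:
  assumes X: "\<And>n. X n \<in> edge_fun" "\<And>n. ip (X n) (X n) \<le> 1" and e: "e \<in> arcs G"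
  shows "\<exists>r g. strict_mono (r :: nat \<Rightarrow> nat) \<and> continuous_on {0..l e} g \<and>
    (\<forall>\<epsilon>>0. \<exists>N. \<forall>n\<ge>N. \<forall>x\<in>{0..l e}. \<bar>green_op (X (r n)) e x - g x\<bar> < \<epsilon>)"
proof -
  have "\<forall>n. \<exists>u'. solves (X n) (green_op (X n)) u'" using green_op_solves X(1) by blast
  then obtain u' where u: "\<And>n. solves (X n) (green_op (X n)) (u' n)" by metis
  obtain g r where "continuous_on {0..l e} g" "strict_mono (r :: nat \<Rightarrow> nat)"
    "\<And>\<epsilon>. 0 < \<epsilon> \<Longrightarrow> \<exists>N. \<forall>n x. n \<ge> N \<and> x \<in> {0..l e} \<longrightarrow> norm (green_op (X (r n)) e x - g x) < \<epsilon>"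
  proof (rule Arzela_Ascoli[of "{0..l e}" "\<lambda>n. green_op (X n) e" "1 + 2 / l e + (l e + 1)\<^sup>2 / 2"])
    show "compact {0..l e}" by simp
    show "norm (green_op (X n) e x) \<le> 1 + 2 / l e + (l e + 1)\<^sup>2 / 2" if "x \<in> {0..l e}" for n x
      using solution_bounded[OF X u e that] by simp
    show "\<exists>d>0. \<forall>n y. y \<in> {0..l e} \<and> norm (x - y) < d \<longrightarrow>
        norm (green_op (X n) e x - green_op (X n) e y) < \<epsilon>"
      if x: "x \<in> {0..l e}" and \<epsilon>: "0 < \<epsilon>" for x \<epsilon>
    proof (intro exI[of _ "\<epsilon>\<^sup>2 / 2"] conjI allI impI)
      show "0 < \<epsilon>\<^sup>2 / 2" using \<epsilon> by simp
      fix n y assume y: "y \<in> {0..l e} \<and> norm (x - y) < \<epsilon>\<^sup>2 / 2"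
      have "\<bar>green_op (X n) e x - green_op (X n) e y\<bar> \<le> (2 / \<epsilon> * \<bar>x - y\<bar> + 1 / (2 / \<epsilon>)) / 2"
        using \<epsilon> x y by (intro solution_equicontinuous[OF X u e]) auto
      also have "2 / \<epsilon> * \<bar>x - y\<bar> < 2 / \<epsilon> * (\<epsilon>\<^sup>2 / 2)"
        using y \<epsilon> by (intro mult_strict_left_mono) auto
      finally show "norm (green_op (X n) e x - green_op (X n) e y) < \<epsilon>"
        using \<epsilon> by (simp add: power2_eq_square)
    qed
  qed blast
  then show ?thesis by (intro exI[of _ r] exI[of _ g]) fastforce
qed

lemma green_op_subsequence:
  assumes X: "\<And>n. X n \<in> edge_fun" "\<And>n. ip (X n) (X n) \<le> 1" and A: "finite A" "A \<subseteq> arcs G"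
  shows "\<exists>r g. strict_mono (r :: nat \<Rightarrow> nat) \<and> (\<forall>e\<in>A. continuous_on {0..l e} (g e) \<and>
    (\<forall>\<epsilon>>0. \<exists>N. \<forall>n\<ge>N. \<forall>x\<in>{0..l e}. \<bar>green_op (X (r n)) e x - g e x\<bar> < \<epsilon>))"
  using A
proof (induction A rule: finite_induct)
  case empty
  have "strict_mono (id :: nat \<Rightarrow> nat)" by (rule strict_mono_id)
  then show ?case by blast
next
  case (insert e A)
  then obtain r g where r: "strict_mono (r :: nat \<Rightarrow> nat)"
    and g: "\<forall>e\<in>A. continuous_on {0..l e} (g e) \<and>
      (\<forall>\<epsilon>>0. \<exists>N. \<forall>n\<ge>N. \<forall>x\<in>{0..l e}. \<bar>green_op (X (r n)) e x - g e x\<bar> < \<epsilon>)" by auto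
  obtain r' h where r': "strict_mono (r' :: nat \<Rightarrow> nat)" and h: "continuous_on {0..l e} h"
    "\<forall>\<epsilon>>0. \<exists>N. \<forall>n\<ge>N. \<forall>x\<in>{0..l e}. \<bar>green_op (X (r (r' n))) e x - h x\<bar> < \<epsilon>"
    using green_op_subsequence_edge[of "\<lambda>n. X (r n)" e] X insert.prems by auto
  have "\<exists>N. \<forall>n\<ge>N. \<forall>x\<in>{0..l e'}. \<bar>green_op (X (r (r' n))) e' x - g e' x\<bar> < \<epsilon>"
    if e': "e' \<in> A" "0 < \<epsilon>" for e' and \<epsilon> :: real
  proof -
    obtain N where "\<forall>n\<ge>N. \<forall>x\<in>{0..l e'}. \<bar>green_op (X (r n)) e' x - g e' x\<bar> < \<epsilon>"
      using g e' by blast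
    then show ?thesis using seq_suble[OF r'] by (intro exI[of _ N]) (auto intro: le_trans)
  qed
  then show ?case
    using g h insert.hyps strict_mono_o[OF r r', unfolded o_def]
    by (intro exI[of _ "\<lambda>n. r (r' n)"] exI[of _ "g(e := h)"]) auto
qed

lemma green_op_compact:
  assumes X: "\<And>n. X n \<in> edge_fun" "\<And>n. ip (X n) (X n) \<le> 1"
  shows "\<exists>r y. strict_mono (r :: nat \<Rightarrow> nat) \<and> y \<in> edge_fun \<and>
    (\<lambda>n. ip (green_op (X (r n)) - y) (green_op (X (r n)) - y)) \<longlonglongrightarrow> 0"
proof -
  obtain r g where r: "strict_mono (r :: nat \<Rightarrow> nat)"
    and rg: "\<forall>e\<in>arcs G. continuous_on {0..l e} (g e) \<and>
      (\<forall>\<epsilon>>0. \<exists>N. \<forall>n\<ge>N. \<forall>x\<in>{0..l e}. \<bar>green_op (X (r n)) e x - g e x\<bar> < \<epsilon>)"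
    using green_op_subsequence[of X "arcs G"] X by auto
  have g: "continuous_on {0..l e} (g e)" if "e \<in> arcs G" for e
    using rg that by blast
  have lim: "\<exists>N. \<forall>n\<ge>N. \<forall>x\<in>{0..l e}. \<bar>green_op (X (r n)) e x - g e x\<bar> < \<epsilon>"
    if "e \<in> arcs G" "0 < \<epsilon>" for e \<epsilon>
    using rg that by blast
  define y where "y = (\<lambda>e x. if e \<in> arcs G \<and> x \<in> {0..l e} then g e x else 0)"
  have y: "y \<in> edge_fun"
    unfolding edge_fun_def
  proof (intro CollectI conjI ballI allI impI)
    fix e assume e: "e \<in> arcs G"
    show "continuous_on {0..l e} (y e)"
      using g[OF e] by (rule continuous_on_cong[THEN iffD1, rotated -1]) (auto simp: y_def e)
  qed (auto simp: y_def)
  define d where "d = (\<lambda>n. green_op (X (r n)) - y)"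
  have d: "d n \<in> edge_fun" for n
    unfolding d_def using subspace_edge_fun green_op_mem[OF X(1)] y by (intro graph_fun.subspace_diff)
  have "(\<lambda>n. integral {0..l e} (\<lambda>x. d n e x * d n e x)) \<longlonglongrightarrow> 0" if e: "e \<in> arcs G" for e
  proof (rule LIMSEQ_I)
    fix \<epsilon> :: real assume \<epsilon>: "0 < \<epsilon>"
    define \<delta> where "\<delta> = sqrt (\<epsilon> / (2 * l e))"
    have \<delta>: "0 < \<delta>" "\<delta> * \<delta> * l e < \<epsilon>" using \<epsilon> l_pos[OF e] by (auto simp: \<delta>_def)
    obtain N where N: "\<And>n x. n \<ge> N \<Longrightarrow> x \<in> {0..l e} \<Longrightarrow> \<bar>green_op (X (r n)) e x - g e x\<bar> < \<delta>"
      using lim[OF e \<delta>(1)] by blast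
    have "norm (integral {0..l e} (\<lambda>x. d n e x * d n e x) - 0) < \<epsilon>" if n: "n \<ge> N" for n
    proof -
      have "\<bar>d n e x\<bar> < \<delta>" if "x \<in> {0..l e}" for x
        using N[OF n that] that e by (simp add: d_def y_def)
      then have "\<bar>d n e x\<bar> * \<bar>d n e x\<bar> \<le> \<delta> * \<delta>" if "x \<in> {0..l e}" for x
        using that \<delta>(1) by (intro mult_mono) (auto intro: less_imp_le)
      then have "integral {0..l e} (\<lambda>x. d n e x * d n e x) \<le> integral {0..l e} (\<lambda>x. \<delta> * \<delta>)"
        using edge_fun_mult_integrable[OF d d e] by (intro integral_le) (auto simp: abs_mult_self_eq)
      also have "\<dots> = \<delta> * \<delta> * l e" using l_pos[OF e] by simp
      also have "\<dots> < \<epsilon>" by (rule \<delta>)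
      finally show ?thesis
        using integral_nonneg[OF edge_fun_mult_integrable[OF d d e], of n] by simp
    qed
    then show "\<exists>N. \<forall>n\<ge>N. norm (integral {0..l e} (\<lambda>x. d n e x * d n e x) - 0) < \<epsilon>" by blast
  qed
  then have "(\<lambda>n. ip (d n) (d n)) \<longlonglongrightarrow> (\<Sum>e\<in>arcs G. 0)"
    unfolding ip_def by (intro tendsto_sum)
  then show ?thesis using r y by (auto simp: d_def)
qed

text \<open>
  Polynomials of degree up to \<open>card F\<close> on a single edge give one dimension more than there are
  orthogonality conditions.
\<close>

lemma edge_fun_infinite_dim:
  assumes F: "finite F" "F \<subseteq> edge_fun"
  shows "\<exists>x\<in>edge_fun. x \<noteq> 0 \<and> (\<forall>y\<in>F. ip x y = 0)"
proof -
  obtain e0 where e0: "e0 \<in> arcs G" using arcs_nonempty by blast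
  define P where "P = (\<lambda>a :: nat \<Rightarrow> real. \<lambda>e x.
    if e = e0 \<and> x \<in> {0..l e0} then \<Sum>i\<le>card F. a i * x ^ i else 0)"
  have P: "P a \<in> edge_fun" for a
    unfolding edge_fun_def
  proof (intro CollectI conjI ballI allI impI)
    fix e assume "e \<in> arcs G"
    have "continuous_on {0..l e0} (\<lambda>x. \<Sum>i\<le>card F. a i * x ^ i)" by (intro continuous_intros)
    then have "continuous_on {0..l e0} (P a e0)"
      by (rule continuous_on_cong[THEN iffD1, rotated -1]) (auto simp: P_def)
    moreover have "continuous_on {0..l e} (P a e)" if "e \<noteq> e0"
      using that by (simp add: P_def)
    ultimately show "continuous_on {0..l e} (P a e)" by blast
  qed (use e0 in \<open>auto simp: P_def\<close>)
  have P_lin: "P (\<lambda>j. a j + c * b j) = P a + graph_fun_scale c (P b)" for a b c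
    by (auto simp: P_def graph_fun_scale_def fun_eq_iff sum.distrib sum_distrib_left algebra_simps)
  have "ip (P (\<lambda>j. a j + c * b j)) y = ip (P a) y + c * ip (P b) y" if "y \<in> F" for a b c y
  proof -
    have "graph_fun_scale c (P b) \<in> edge_fun"
      using P subspace_edge_fun by (intro graph_fun.subspace_scale)
    then show ?thesis using that F P by (auto simp: P_lin ip_add ip_scale)
  qed
  then obtain a where a: "\<exists>j\<in>{..card F}. a j \<noteq> 0" "\<forall>y\<in>F. ip (P a) y = 0"
    using underdetermined_system[of "{..card F}" F "\<lambda>y a. ip (P a) y"] F(1) by auto
  have "P a \<noteq> 0"
  proof
    assume "P a = 0"
    then have zero: "P a e0 x = 0" for x by simp
    have "{0..l e0} \<subseteq> {x. (\<Sum>i\<le>card F. a i * x ^ i) = 0}"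
    proof
      fix x assume "x \<in> {0..l e0}"
      then show "x \<in> {x. (\<Sum>i\<le>card F. a i * x ^ i) = 0}" using zero[of x] by (simp add: P_def)
    qed
    moreover have "infinite {0..l e0}" using l_pos[OF e0] by (simp add: infinite_Icc)
    ultimately have "infinite {x. (\<Sum>i\<le>card F. a i * x ^ i) = 0}" using finite_subset by blast
    moreover obtain j where "a j \<noteq> 0" "j \<le> card F" using a(1) by auto
    ultimately show False using polyfun_rootbound by blast
  qed
  then show ?thesis using P a(2) by blast
qed

lemma green_op_compact_positive:
  "compact_positive_operator graph_fun_scale edge_fun ip green_op"
proof unfold_locales
  show "graph_fun.subspace edge_fun" by (rule subspace_edge_fun)
  show "ip (f + g) h = ip f h + ip g h" if "f \<in> edge_fun" "g \<in> edge_fun" "h \<in> edge_fun" for f g h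
    using that by (rule ip_add)
  show "ip (graph_fun_scale c f) h = c * ip f h" for c f h by (rule ip_scale)
  show "ip f g = ip g f" for f g by (rule ip_sym)
  show "0 < ip f f" if "f \<in> edge_fun" "f \<noteq> 0" for f using that by (rule ip_pos)
  show "green_op f \<in> edge_fun" if "f \<in> edge_fun" for f using that by (rule green_op_mem)
  show "green_op (f + g) = green_op f + green_op g" if "f \<in> edge_fun" "g \<in> edge_fun" for f g
    using green_op_add_scale[OF that, of 1] by simp
  show "green_op (graph_fun_scale c f) = graph_fun_scale c (green_op f)" if f: "f \<in> edge_fun" for c f
  proof -
    obtain u' where "solves f (green_op f) u'" using green_op_solves[OF f] by blast
    from solves_scale[OF this] show ?thesis
      using f subspace_edge_fun by (intro green_op_eqI graph_fun.subspace_scale)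
  qed
  show "ip (green_op f) g = ip f (green_op g)" if "f \<in> edge_fun" "g \<in> edge_fun" for f g
    using that by (rule green_op_sym)
  show "0 < ip (green_op f) f" if "f \<in> edge_fun" "f \<noteq> 0" for f using that by (rule green_op_pos)
  show "ip (green_op f) f \<le> ip f f" if "f \<in> edge_fun" for f
    using green_op_bound[OF that] by (simp add: ip_sym)
  show "\<exists>r y. strict_mono (r :: nat \<Rightarrow> nat) \<and> y \<in> edge_fun \<and>
      (\<lambda>n. ip (green_op (X (r n)) - y) (green_op (X (r n)) - y)) \<longlonglongrightarrow> 0"
    if "\<And>n. X n \<in> edge_fun" "\<And>n. ip (X n) (X n) \<le> 1" for X
    using that by (rule green_op_compact)
  show "\<exists>x\<in>edge_fun. x \<noteq> 0 \<and> (\<forall>y\<in>F. ip x y = 0)" if "finite F" "F \<subseteq> edge_fun" for F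
    using that by (rule edge_fun_infinite_dim)
qed

lemma eigenspace_green_op:
  assumes \<nu>: "\<nu> > -1"
  shows "neumann_eigenspace G l \<nu> = {f \<in> edge_fun. green_op f = graph_fun_scale (1 / (1 + \<nu>)) f}"
proof -
  have iff: "f \<in> neumann_eigenspace G l \<nu> \<longleftrightarrow> (\<exists>f'. solves (graph_fun_scale (1 + \<nu>) f) f f')" for f
  proof -
    have "f e x - graph_fun_scale (1 + \<nu>) f e x = - \<nu> * f e x" for e x
      by (simp add: graph_fun_scale_def algebra_simps)
    then show ?thesis by (simp add: neumann_eigenspace_def solves_def)
  qed
  have scale: "graph_fun_scale (1 + \<nu>) f \<in> edge_fun" if "f \<in> edge_fun" for f
    using that subspace_edge_fun by (intro graph_fun.subspace_scale)
  interpret K: compact_positive_operator graph_fun_scale edge_fun ip green_op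
    by (rule green_op_compact_positive)
  have inv: "graph_fun_scale (1 / (1 + \<nu>)) (graph_fun_scale (1 + \<nu>) f) = f"
    "graph_fun_scale (1 + \<nu>) (graph_fun_scale (1 / (1 + \<nu>)) f) = f" for f
    using \<nu> by (simp_all add: graph_fun_scale_def)
  show ?thesis
  proof (intro set_eqI iffI)
    fix f assume "f \<in> neumann_eigenspace G l \<nu>"
    then obtain f' where f': "solves (graph_fun_scale (1 + \<nu>) f) f f'" using iff by blast
    have f: "f \<in> edge_fun" using f' by (rule solves_edge_fun)
    have "graph_fun_scale (1 + \<nu>) (green_op f) = f"
      using green_op_eqI[OF f' scale[OF f]] K.K_scale[OF f] by simp
    then have "green_op f = graph_fun_scale (1 / (1 + \<nu>)) f" using inv(1) by metis
    then show "f \<in> {f \<in> edge_fun. green_op f = graph_fun_scale (1 / (1 + \<nu>)) f}" using f by simp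
  next
    fix f assume "f \<in> {f \<in> edge_fun. green_op f = graph_fun_scale (1 / (1 + \<nu>)) f}"
    then have f: "f \<in> edge_fun" "green_op f = graph_fun_scale (1 / (1 + \<nu>)) f" by auto
    then have "green_op (graph_fun_scale (1 + \<nu>) f) = f" 
      using K.K_scale[OF f(1), of "1 + \<nu>"] inv(2)[of f] by (simp only:)
    then show "f \<in> neumann_eigenspace G l \<nu>"
      using green_op_solves[OF scale[OF f(1)]] iff by simp
  qed
qed

lemma neumann_eigenvalue_gt:
  assumes "neumann_eigenvalue G l \<nu>"
  shows "\<nu> > -1"
proof -
  obtain f where f: "f \<in> neumann_eigenspace G l \<nu>" "f \<noteq> 0"
    using assms by (auto simp: neumann_eigenvalue_def)
  have "f e x - graph_fun_scale (1 + \<nu>) f e x = - \<nu> * f e x" for e x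
    by (simp add: graph_fun_scale_def algebra_simps)
  then obtain f' where f': "solves (graph_fun_scale (1 + \<nu>) f) f f'"
    using f(1) by (auto simp: neumann_eigenspace_def solves_def)
  have f_edge: "f \<in> edge_fun" using f' by (rule solves_edge_fun)
  have "dirichlet f' + ip f f = (1 + \<nu>) * ip f f"
    using green_self[OF graph_fun.subspace_scale[OF subspace_edge_fun f_edge] f'] by (simp add: ip_scale)
  then have "0 < (1 + \<nu>) * ip f f"
    using dirichlet_nonneg_solves[OF f'] ip_pos[OF f_edge f(2)] by simp
  then show ?thesis using ip_pos[OF f_edge f(2)] by (simp add: zero_less_mult_iff)
qed

text \<open>
  The eigenvalue \<open>\<kappa>\<close> of the Green operator corresponds to \<open>1 / \<kappa> - 1\<close>. For the variational bound,
  \<open>energy_variation\<close> is used with \<open>t = \<kappa> n\<close>; it turns the upper bound for the Green operator on the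
  orthogonal complement of \<open>n\<close> eigenfunctions into a lower bound for the Dirichlet energy.
\<close>

theorem spectrum_and_variational_bound:
  "\<exists>s e. neumann_spectrum G l s \<and> (\<forall>n. e n \<in> edge_fun) \<and>
    (\<forall>n f f'. piecewise_deriv f f' \<longrightarrow> (\<forall>i<n. ip f (e i) = 0) \<longrightarrow> s n * ip f f \<le> dirichlet f')"
proof -
  interpret K: compact_positive_operator graph_fun_scale edge_fun ip green_op
    by (rule green_op_compact_positive)
  obtain e \<kappa> where "(\<forall>n. e n \<in> edge_fun \<and> green_op (e n) = graph_fun_scale (\<kappa> n) (e n) \<and> 0 < \<kappa> n) \<and>
    (\<forall>m n. ip (e m) (e n) = (if m = n then 1 else 0)) \<and> decseq \<kappa> \<and>
    (\<forall>n x. x \<in> edge_fun \<longrightarrow> (\<forall>i<n. ip x (e i) = 0) \<longrightarrow> ip (green_op x) x \<le> \<kappa> n * ip x x)"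
    using K.eigenbasis_exists by blast
  then interpret E: compact_positive_eigenbasis graph_fun_scale edge_fun ip green_op e \<kappa>
    by unfold_locales auto
  define s where "s = (\<lambda>n. 1 / \<kappa> n - 1)"
  have s_eq: "s n = \<nu> \<longleftrightarrow> \<kappa> n = 1 / (1 + \<nu>)" if "\<nu> > -1" for n \<nu>
    using E.\<kappa>_pos[of n] that by (auto simp: s_def field_simps)
  have s_gt: "s n > -1" for n using E.\<kappa>_pos[of n] by (simp add: s_def)
  have eigen: "neumann_eigenvalue G l \<nu> \<longleftrightarrow> \<nu> \<in> range s" for \<nu>
  proof (cases "\<nu> > -1")
    case True
    then have "neumann_eigenvalue G l \<nu> \<longleftrightarrow> 1 / (1 + \<nu>) \<in> range \<kappa>"
      using E.eigenvalue_iff[of "1 / (1 + \<nu>)"]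
      by (auto simp: neumann_eigenvalue_def eigenspace_green_op)
    also have "\<dots> \<longleftrightarrow> \<nu> \<in> range s" using s_eq[OF True] by (metis rangeE rangeI)
    finally show ?thesis .
  next
    case False
    then show ?thesis using neumann_eigenvalue_gt s_gt by auto
  qed
  have "neumann_spectrum G l s"
    unfolding neumann_spectrum_def
  proof (intro conjI allI impI)
    show "incseq s"
      unfolding s_def using decseqD[OF E.decseq_\<kappa>] E.\<kappa>_pos
      by (intro incseq_SucI diff_right_mono divide_left_mono mult_pos_pos) auto
    show "range s = {\<nu>. neumann_eigenvalue G l \<nu>}" using eigen by auto
    fix \<nu> assume "neumann_eigenvalue G l \<nu>"
    then have \<nu>: "\<nu> > -1" by (rule neumann_eigenvalue_gt)
    have "{j. s j = \<nu>} = {j. \<kappa> j = 1 / (1 + \<nu>)}" using s_eq[OF \<nu>] by blast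
    then show "finite {j. s j = \<nu>}" "card {j. s j = \<nu>} = eigenvalue_multiplicity G l \<nu>"
      using E.finite_\<kappa>_eq E.dim_eigenspace[of "1 / (1 + \<nu>)"] \<nu>
      by (simp_all add: eigenvalue_multiplicity_def eigenspace_green_op)
  qed
  moreover have "s n * ip f f \<le> dirichlet f'"
    if f: "piecewise_deriv f f'" and orth: "\<forall>i<n. ip f (e i) = 0" for n f f'
  proof -
    have f_edge: "f \<in> edge_fun" using f by (simp add: piecewise_deriv_def continuous_graph_fun_edge)
    obtain u' where u: "solves f (green_op f) u'" using green_op_solves[OF f_edge] by blast
    have "ip f (green_op f) \<le> \<kappa> n * ip f f"
      using E.K_le[OF f_edge, of n] orth by (simp add: ip_sym)
    then have "0 \<le> \<kappa> n * (\<kappa> n * (dirichlet f' + ip f f) - ip f f)"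
      using energy_variation[OF f u, of "\<kappa> n"] by (simp add: power2_eq_square algebra_simps)
    then have "ip f f \<le> \<kappa> n * (dirichlet f' + ip f f)"
      using E.\<kappa>_pos[of n] by (simp add: zero_le_mult_iff)
    then show ?thesis using E.\<kappa>_pos[of n] by (simp add: s_def field_simps)
  qed
  ultimately show ?thesis using E.e_mem by blast
qed

lemma neumann_spectrum_unique:
  assumes s: "neumann_spectrum G l s" and t: "neumann_spectrum G l t"
  shows "s = t"
proof (rule nondecreasing_enumeration_unique)
  show "incseq s" "incseq t" "range s = range t"
    using s t by (auto simp: neumann_spectrum_def)
  have "finite {j. s j = x} \<and> finite {j. t j = x} \<and> card {j. s j = x} = card {j. t j = x}" for x
  proof (cases "neumann_eigenvalue G l x")
    case True
    then show ?thesis using s t by (simp add: neumann_spectrum_def)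
  next
    case False
    then have "{j. s j = x} = {}" "{j. t j = x} = {}"
      using s t by (auto simp: neumann_spectrum_def)
    then show ?thesis by simp
  qed
  then show "finite {j. s j = x}" "finite {j. t j = x}" "card {j. s j = x} = card {j. t j = x}" for x
    by blast+
qed

theorem neumann_ev_variational:
  "\<exists>e. (\<forall>i. e i \<in> edge_fun) \<and> (\<forall>f f'. piecewise_deriv f f' \<longrightarrow> (\<forall>i<n. ip f (e i) = 0) \<longrightarrow>
    neumann_ev G n l * ip f f \<le> dirichlet f')"
proof -
  obtain s e where s: "neumann_spectrum G l s" and e: "\<forall>n. e n \<in> edge_fun"
    "\<forall>n f f'. piecewise_deriv f f' \<longrightarrow> (\<forall>i<n. ip f (e i) = 0) \<longrightarrow> s n * ip f f \<le> dirichlet f'"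
    using spectrum_and_variational_bound by blast
  have "(THE s. neumann_spectrum G l s) = s"
    using s neumann_spectrum_unique by blast
  then have "neumann_ev G n l = s n" by (simp add: neumann_ev_def)
  then show ?thesis using e by (intro exI[of _ e]) simp
qed

end

section \<open>Phases: merging branches and waves on one edge\<close>

text \<open>
  The phase of the branch that continues branches of phases \<open>\<theta>\<close> and \<open>\<rho>\<close> beyond their common end. Phase zero
  stands for a node, that is, a Dirichlet condition, which persists whatever is attached to it.
\<close>

definition merge_angle :: "real \<Rightarrow> real \<Rightarrow> real" where
  "merge_angle \<theta> \<rho> = (if \<theta> = 0 \<or> \<rho> = 0 then 0 else pi / 2 - arctan (cot \<theta> + cot \<rho>))"

lemma cot_half_pi_minus_arctan: "cot (pi / 2 - arctan c) = c"
proof -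
  have "cot (pi / 2 - arctan c) = sin (arctan c) / cos (arctan c)"
    by (simp add: cot_def cos_sin_eq[of "arctan c"] sin_cos_eq[of "arctan c"])
  then show ?thesis using tan_arctan[of c] by (simp add: tan_def)
qed

lemma merge_angle_range:
  shows "0 \<le> merge_angle \<theta> \<rho>" "merge_angle \<theta> \<rho> < pi"
  using arctan_bounded[of "cot \<theta> + cot \<rho>"] pi_gt_zero by (auto simp: merge_angle_def)

lemma merge_angle_pos: "\<theta> \<noteq> 0 \<Longrightarrow> \<rho> \<noteq> 0 \<Longrightarrow> 0 < merge_angle \<theta> \<rho>"
  using arctan_bounded[of "cot \<theta> + cot \<rho>"] by (auto simp: merge_angle_def)

lemma cot_merge_angle: "\<theta> \<noteq> 0 \<Longrightarrow> \<rho> \<noteq> 0 \<Longrightarrow> cot (merge_angle \<theta> \<rho>) = cot \<theta> + cot \<rho>"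
  by (simp add: merge_angle_def cot_half_pi_minus_arctan)

lemma cot_diff:
  fixes x y :: real
  assumes "sin x \<noteq> 0" "sin y \<noteq> 0"
  shows "cot x - cot y = sin (y - x) / (sin x * sin y)"
  using assms by (simp add: cot_def sin_diff field_simps)

lemma cot_strict_antimono:
  fixes x y :: real
  assumes "0 < x" "x < y" "y < pi"
  shows "cot y < cot x"
proof -
  have "0 < sin x" "0 < sin y" "0 < sin (y - x)" using assms by (auto intro!: sin_gt_zero)
  then have "0 < cot x - cot y" by (simp add: cot_diff)
  then show ?thesis by simp
qed

text \<open>
  As the cotangent decreases, this says that \<open>cot \<sigma> \<ge> cot \<theta> + cot \<rho>\<close> if \<open>\<sigma> = \<theta> + \<rho> - \<pi>\<close> is positive. After multiplication with the sines this
  is \<open>sin \<sigma> sin \<sigma> + cos \<sigma> sin \<theta> sin \<rho> \<ge> 0\<close>, and with \<open>a = sin \<theta> cos \<rho>\<close>, \<open>b = cos \<theta> sin \<rho>\<close> the left-hand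
  side is \<open>a\<^sup>2 + a b + b\<^sup>2 + (sin \<theta> sin \<rho>)\<^sup>2\<close>.
\<close>

lemma merge_angle_ge:
  assumes "0 \<le> \<theta>" "\<theta> < pi" "0 \<le> \<rho>" "\<rho> < pi"
  shows "\<theta> + \<rho> - pi \<le> merge_angle \<theta> \<rho>"
proof (rule ccontr)
  assume neg: "\<not> ?thesis"
  define \<sigma> where "\<sigma> = \<theta> + \<rho> - pi"
  have \<sigma>: "0 < \<sigma>" "\<sigma> < pi"
    using neg merge_angle_range(1)[of \<theta> \<rho>] assms by (auto simp: \<sigma>_def)
  then have pos: "0 < \<theta>" "0 < \<rho>" using assms by (auto simp: \<sigma>_def)
  then have s: "0 < sin \<theta>" "0 < sin \<rho>" "0 < sin \<sigma>" using assms \<sigma> by (auto intro!: sin_gt_zero)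
  have sin_\<sigma>: "sin \<sigma> = - (sin \<theta> * cos \<rho> + cos \<theta> * sin \<rho>)"
    and cos_\<sigma>: "cos \<sigma> = - (cos \<theta> * cos \<rho> - sin \<theta> * sin \<rho>)"
    by (simp_all add: \<sigma>_def sin_diff cos_diff sin_add cos_add)
  have "cot \<sigma> < cot (merge_angle \<theta> \<rho>)"
    using merge_angle_pos[of \<theta> \<rho>] pos neg \<sigma> by (intro cot_strict_antimono) (auto simp: \<sigma>_def)
  also have "\<dots> = cot \<theta> + cot \<rho>" using pos by (intro cot_merge_angle) auto
  also have "\<dots> = - sin \<sigma> / (sin \<theta> * sin \<rho>)"
    using s by (simp add: cot_def sin_\<sigma> field_simps)
  finally have "cos \<sigma> * (sin \<theta> * sin \<rho>) < - (sin \<sigma> * sin \<sigma>)"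
    using s by (simp add: cot_def field_simps)
  moreover have "0 \<le> sin \<sigma> * sin \<sigma> + cos \<sigma> * (sin \<theta> * sin \<rho>)"
  proof -
    define a b where "a = sin \<theta> * cos \<rho>" and "b = cos \<theta> * sin \<rho>"
    have "sin \<sigma> * sin \<sigma> + cos \<sigma> * (sin \<theta> * sin \<rho>) = (a + b) * (a + b) - a * b + (sin \<theta> * sin \<rho>)\<^sup>2"
      by (simp add: sin_\<sigma> cos_\<sigma> a_def b_def power2_eq_square algebra_simps)
    also have "(a + b) * (a + b) - a * b = ((a + b)\<^sup>2 + a\<^sup>2 + b\<^sup>2) / 2"
      by (simp add: power2_eq_square algebra_simps)
    finally show ?thesis by simp
  qed
  ultimately show False by simp
qed

text \<open>
  Phase \<open>\<pi> / 2\<close> is that of a vertex with nothing attached, so the first branch passes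
  through without any loss.
\<close>

lemma merge_angle_half_pi:
  assumes "0 \<le> \<rho>" "\<rho> < pi"
  shows "merge_angle (pi / 2) \<rho> = \<rho>"
proof (cases "\<rho> = 0")
  case False
  have cot: "cot (merge_angle (pi / 2) \<rho>) = cot \<rho>"
    using False cot_merge_angle[of "pi / 2" \<rho>] by (simp add: cot_def)
  show ?thesis
    using cot_strict_antimono[of "merge_angle (pi / 2) \<rho>" \<rho>]
      cot_strict_antimono[of \<rho> "merge_angle (pi / 2) \<rho>"]
      merge_angle_range(2)[of "pi / 2" \<rho>] merge_angle_pos[of "pi / 2" \<rho>] assms False cot
    by (cases "merge_angle (pi / 2) \<rho>" \<rho> rule: linorder_cases) auto
qed (simp add: merge_angle_def)

text \<open>
  Composed with \<open>clamp_pi i\<close>, a continuous function that vanishes at all multiples of \<open>\<pi>\<close> is cut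
  down to the nodal interval from \<open>i \<pi>\<close> to \<open>(i + 1) \<pi>\<close> and stays continuous.
\<close>

definition clamp_pi :: "nat \<Rightarrow> real \<Rightarrow> real" where
  "clamp_pi i y = max (real i * pi) (min y ((real i + 1) * pi))"

lemma nodal_interval:
  assumes "0 \<le> y"
  obtains j :: nat where "real j * pi \<le> y" "y < (real j + 1) * pi" "j = nat \<lfloor>y / pi\<rfloor>"
proof -
  have "0 \<le> \<lfloor>y / pi\<rfloor>" using assms by simp
  then have eq: "real (nat \<lfloor>y / pi\<rfloor>) = of_int \<lfloor>y / pi\<rfloor>" by simp
  have "of_int \<lfloor>y / pi\<rfloor> * pi \<le> y / pi * pi" by (intro mult_right_mono) auto
  moreover have "y / pi * pi < (of_int \<lfloor>y / pi\<rfloor> + 1) * pi"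
    by (intro mult_strict_right_mono) (linarith, simp)
  ultimately have "real (nat \<lfloor>y / pi\<rfloor>) * pi \<le> y" "y < (real (nat \<lfloor>y / pi\<rfloor>) + 1) * pi"
    unfolding eq by simp_all
  then show ?thesis by (rule that) simp
qed

lemma rest_phase_range:
  assumes "0 \<le> y"
  shows "0 \<le> y - real (nat \<lfloor>y / pi\<rfloor>) * pi" "y - real (nat \<lfloor>y / pi\<rfloor>) * pi < pi"
  by (rule nodal_interval[OF assms]; simp add: algebra_simps)+

lemma clamp_pi_eval:
  assumes h: "\<And>i :: nat. h (real i * pi) = 0"
    and y: "real j * pi \<le> y" "y \<le> (real j + 1) * pi"
  shows "h (clamp_pi i y) = (if i = j then h y else 0)"
proof (cases i j rule: linorder_cases)
  case less
  then have "real i + 1 \<le> real j" by linarith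
  then have "(real i + 1) * pi \<le> real j * pi" by (intro mult_right_mono) auto
  then have "clamp_pi i y = real (Suc i) * pi"
    using y by (simp add: clamp_pi_def max_def min_def algebra_simps)
  then show ?thesis using less h[of "Suc i"] by simp
next
  case equal
  then show ?thesis using y by (simp add: clamp_pi_def)
next
  case greater
  then have "real j + 1 \<le> real i" by linarith
  then have "(real j + 1) * pi \<le> real i * pi" by (intro mult_right_mono) auto
  then have "y \<le> real i * pi" using y by linarith
  then have "clamp_pi i y = real i * pi"
    unfolding clamp_pi_def by (intro max_absorb1) (simp add: min_le_iff_disj)
  then show ?thesis using greater h[of i] by simp
qed

lemma clamp_pi_sum_eval:
  assumes h: "\<And>i :: nat. h (real i * pi) = 0"
    and y: "real j * pi \<le> y" "y \<le> (real j + 1) * pi" and j: "j \<le> M"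
  shows "(\<Sum>i\<le>M. a i * h (clamp_pi i y)) = a j * (h y :: real)"
proof -
  have "(\<Sum>i\<le>M. a i * h (clamp_pi i y)) = (\<Sum>i\<le>M. if i = j then a i * h y else 0)"
    by (intro sum.cong) (auto simp: clamp_pi_eval[where h = h, OF h y])
  then show ?thesis using j by simp
qed

lemma continuous_clamp_pi [continuous_intros]:
  "continuous_on S f \<Longrightarrow> continuous_on S (\<lambda>x. clamp_pi i (f x))"
  unfolding clamp_pi_def by (intro continuous_intros)

definition edge_energy :: "real \<Rightarrow> (real \<Rightarrow> real) \<Rightarrow> real \<Rightarrow> bool" where
  "edge_energy b \<phi> d \<longleftrightarrow> (\<exists>\<phi>' S. finite S \<and>
     (\<forall>x\<in>{0<..<b} - S. (\<phi> has_real_derivative \<phi>' x) (at x)) \<and>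
     ((\<lambda>x. (\<phi>' x)\<^sup>2) has_integral d) {0..b})"

text \<open>
  The functions on an edge that are multiples \<open>a i\<close> of the wave \<open>sin (k d + \<theta>)\<close> on its successive nodal intervals,
  where \<open>d\<close> is the distance from the end \<open>xs\<close> at which the wave enters with phase \<open>\<theta>\<close>. At the other end
  \<open>xt\<close> it has passed \<open>M\<close> nodes and has phase \<open>\<rho>\<close>. The orientation \<open>\<sigma>\<close> tells whether the wave runs
  with or against the parametrisation. As \<open>F'\<^sup>2 - k\<^sup>2 F\<^sup>2 = (F F')'\<close> off the nodes and \<open>F F'\<close> is continuous,
  only the two ends contribute to the energy.
\<close>

lemma branch_functions:
  fixes k l \<theta> \<sigma> c :: real
  assumes k: "0 < k" and l: "0 < l" and \<theta>: "0 \<le> \<theta>" "\<theta> < pi"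
    and orient: "\<sigma> = 1 \<and> c = \<theta> \<and> xs = 0 \<and> xt = l \<or> \<sigma> = -1 \<and> c = k * l + \<theta> \<and> xs = l \<and> xt = 0"
    and M: "M = nat \<lfloor>(k * l + \<theta>) / pi\<rfloor>" and \<rho>: "\<rho> = k * l + \<theta> - real M * pi"
  defines "B \<equiv> \<lambda>i x. sin (clamp_pi i (\<sigma> * k * x + c))"
  shows "continuous_on {0..l} (B i)"
    and "(\<Sum>i\<le>M. a i * B i xs) = a 0 * sin \<theta>"
    and "(\<Sum>i\<le>M. a i * B i xt) = a M * (-1) ^ M * sin \<rho>"
    and "edge_energy l (\<lambda>x. \<Sum>i\<le>M. a i * B i x)
      (k\<^sup>2 * integral {0..l} (\<lambda>x. (\<Sum>i\<le>M. a i * B i x)\<^sup>2) +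
        k * ((a M)\<^sup>2 * sin \<rho> * cos \<rho> - (a 0)\<^sup>2 * sin \<theta> * cos \<theta>))"
    and "(\<forall>x\<in>{0..l}. (\<Sum>i\<le>M. a i * B i x) = 0) \<Longrightarrow> i < M \<Longrightarrow> a i = 0"
proof -
  define y where "y = (\<lambda>x. \<sigma> * k * x + c)"
  have \<sigma>: "\<sigma> * \<sigma> = 1" using orient by auto
  have y_ends: "y xs = \<theta>" "y xt = k * l + \<theta>" using orient by (auto simp: y_def)
  have y_range: "\<theta> \<le> y x" "y x \<le> k * l + \<theta>" if "x \<in> {0..l}" for x
  proof -
    have "0 \<le> k * x" "k * x \<le> k * l" using that k by auto
    then show "\<theta> \<le> y x" "y x \<le> k * l + \<theta>" using orient by (auto simp: y_def)
  qed
  have y_surj: "\<exists>x\<in>{0..l}. y x = z" if "\<theta> \<le> z" "z \<le> k * l + \<theta>" for z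
  proof -
    have "(z - c) / (\<sigma> * k) \<in> {0..l}" "y ((z - c) / (\<sigma> * k)) = z"
      using orient that k by (auto simp: y_def field_simps)
    then show ?thesis by blast
  qed
  have kl: "0 \<le> k * l + \<theta>" using k l \<theta> by simp
  have \<rho>_range: "0 \<le> \<rho>" "\<rho> < pi" unfolding \<rho> M using rest_phase_range[OF kl] .
  have nodal: "\<exists>j\<le>M. real j * pi \<le> y x \<and> y x < (real j + 1) * pi \<and> j = nat \<lfloor>y x / pi\<rfloor>"
    if "x \<in> {0..l}" for x
  proof -
    have "0 \<le> y x" using y_range(1)[OF that] \<theta> by simp
    then obtain j where j: "real j * pi \<le> y x" "y x < (real j + 1) * pi" "j = nat \<lfloor>y x / pi\<rfloor>"
      by (rule nodal_interval)
    have "y x / pi \<le> (k * l + \<theta>) / pi" using y_range(2)[OF that] by (intro divide_right_mono) auto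
    then have "j \<le> M" unfolding j(3) M by (intro nat_mono floor_mono)
    then show ?thesis using j by blast
  qed
  have sin0: "sin (real i * pi) = 0" for i :: nat by simp
  have sc0: "sin (real i * pi) * cos (real i * pi) = 0" for i :: nat by simp
  have M_int: "real M * pi \<le> k * l + \<theta>" "k * l + \<theta> \<le> (real M + 1) * pi"
    using \<rho>_range by (simp_all add: \<rho> algebra_simps)
  have zero_int: "real 0 * pi \<le> \<theta>" "\<theta> \<le> (real 0 + 1) * pi" using \<theta> by simp_all
  have B: "B i x = sin (clamp_pi i (y x))" for i x by (simp add: B_def y_def)
  have F_eval: "(\<Sum>i\<le>M. a i * B i x) = a j * sin (y x)"
    if "real j * pi \<le> y x" "y x \<le> (real j + 1) * pi" "j \<le> M" for j x
    unfolding B by (rule clamp_pi_sum_eval[where h = sin, OF sin0 that])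
  show contB: "continuous_on {0..l} (B i)" for i
    unfolding B_def by (intro continuous_intros)
  show "(\<Sum>i\<le>M. a i * B i xs) = a 0 * sin \<theta>"
    using F_eval[of 0 xs] zero_int by (simp add: y_ends)
  have shift: "sin (k * l + \<theta>) = (-1) ^ M * sin \<rho>" "cos (k * l + \<theta>) = (-1) ^ M * cos \<rho>"
  proof -
    have "k * l + \<theta> = \<rho> + real M * pi" by (simp add: \<rho>)
    then show "sin (k * l + \<theta>) = (-1) ^ M * sin \<rho>" "cos (k * l + \<theta>) = (-1) ^ M * cos \<rho>"
      by (simp_all add: sin_add cos_add)
  qed
  have shift_mult: "sin (k * l + \<theta>) * cos (k * l + \<theta>) = sin \<rho> * cos \<rho>"
  proof -
    have "(-1) ^ M * (-1) ^ M = (1 :: real)" by (simp flip: power_mult_distrib)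
    moreover have "sin (k * l + \<theta>) * cos (k * l + \<theta>) = ((-1) ^ M * (-1) ^ M) * (sin \<rho> * cos \<rho>)"
      unfolding shift by (simp only: ac_simps)
    ultimately show ?thesis by simp
  qed
  show "(\<Sum>i\<le>M. a i * B i xt) = a M * (-1) ^ M * sin \<rho>"
    using F_eval[of M xt] M_int by (simp add: y_ends shift)
  define F where "F = (\<lambda>x. \<Sum>i\<le>M. a i * B i x)"
  define F' where "F' = (\<lambda>x. \<sigma> * k * a (nat \<lfloor>y x / pi\<rfloor>) * cos (y x))"
  define \<Phi> where "\<Phi> = (\<lambda>x. \<sigma> * k * (\<Sum>i\<le>M. (a i)\<^sup>2 * (sin (clamp_pi i (y x)) * cos (clamp_pi i (y x)))))"
  have \<Phi>_eval: "\<Phi> x = \<sigma> * k * ((a j)\<^sup>2 * (sin (y x) * cos (y x)))"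
    if "real j * pi \<le> y x" "y x \<le> (real j + 1) * pi" "j \<le> M" for j x
    unfolding \<Phi>_def
    using clamp_pi_sum_eval[of "\<lambda>z. sin z * cos z" j "y x" M "\<lambda>i. (a i)\<^sup>2"] that sc0 by simp
  define S where "S = (\<lambda>i. (real i * pi - c) / (\<sigma> * k)) ` {..M}"
  have S: "finite S" by (simp add: S_def)
  have deriv: "(F has_real_derivative F' x) (at x) \<and>
      (\<Phi> has_real_derivative (F' x)\<^sup>2 - k\<^sup>2 * (F x)\<^sup>2) (at x)" if x: "x \<in> {0<..<l} - S" for x
  proof -
    obtain j where j: "j \<le> M" "real j * pi \<le> y x" "y x < (real j + 1) * pi" "j = nat \<lfloor>y x / pi\<rfloor>"
      using nodal[of x] x by auto
    have "y x \<noteq> real j * pi"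
    proof
      assume "y x = real j * pi"
      then have "x = (real j * pi - c) / (\<sigma> * k)" using orient k by (auto simp: y_def field_simps)
      then show False using x j(1) by (auto simp: S_def)
    qed
    then have j2: "real j * pi < y x" using j by simp
    define U where "U = {z. real j * pi < y z \<and> y z < (real j + 1) * pi}"
    have "open U"
      unfolding U_def y_def by (intro open_Collect_conj open_Collect_less continuous_intros)
    have "x \<in> U" using j j2 by (simp add: U_def)
    have "((\<lambda>z. a j * sin (y z)) has_real_derivative F' x) (at x)"
      unfolding y_def F'_def j(4)[symmetric]
      by (auto intro!: derivative_eq_intros simp: j(4)[symmetric, unfolded y_def])
    then have 1: "(F has_real_derivative F' x) (at x)"
      using \<open>open U\<close> \<open>x \<in> U\<close>
      by (rule has_field_derivative_transform_within_open) (simp add: F_def F_eval[OF _ _ j(1)] U_def)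
    have "((\<lambda>z. \<sigma> * k * ((a j)\<^sup>2 * (sin (y z) * cos (y z)))) has_real_derivative
        \<sigma> * k * ((a j)\<^sup>2 * (\<sigma> * k * cos (y x) * cos (y x) + sin (y x) * (- (\<sigma> * k) * sin (y x))))) (at x)"
      unfolding y_def by (auto intro!: derivative_eq_intros)
    then have "(\<Phi> has_real_derivative
        \<sigma> * k * ((a j)\<^sup>2 * (\<sigma> * k * cos (y x) * cos (y x) + sin (y x) * (- (\<sigma> * k) * sin (y x))))) (at x)"
      using \<open>open U\<close> \<open>x \<in> U\<close>
      by (rule has_field_derivative_transform_within_open) (simp add: \<Phi>_eval[OF _ _ j(1)] U_def)
    moreover have "\<sigma> * k * ((a j)\<^sup>2 * (\<sigma> * k * cos (y x) * cos (y x) + sin (y x) * (- (\<sigma> * k) * sin (y x)))) =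
        (F' x)\<^sup>2 - k\<^sup>2 * (F x)\<^sup>2"
    proof -
      have "F x = a j * sin (y x)" using F_eval[of j x] j by (simp add: F_def)
      moreover have "F' x = \<sigma> * k * a j * cos (y x)" using j(4) by (simp add: F'_def)
      ultimately have "(F' x)\<^sup>2 - k\<^sup>2 * (F x)\<^sup>2 = (\<sigma> * \<sigma>) * (k * k * (a j * a j) * (cos (y x) * cos (y x))) -
          k * k * (a j * a j) * (sin (y x) * sin (y x))"
        by (simp add: power2_eq_square algebra_simps)
      also have "\<dots> = (\<sigma> * \<sigma>) * (k * k * (a j * a j) * (cos (y x) * cos (y x))) -
          (\<sigma> * \<sigma>) * (k * k * (a j * a j) * (sin (y x) * sin (y x)))"
        by (simp add: \<sigma>)
      finally show ?thesis by (simp add: power2_eq_square algebra_simps)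
    qed
    ultimately show ?thesis using 1 by simp
  qed
  have contF: "continuous_on {0..l} F" unfolding F_def using contB by (intro continuous_intros)
  have "((\<lambda>x. (F' x)\<^sup>2 - k\<^sup>2 * (F x)\<^sup>2) has_integral \<Phi> l - \<Phi> 0) {0..l}"
  proof (rule fundamental_theorem_of_calculus_interior_strong[OF S])
    show "continuous_on {0..l} \<Phi>" unfolding \<Phi>_def y_def by (intro continuous_intros)
  qed (use l deriv in \<open>auto simp: has_real_derivative_iff_has_vector_derivative[symmetric]\<close>)
  moreover have "((\<lambda>x. k\<^sup>2 * (F x)\<^sup>2) has_integral k\<^sup>2 * integral {0..l} (\<lambda>x. (F x)\<^sup>2)) {0..l}"
    using contF by (intro has_integral_mult_right integrable_integral integrable_continuous_real continuous_intros)
  ultimately have "((\<lambda>x. (F' x)\<^sup>2 - k\<^sup>2 * (F x)\<^sup>2 + k\<^sup>2 * (F x)\<^sup>2) has_integral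
      \<Phi> l - \<Phi> 0 + k\<^sup>2 * integral {0..l} (\<lambda>x. (F x)\<^sup>2)) {0..l}"
    by (rule has_integral_add)
  moreover have "\<Phi> l - \<Phi> 0 = k * ((a M)\<^sup>2 * sin \<rho> * cos \<rho> - (a 0)\<^sup>2 * sin \<theta> * cos \<theta>)"
  proof -
    have "\<Phi> xs = \<sigma> * k * ((a 0)\<^sup>2 * (sin \<theta> * cos \<theta>))"
      using \<Phi>_eval[of 0 xs] zero_int by (simp add: y_ends)
    moreover have "\<Phi> xt = \<sigma> * k * ((a M)\<^sup>2 * (sin \<rho> * cos \<rho>))"
      using \<Phi>_eval[of M xt] M_int by (simp only: y_ends shift_mult)
    ultimately show ?thesis using orient by (auto simp: algebra_simps)
  qed
  ultimately have "((\<lambda>x. (F' x)\<^sup>2) has_integral k\<^sup>2 * integral {0..l} (\<lambda>x. (F x)\<^sup>2) +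
        k * ((a M)\<^sup>2 * sin \<rho> * cos \<rho> - (a 0)\<^sup>2 * sin \<theta> * cos \<theta>)) {0..l}"
    by (simp add: add.commute)
  then show "edge_energy l (\<lambda>x. \<Sum>i\<le>M. a i * B i x)
      (k\<^sup>2 * integral {0..l} (\<lambda>x. (\<Sum>i\<le>M. a i * B i x)\<^sup>2) +
        k * ((a M)\<^sup>2 * sin \<rho> * cos \<rho> - (a 0)\<^sup>2 * sin \<theta> * cos \<theta>))"
    using S deriv unfolding F_def edge_energy_def by blast
  show "a i = 0" if zero: "\<forall>x\<in>{0..l}. (\<Sum>i\<le>M. a i * B i x) = 0" and i: "i < M"
  proof -
    have mid: "p < (max p \<theta> + q) / 2 \<and> \<theta> \<le> (max p \<theta> + q) / 2 \<and> (max p \<theta> + q) / 2 < q"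
      if "p < q" "\<theta> < q" for p q using that by (auto simp: max_def)
    define z where "z = (max (real i * pi) \<theta> + (real i + 1) * pi) / 2"
    have "\<theta> < (real i + 1) * pi"
    proof -
      have "pi \<le> (real i + 1) * pi" by simp
      then show ?thesis using \<theta> by linarith
    qed
    moreover have "real i * pi < (real i + 1) * pi" by (simp add: algebra_simps)
    ultimately have z: "real i * pi < z" "\<theta> \<le> z" "z < (real i + 1) * pi"
      using mid[of "real i * pi" "(real i + 1) * pi"] by (simp_all add: z_def)
    have "(real i + 1) * pi \<le> real M * pi" using i by (intro mult_right_mono) auto
    then have "z \<le> k * l + \<theta>" using z M_int by linarith
    then obtain x where x: "x \<in> {0..l}" "y x = z" using y_surj z(2) by blast
    then have "a i * sin z = 0" using zero F_eval[of i x] z i by simp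
    moreover have "sin z \<noteq> 0"
    proof -
      have "sin z = (-1) ^ i * sin (z - real i * pi)" by (simp add: sin_diff)
      moreover have "0 < sin (z - real i * pi)" using z by (intro sin_gt_zero) (auto simp: algebra_simps)
      ultimately show ?thesis by simp
    qed
    ultimately show ?thesis by simp
  qed
qed

section \<open>Test functions on partial graphs with Robin conditions\<close>

context metric_graph begin

text \<open>
  Linearity is required only on edgewise continuous functions, because the integrals that occur as
  functionals are not additive on all functions.
\<close>

definition lin_fun :: "(('e \<Rightarrow> real \<Rightarrow> real) \<Rightarrow> ('v \<Rightarrow> real) \<Rightarrow> real) \<Rightarrow> bool" where
  "lin_fun T \<longleftrightarrow> (\<forall>f g f2 g2 c. f \<in> edge_fun \<longrightarrow> f2 \<in> edge_fun \<longrightarrow>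
     T (f + graph_fun_scale c f2) (\<lambda>v. g v + c * g2 v) = T f g + c * T f2 g2)"

text \<open>
  A test function on the partial graph with vertices \<open>V\<close> and arcs \<open>A\<close>, with values \<open>g\<close> at the vertices and
  Dirichlet energy \<open>D e\<close> on the arc \<open>e\<close>. The vertex values are kept separately since a partial graph
  may consist of a single vertex.
\<close>

definition admissible ::
    "'v set \<Rightarrow> 'e set \<Rightarrow> ('e \<Rightarrow> real \<Rightarrow> real) \<Rightarrow> ('v \<Rightarrow> real) \<Rightarrow> ('e \<Rightarrow> real) \<Rightarrow> bool" where
  "admissible V A f g D \<longleftrightarrow> f \<in> edge_fun \<and> (\<forall>e. e \<notin> A \<longrightarrow> f e = 0) \<and> (\<forall>v. v \<notin> V \<longrightarrow> g v = 0) \<and>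
     (\<forall>e\<in>A. f e 0 = g (tail G e) \<and> f e (l e) = g (head G e) \<and>
       edge_energy (l e) (f e) (D e))"

text \<open>
  The form \<open>\<integral>f'\<^sup>2 - k\<^sup>2 f\<^sup>2\<close> on the partial graph plus the contribution of what has been removed: a solution
  attached at \<open>v\<close> with phase \<open>\<theta> v\<close> has energy \<open>k cot (\<theta> v) f(v)\<^sup>2\<close>.
\<close>

definition robin_form ::
    "real \<Rightarrow> 'v set \<Rightarrow> 'e set \<Rightarrow> ('v \<Rightarrow> real) \<Rightarrow> ('e \<Rightarrow> real \<Rightarrow> real) \<Rightarrow> ('v \<Rightarrow> real) \<Rightarrow> ('e \<Rightarrow> real) \<Rightarrow> real" where
  "robin_form k V A \<theta> f g D =
     (\<Sum>e\<in>A. D e - k\<^sup>2 * integral {0..l e} (\<lambda>x. (f e x)\<^sup>2)) + (\<Sum>v\<in>V. k * cot (\<theta> v) * (g v)\<^sup>2)"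

definition robin_test ::
    "real \<Rightarrow> 'v set \<Rightarrow> 'e set \<Rightarrow> ('v \<Rightarrow> real) \<Rightarrow> ('e \<Rightarrow> real \<Rightarrow> real) \<Rightarrow> ('v \<Rightarrow> real) \<Rightarrow> ('e \<Rightarrow> real) \<Rightarrow> bool" where
  "robin_test k V A \<theta> f g D \<longleftrightarrow> admissible V A f g D \<and> (\<forall>v\<in>V. \<theta> v = 0 \<longrightarrow> g v = 0) \<and>
     robin_form k V A \<theta> f g D \<le> 0"

text \<open>
  For a natural number \<open>b\<close> this expresses that the test functions with nonpositive form fill more than
  \<open>b\<close> dimensions. Dimensions are counted by functionals since these are what has to be satisfied in
  the end: orthogonality to eigenfunctions and continuity at the cuts.
\<close>

definition test_exists :: "real \<Rightarrow> 'v set \<Rightarrow> 'e set \<Rightarrow> ('v \<Rightarrow> real) \<Rightarrow> real \<Rightarrow> bool" where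
  "test_exists k V A \<theta> b \<longleftrightarrow> (\<forall>Ts. (\<forall>T\<in>set Ts. lin_fun T) \<longrightarrow> real (length Ts) \<le> b \<longrightarrow>
     (\<exists>f g D. robin_test k V A \<theta> f g D \<and> (f \<noteq> 0 \<or> g \<noteq> 0) \<and> (\<forall>T\<in>set Ts. T f g = 0)))"

lemma test_exists_mono: "test_exists k V A \<theta> b \<Longrightarrow> b' \<le> b \<Longrightarrow> test_exists k V A \<theta> b'"
  unfolding test_exists_def by (meson order_trans)

lemma lin_funD:
  "lin_fun T \<Longrightarrow> f \<in> edge_fun \<Longrightarrow> f2 \<in> edge_fun \<Longrightarrow>
    T (f + graph_fun_scale c f2) (\<lambda>v. g v + c * g2 v) = T f g + c * T f2 g2"
  by (simp add: lin_fun_def)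

lemma zero_edge_fun: "0 \<in> edge_fun"
  using subspace_edge_fun by (rule graph_fun.subspace_0)

lemma lin_fun_zero: "lin_fun T \<Longrightarrow> T 0 0 = 0"
  using lin_funD[OF _ zero_edge_fun zero_edge_fun, of T "-1" 0 0] by (simp add: zero_fun_def)

lemma lin_fun_sum:
  assumes T: "lin_fun T" and f: "f \<in> edge_fun" and h: "\<And>i. i \<in> I \<Longrightarrow> h i \<in> edge_fun" and I: "finite I"
  shows "T (f + (\<Sum>i\<in>I. graph_fun_scale (a i) (h i))) (\<lambda>v. g v + (\<Sum>i\<in>I. a i * q i v)) =
    T f g + (\<Sum>i\<in>I. a i * T (h i) (q i))"
  using I h
proof (induction I rule: finite_induct)
  case (insert i I)
  define F where "F = f + (\<Sum>i\<in>I. graph_fun_scale (a i) (h i))"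
  have "F \<in> edge_fun"
    unfolding F_def using f insert.prems subspace_edge_fun
    by (intro graph_fun.subspace_add graph_fun.subspace_sum graph_fun.subspace_scale) auto
  then have step: "T (F + graph_fun_scale (a i) (h i)) (\<lambda>v. (g v + (\<Sum>i\<in>I. a i * q i v)) + a i * q i v) =
      T F (\<lambda>v. g v + (\<Sum>i\<in>I. a i * q i v)) + a i * T (h i) (q i)"
    using insert.prems by (intro lin_funD[OF T]) auto
  have IH: "T F (\<lambda>v. g v + (\<Sum>i\<in>I. a i * q i v)) = T f g + (\<Sum>i\<in>I. a i * T (h i) (q i))"
    unfolding F_def using insert.prems by (intro insert.IH) auto
  have eqs: "f + (\<Sum>i\<in>insert i I. graph_fun_scale (a i) (h i)) = F + graph_fun_scale (a i) (h i)"
    "(\<lambda>v. g v + (\<Sum>i\<in>insert i I. a i * q i v)) = (\<lambda>v. (g v + (\<Sum>i\<in>I. a i * q i v)) + a i * q i v)"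
    using insert.hyps by (simp_all add: F_def add_ac)
  show ?case unfolding eqs step IH using insert.hyps by simp
qed simp

lemma robin_test_zero: "robin_test k V A \<theta> 0 0 (\<lambda>_. 0)"
proof -
  have "edge_energy (l e) 0 0" for e
    unfolding edge_energy_def by (intro exI[of _ "\<lambda>_. 0"] exI[of _ "{}"]) (simp add: zero_fun_def)
  then show ?thesis
    unfolding robin_test_def admissible_def robin_form_def by (simp add: zero_edge_fun)
qed

lemma edge_energy_cong:
  assumes "edge_energy b \<phi> d" and eq: "\<And>x. x \<in> {0<..<b} \<Longrightarrow> \<phi> x = \<psi> x"
  shows "edge_energy b \<psi> d"
proof -
  have "(\<psi> has_real_derivative c) (at x)" if "(\<phi> has_real_derivative c) (at x)" "x \<in> {0<..<b}" for c x
    using that(1) open_greaterThanLessThan that(2) eq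
    by (rule has_field_derivative_transform_within_open)
  then show ?thesis using assms(1) unfolding edge_energy_def by blast
qed

text \<open>
  One edge \<open>e\<close> is added to a partial graph. The wave on \<open>e\<close> enters at \<open>xs\<close> with phase \<open>\<theta>0\<close> and meets the old graph in
  \<open>w\<close> at \<open>xt\<close>. The coefficients on the \<open>M\<close> completed nodal intervals are free and compensate for \<open>M\<close> more
  functionals; the last coefficient is determined by the value of \<open>g\<close> at \<open>w\<close>. The vertex \<open>u\<close>
  at the other end receives the value \<open>z * a0\<close>, where \<open>a0\<close> is the first coefficient. The factor \<open>z\<close> is
  \<open>sin \<theta>0\<close> for a new vertex and zero if the edge is cut off there.
\<close>

lemma attach_branch:
  assumes k: "0 < k" and e: "e \<in> arcs G" and \<theta>0: "0 \<le> \<theta>0" "\<theta>0 < pi"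
    and ends: "xs = 0 \<and> xt = l e \<or> xs = l e \<and> xt = 0"
    and M: "M = nat \<lfloor>(k * l e + \<theta>0) / pi\<rfloor>" and \<rho>: "\<rho> = k * l e + \<theta>0 - real M * pi"
    and eA: "e \<notin> A" and test: "test_exists k V A \<theta>' b"
    and Ts: "\<forall>T\<in>set Ts. lin_fun T" "real (length Ts) \<le> b + real M"
  shows "\<exists>f g D \<phi> d a0. robin_test k V A \<theta>' f g D \<and> (f \<noteq> 0 \<or> g \<noteq> 0 \<or> \<phi> \<noteq> 0) \<and>
    (\<forall>x. x \<notin> {0..l e} \<longrightarrow> \<phi> x = 0) \<and> continuous_on {0..l e} \<phi> \<and>
    \<phi> xs = a0 * sin \<theta>0 \<and> \<phi> xt = (if \<rho> = 0 then 0 else g w) \<and>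
    edge_energy (l e) \<phi> d \<and>
    d - k\<^sup>2 * integral {0..l e} (\<lambda>x. (\<phi> x)\<^sup>2) =
      k * ((if \<rho> = 0 then 0 else cot \<rho> * (g w)\<^sup>2) - a0\<^sup>2 * sin \<theta>0 * cos \<theta>0) \<and>
    (\<forall>T\<in>set Ts. T (f(e := \<phi>)) (\<lambda>v. g v + (if v = u then z * a0 else 0)) = 0)"
proof -
  have le: "0 < l e" using e by (rule l_pos)
  obtain \<sigma> c :: real where orient:
    "\<sigma> = 1 \<and> c = \<theta>0 \<and> xs = 0 \<and> xt = l e \<or> \<sigma> = -1 \<and> c = k * l e + \<theta>0 \<and> xs = l e \<and> xt = 0"
    using ends by blast
  define B where "B = (\<lambda>i x. sin (clamp_pi i (\<sigma> * k * x + c)))"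
  have B_eq: "sin (clamp_pi i (\<sigma> * k * x + c)) = B i x" for i x by (simp add: B_def)
  note branch = branch_functions[OF k le \<theta>0 orient M \<rho>, unfolded B_eq]
  have "0 \<le> k * l e + \<theta>0" using k le \<theta>0 by simp
  then have \<rho>_range: "0 \<le> \<rho>" "\<rho> < pi" unfolding \<rho> M by (rule rest_phase_range)+
  have sin_\<rho>: "sin \<rho> \<noteq> 0" if "\<rho> \<noteq> 0" using sin_gt_zero[of \<rho>] \<rho>_range that by simp
  define Br where "Br = (\<lambda>i x. if x \<in> {0..l e} then B i x else 0)"
  define vec where "vec = (\<lambda>i :: nat. (0 :: 'e \<Rightarrow> real \<Rightarrow> real)(e := Br i))"
  define q where "q = (\<lambda>(i :: nat) v. if v = u \<and> i = 0 then z else 0 :: real)"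
  define cM where "cM = (if \<rho> = 0 then 0 else (-1) ^ M / sin \<rho>)"
  have Br_cont: "continuous_on {0..l e} (Br i)" for i
    using branch(1)[of i] by (rule continuous_on_cong[THEN iffD1, rotated -1]) (auto simp: Br_def)
  have vec: "vec i \<in> edge_fun" for i
    using Br_cont[of i] e by (auto simp: edge_fun_def vec_def Br_def)
  define red where "red = (\<lambda>T f (g :: 'v \<Rightarrow> real). T f g + g w * (cM * T (vec M) (q M)) :: real)"
  have red_lin: "lin_fun (red T)" if "lin_fun T" for T
    using that unfolding lin_fun_def red_def by (simp add: algebra_simps)
  define Lin where "Lin = {case_prod T | T. lin_fun T}"
  have LinI: "case_prod T \<in> Lin" if "lin_fun T" for T
    unfolding Lin_def by (rule CollectI, rule exI[of _ T], rule conjI[OF refl that])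
  define Y where "Y = {(f, g). (f \<noteq> 0 \<or> g \<noteq> 0) \<and> (\<exists>D. robin_test k V A \<theta>' f g D)}"
  define ps where "ps = map (\<lambda>T. (case_prod (red T), \<lambda>i. T (vec i) (q i))) Ts"
  have "(\<exists>y\<in>Y. \<exists>a. \<forall>(T, b)\<in>set ps. T y + (\<Sum>j\<in>{..<M}. a j * b j) = 0) \<or>
    (\<exists>a. (\<exists>j\<in>{..<M}. a j \<noteq> 0) \<and> (\<forall>(T, b)\<in>set ps. (\<Sum>j\<in>{..<M}. a j * b j) = 0))"
  proof (rule elimination[where Lin = Lin and B = b])
    show "(\<lambda>y. T y - c * T' y) \<in> Lin" if TT': "T \<in> Lin" "T' \<in> Lin" for T T' c
    proof -
      obtain S S' where S: "T = case_prod S" "T' = case_prod S'" "lin_fun S" "lin_fun S'"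
        using TT' unfolding Lin_def by blast
      have "lin_fun (\<lambda>f g. S f g - c * S' f g)"
        using S(3,4) unfolding lin_fun_def by (simp add: algebra_simps)
      then have "case_prod (\<lambda>f g. S f g - c * S' f g) \<in> Lin" by (rule LinI)
      moreover have "case_prod (\<lambda>f g. S f g - c * S' f g) = (\<lambda>y. T y - c * T' y)"
        unfolding S(1,2) by (rule ext) (simp add: case_prod_beta)
      ultimately show ?thesis by (rule subst[rotated])
    qed
    show "\<exists>y\<in>Y. \<forall>T\<in>set Ss. T y = 0" if Ss: "set Ss \<subseteq> Lin" "real (length Ss) \<le> b" for Ss
    proof -
      have "lin_fun (\<lambda>f g. S (f, g))" if "S \<in> set Ss" for S
      proof -
        have "S \<in> Lin" using Ss(1) that by blast
        then obtain T where "S = case_prod T" "lin_fun T" unfolding Lin_def by blast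
        then show ?thesis by simp
      qed
      then have lin: "\<forall>T\<in>set (map (\<lambda>S f g. S (f, g)) Ss). lin_fun T" by simp
      have len: "real (length (map (\<lambda>S f g. S (f, g)) Ss)) \<le> b" using Ss(2) by simp
      obtain f g D where fgD: "robin_test k V A \<theta>' f g D" "f \<noteq> 0 \<or> g \<noteq> 0"
        "\<forall>T\<in>set (map (\<lambda>S f g. S (f, g)) Ss). T f g = 0"
        using test[unfolded test_exists_def, THEN spec, THEN mp, OF lin, THEN mp, OF len] by (elim exE conjE)
      have "(f, g) \<in> Y" unfolding Y_def using fgD(1,2) by blast
      moreover have "\<forall>S\<in>set Ss. S (f, g) = 0" using fgD(3) by simp
      ultimately show ?thesis by blast
    qed
    have "case_prod (red T) \<in> Lin" if "T \<in> set Ts" for T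
      using Ts(1) that by (intro LinI red_lin) blast
    then show "\<forall>(T, b)\<in>set ps. T \<in> Lin" by (simp add: ps_def)
    show "real (length ps) \<le> b + real (card {..<M})" using Ts(2) by (simp add: ps_def)
  qed simp
  then have "\<exists>f g D a. robin_test k V A \<theta>' f g D \<and> (f \<noteq> 0 \<or> g \<noteq> 0 \<or> (\<exists>j<M. a j \<noteq> 0)) \<and>
    (\<forall>T\<in>set Ts. red T f g + (\<Sum>j<M. a j * T (vec j) (q j)) = 0)"
  proof
    assume "\<exists>y\<in>Y. \<exists>a. \<forall>(T, b)\<in>set ps. T y + (\<Sum>j\<in>{..<M}. a j * b j) = 0"
    then obtain y a where y: "y \<in> Y" "\<forall>(T, b)\<in>set ps. T y + (\<Sum>j\<in>{..<M}. a j * b j) = 0" by blast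
    obtain f g where fg: "y = (f, g)" by (cases y)
    obtain D where "robin_test k V A \<theta>' f g D" "f \<noteq> 0 \<or> g \<noteq> 0"
      using y(1) unfolding Y_def fg by blast
    moreover have "\<forall>T\<in>set Ts. red T f g + (\<Sum>j<M. a j * T (vec j) (q j)) = 0"
      using y(2) by (simp add: ps_def fg)
    ultimately show ?thesis by blast
  next
    assume "\<exists>a. (\<exists>j\<in>{..<M}. a j \<noteq> 0) \<and> (\<forall>(T, b)\<in>set ps. (\<Sum>j\<in>{..<M}. a j * b j) = 0)"
    then obtain a where a: "\<exists>j<M. a j \<noteq> 0" "\<forall>T\<in>set Ts. (\<Sum>j<M. a j * T (vec j) (q j)) = 0"
      by (auto simp: ps_def)
    have "red T 0 0 = 0" if "T \<in> set Ts" for T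
      using lin_fun_zero[of T] Ts(1) that by (simp add: red_def)
    then have "\<forall>T\<in>set Ts. red T 0 0 + (\<Sum>j<M. a j * T (vec j) (q j)) = 0" using a(2) by simp
    then show ?thesis using a(1) robin_test_zero by blast
  qed
  then obtain f g D a where R: "robin_test k V A \<theta>' f g D"
    and nz: "f \<noteq> 0 \<or> g \<noteq> 0 \<or> (\<exists>j<M. a j \<noteq> 0)"
    and zero: "\<And>T. T \<in> set Ts \<Longrightarrow> red T f g + (\<Sum>j<M. a j * T (vec j) (q j)) = 0"
    by blast
  have f: "f \<in> edge_fun" "f e = 0" using R eA by (auto simp: robin_test_def admissible_def)
  define a' where "a' = a(M := cM * g w)"
  define F where "F = (\<lambda>x. \<Sum>i\<le>M. a' i * B i x)"
  define \<phi> where "\<phi> = (\<lambda>x. \<Sum>i\<le>M. a' i * Br i x)"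
  have \<phi>_eq: "\<phi> x = F x" if "x \<in> {0..l e}" for x using that by (simp add: \<phi>_def F_def Br_def)
  have xs_xt: "xs \<in> {0..l e}" "xt \<in> {0..l e}" using ends le by auto
  have \<phi>_out: "\<phi> x = 0" if "x \<notin> {0..l e}" for x
    using that unfolding \<phi>_def Br_def by (intro sum.neutral) auto
  have \<phi>_cont: "continuous_on {0..l e} \<phi>" unfolding \<phi>_def using Br_cont by (intro continuous_intros)
  have \<phi>_xs: "\<phi> xs = a' 0 * sin \<theta>0"
    using branch(2)[of a'] \<phi>_eq[OF xs_xt(1)] by (simp add: F_def)
  have one: "(-1) ^ M * (-1) ^ M = (1 :: real)" by (simp flip: power_mult_distrib)
  have \<phi>_xt: "\<phi> xt = (if \<rho> = 0 then 0 else g w)"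
  proof -
    have "\<phi> xt = a' M * (-1) ^ M * sin \<rho>"
      using branch(3)[of a'] \<phi>_eq[OF xs_xt(2)] by (simp add: F_def)
    also have "\<dots> = (if \<rho> = 0 then 0 else ((-1) ^ M * (-1) ^ M) * g w)"
      using sin_\<rho> by (simp add: a'_def cM_def)
    finally show ?thesis by (simp add: one)
  qed
  define d where "d = k\<^sup>2 * integral {0..l e} (\<lambda>x. (F x)\<^sup>2) +
      k * ((a' M)\<^sup>2 * sin \<rho> * cos \<rho> - (a' 0)\<^sup>2 * sin \<theta>0 * cos \<theta>0)"
  have "edge_energy (l e) F d" using branch(4)[of a'] unfolding F_def d_def .
  then have deriv: "edge_energy (l e) \<phi> d" by (rule edge_energy_cong) (simp add: \<phi>_eq)
  have "integral {0..l e} (\<lambda>x. (\<phi> x)\<^sup>2) = integral {0..l e} (\<lambda>x. (F x)\<^sup>2)"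
    by (intro integral_cong) (simp add: \<phi>_eq)
  moreover have "(a' M)\<^sup>2 * sin \<rho> * cos \<rho> = (if \<rho> = 0 then 0 else cot \<rho> * (g w)\<^sup>2)"
  proof (cases "\<rho> = 0")
    case False
    have "(a' M)\<^sup>2 * sin \<rho> * cos \<rho> = ((-1) ^ M * (-1) ^ M) * (cot \<rho> * (g w)\<^sup>2)"
      using sin_\<rho>[OF False] False
      by (simp add: a'_def cM_def cot_def power2_eq_square field_simps)
    then show ?thesis using False by (simp add: one)
  qed simp
  ultimately have d_eq: "d - k\<^sup>2 * integral {0..l e} (\<lambda>x. (\<phi> x)\<^sup>2) =
      k * ((if \<rho> = 0 then 0 else cot \<rho> * (g w)\<^sup>2) - (a' 0)\<^sup>2 * sin \<theta>0 * cos \<theta>0)"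
    by (simp add: d_def)
  have \<phi>_nz: "\<phi> \<noteq> 0" if "\<exists>j<M. a j \<noteq> 0"
  proof
    assume "\<phi> = 0"
    have "(\<Sum>i\<le>M. a' i * B i x) = 0" if "x \<in> {0..l e}" for x
      using \<phi>_eq[OF that] unfolding \<open>\<phi> = 0\<close> F_def by simp
    then have "a' j = 0" if "j < M" for j using branch(5)[of a' j] that by blast
    then show False using \<open>\<exists>j<M. a j \<noteq> 0\<close> by (auto simp: a'_def)
  qed
  have "T (f(e := \<phi>)) (\<lambda>v. g v + (if v = u then z * a' 0 else 0)) = 0" if T: "T \<in> set Ts" for T
  proof -
    have lin: "lin_fun T" using Ts(1) T by blast
    have "f(e := \<phi>) = f + (\<Sum>i\<le>M. graph_fun_scale (a' i) (vec i))"
    proof (intro ext)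
      fix e' x
      have sum: "(\<Sum>i\<le>M. graph_fun_scale (a' i) (vec i)) e' x = (\<Sum>i\<le>M. a' i * vec i e' x)"
        by (induction M) (simp_all add: graph_fun_scale_def)
      have "(f(e := \<phi>)) e' x = f e' x + (\<Sum>i\<le>M. a' i * vec i e' x)"
        using f(2) by (simp add: vec_def \<phi>_def)
      then show "(f(e := \<phi>)) e' x = (f + (\<Sum>i\<le>M. graph_fun_scale (a' i) (vec i))) e' x"
        unfolding plus_fun_apply sum .
    qed
    moreover have "(\<lambda>v. g v + (if v = u then z * a' 0 else 0)) = (\<lambda>v. g v + (\<Sum>i\<le>M. a' i * q i v))"
    proof (intro ext)
      fix v
      have "(\<Sum>i\<le>M. a' i * q i v) = (\<Sum>i\<le>M. if i = 0 then (if v = u then z * a' 0 else 0) else 0)"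
        by (intro sum.cong) (auto simp: q_def)
      then show "g v + (if v = u then z * a' 0 else 0) = g v + (\<Sum>i\<le>M. a' i * q i v)" by simp
    qed
    ultimately have "T (f(e := \<phi>)) (\<lambda>v. g v + (if v = u then z * a' 0 else 0)) =
        T f g + (\<Sum>i\<le>M. a' i * T (vec i) (q i))"
      using lin_fun_sum[OF lin f(1), of "{..M}" vec a' g q] vec by simp
    also have "(\<Sum>i\<le>M. a' i * T (vec i) (q i)) = (\<Sum>i<M. a' i * T (vec i) (q i)) + a' M * T (vec M) (q M)"
      unfolding lessThan_Suc_atMost[symmetric] by (rule sum.lessThan_Suc)
    also have "(\<Sum>i<M. a' i * T (vec i) (q i)) = (\<Sum>i<M. a i * T (vec i) (q i))"
      by (intro sum.cong) (auto simp: a'_def)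
    finally have "T (f(e := \<phi>)) (\<lambda>v. g v + (if v = u then z * a' 0 else 0)) =
        red T f g + (\<Sum>i<M. a i * T (vec i) (q i))"
      by (simp only: red_def a'_def fun_upd_same) (simp add: algebra_simps)
    then show ?thesis using zero[OF T] by (simp only:)
  qed
  then have vanish: "\<forall>T\<in>set Ts. T (f(e := \<phi>)) (\<lambda>v. g v + (if v = u then z * a' 0 else 0)) = 0" by blast
  have out: "\<forall>x. x \<notin> {0..l e} \<longrightarrow> \<phi> x = 0" using \<phi>_out by blast
  have nz': "f \<noteq> 0 \<or> g \<noteq> 0 \<or> \<phi> \<noteq> 0" using nz \<phi>_nz by blast
  show ?thesis
    using R nz' out \<phi>_cont \<phi>_xs \<phi>_xt deriv d_eq vanish
    by (intro exI[where x = f] exI[where x = g] exI[where x = D] exI[where x = \<phi>]) blast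
qed

text \<open>
  Merging the phase \<open>\<rho>\<close> into \<open>w\<close> accounts exactly for the energy \<open>k cot \<rho> g(w)\<^sup>2\<close> that a branch delivers at its end.
  If one of the phases is zero, the Dirichlet condition makes all terms vanish.
\<close>

lemma robin_sum_merge:
  assumes V: "finite V" "w \<in> V" and dir: "\<forall>v\<in>V. (\<theta>(w := merge_angle (\<theta> w) \<rho>)) v = 0 \<longrightarrow> g v = 0"
  shows "(\<Sum>v\<in>V. k * cot ((\<theta>(w := merge_angle (\<theta> w) \<rho>)) v) * (g v)\<^sup>2) =
    (\<Sum>v\<in>V. k * cot (\<theta> v) * (g v)\<^sup>2) + (if \<rho> = 0 then 0 else k * cot \<rho> * (g w)\<^sup>2)"
proof -
  have "k * cot (merge_angle (\<theta> w) \<rho>) * (g w)\<^sup>2 =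
      k * cot (\<theta> w) * (g w)\<^sup>2 + (if \<rho> = 0 then 0 else k * cot \<rho> * (g w)\<^sup>2)"
  proof (cases "\<theta> w = 0 \<or> \<rho> = 0")
    case True
    then have "g w = 0" using dir V(2) by (auto simp: merge_angle_def)
    then show ?thesis by simp
  next
    case False
    then show ?thesis by (simp add: cot_merge_angle algebra_simps)
  qed
  moreover have "(\<Sum>v\<in>V - {w}. k * cot ((\<theta>(w := merge_angle (\<theta> w) \<rho>)) v) * (g v)\<^sup>2) =
      (\<Sum>v\<in>V - {w}. k * cot (\<theta> v) * (g v)\<^sup>2)"
    by (intro sum.cong) auto
  ultimately show ?thesis using V by (simp add: sum.remove[of V w])
qed

lemma robin_form_edges_update:
  assumes "finite A" "e \<notin> A"
  shows "(\<Sum>e'\<in>insert e A. (D(e := d)) e' - k\<^sup>2 * integral {0..l e'} (\<lambda>x. ((f(e := \<phi>)) e' x)\<^sup>2)) =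
    d - k\<^sup>2 * integral {0..l e} (\<lambda>x. (\<phi> x)\<^sup>2) + (\<Sum>e'\<in>A. D e' - k\<^sup>2 * integral {0..l e'} (\<lambda>x. (f e' x)\<^sup>2))"
proof -
  have "(\<Sum>e'\<in>A. (D(e := d)) e' - k\<^sup>2 * integral {0..l e'} (\<lambda>x. ((f(e := \<phi>)) e' x)\<^sup>2)) =
    (\<Sum>e'\<in>A. D e' - k\<^sup>2 * integral {0..l e'} (\<lambda>x. (f e' x)\<^sup>2))"
    using assms by (intro sum.cong) auto
  then show ?thesis using assms by simp
qed

lemma fun_upd_eq_zeroD:
  fixes f :: "'e \<Rightarrow> real \<Rightarrow> real"
  assumes "f e = 0" "f(e := \<phi>) = 0"
  shows "f = 0" "\<phi> = 0"
proof -
  show "\<phi> = 0" using fun_cong[OF assms(2), of e] by simp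
  show "f = 0"
  proof
    fix e' show "f e' = 0 e'"
      using assms(1) fun_cong[OF assms(2), of e'] by (cases "e' = e") simp_all
  qed
qed

lemma admissible_attach:
  assumes adm: "admissible V A f g D" and e: "e \<in> arcs G" "e \<notin> A"
    and \<phi>: "continuous_on {0..l e} \<phi>" "\<forall>x. x \<notin> {0..l e} \<longrightarrow> \<phi> x = 0" "edge_energy (l e) \<phi> d"
    and new: "\<phi> 0 = g' (tail G e)" "\<phi> (l e) = g' (head G e)"
    and old: "\<And>a. a \<in> A \<Longrightarrow> g' (tail G a) = g (tail G a) \<and> g' (head G a) = g (head G a)"
    and out: "\<And>v. v \<notin> V' \<Longrightarrow> g' v = 0"
  shows "admissible V' (insert e A) (f(e := \<phi>)) g' (D(e := d))"
  unfolding admissible_def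
proof (intro conjI ballI allI impI)
  show "f(e := \<phi>) \<in> edge_fun"
    using adm e(1) \<phi>(1,2) by (auto simp: admissible_def edge_fun_def)
  show "(f(e := \<phi>)) a = 0" if "a \<notin> insert e A" for a
    using that adm by (simp add: admissible_def)
  fix a assume "a \<in> insert e A"
  then show "(f(e := \<phi>)) a 0 = g' (tail G a)" "(f(e := \<phi>)) a (l a) = g' (head G a)"
    "edge_energy (l a) ((f(e := \<phi>)) a) ((D(e := d)) a)"
    using adm \<phi>(3) new old[of a] e(2) by (cases "a = e"; simp add: admissible_def)+
qed (rule out)

text \<open>
  The energy of the branch at \<open>u\<close> is \<open>- k a0\<^sup>2 sin \<theta> cos \<theta>\<close>, which cancels against the Robin term
  \<open>k cot \<theta> (a0 sin \<theta>)\<^sup>2\<close> of \<open>u\<close>.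
\<close>

lemma test_exists_attach_leaf:
  assumes k: "0 < k" and e: "e \<in> arcs G" "e \<notin> A"
    and A: "finite A" "A \<subseteq> arcs G" "\<And>e. e \<in> A \<Longrightarrow> tail G e \<in> V \<and> head G e \<in> V"
    and V: "finite V" "w \<in> V" "u \<notin> V"
    and ends: "tail G e = u \<and> head G e = w \<or> tail G e = w \<and> head G e = u"
    and \<theta>: "0 \<le> \<theta> u" "\<theta> u < pi"
    and M: "M = nat \<lfloor>(k * l e + \<theta> u) / pi\<rfloor>" and \<rho>: "\<rho> = k * l e + \<theta> u - real M * pi"
    and test: "test_exists k V A (\<theta>(w := merge_angle (\<theta> w) \<rho>)) b"
  shows "test_exists k (insert u V) (insert e A) \<theta> (b + real M)"
  unfolding test_exists_def
proof (intro allI impI)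
  fix Ts :: "(('e \<Rightarrow> real \<Rightarrow> real) \<Rightarrow> ('v \<Rightarrow> real) \<Rightarrow> real) list"
  assume Ts: "\<forall>T\<in>set Ts. lin_fun T" "real (length Ts) \<le> b + real M"
  define xs where "xs = (if tail G e = u then 0 else l e)"
  define xt where "xt = (if tail G e = u then l e else 0)"
  have xs_xt: "xs = 0 \<and> xt = l e \<or> xs = l e \<and> xt = 0" by (simp add: xs_def xt_def)
  have uw: "u \<noteq> w" using V by auto
  obtain f g D \<phi> d a0 where R: "robin_test k V A (\<theta>(w := merge_angle (\<theta> w) \<rho>)) f g D"
    and nz: "f \<noteq> 0 \<or> g \<noteq> 0 \<or> \<phi> \<noteq> 0" and out: "\<forall>x. x \<notin> {0..l e} \<longrightarrow> \<phi> x = 0"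
    and cont: "continuous_on {0..l e} \<phi>" and \<phi>: "\<phi> xs = a0 * sin (\<theta> u)" "\<phi> xt = (if \<rho> = 0 then 0 else g w)"
    and deriv: "edge_energy (l e) \<phi> d"
    and d: "d - k\<^sup>2 * integral {0..l e} (\<lambda>x. (\<phi> x)\<^sup>2) =
      k * ((if \<rho> = 0 then 0 else cot \<rho> * (g w)\<^sup>2) - a0\<^sup>2 * sin (\<theta> u) * cos (\<theta> u))"
    and zero: "\<forall>T\<in>set Ts. T (f(e := \<phi>)) (\<lambda>v. g v + (if v = u then sin (\<theta> u) * a0 else 0)) = 0"
    using attach_branch[OF k e(1) \<theta> xs_xt M \<rho> e(2) test Ts, of w u "sin (\<theta> u)"] by (elim exE conjE) (rule that)
  define g' where "g' = (\<lambda>v. g v + (if v = u then sin (\<theta> u) * a0 else 0))"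
  have adm: "admissible V A f g D" and dir: "\<forall>v\<in>V. (\<theta>(w := merge_angle (\<theta> w) \<rho>)) v = 0 \<longrightarrow> g v = 0"
    and form: "robin_form k V A (\<theta>(w := merge_angle (\<theta> w) \<rho>)) f g D \<le> 0"
    using R by (auto simp: robin_test_def)
  have f: "f \<in> edge_fun" "f e = 0" "g u = 0" using adm e V by (auto simp: admissible_def)
  have g': "g' v = g v" if "v \<noteq> u" for v using that by (simp add: g'_def)
  have g'_u: "g' u = sin (\<theta> u) * a0" using f by (simp add: g'_def)
  have \<phi>_xt: "\<phi> xt = g w"
    using \<phi>(2) dir V(2) by (auto simp: merge_angle_def)
  have "admissible (insert u V) (insert e A) (f(e := \<phi>)) g' (D(e := d))"
  proof (rule admissible_attach[OF adm e cont out deriv])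
    show "\<phi> 0 = g' (tail G e)" "\<phi> (l e) = g' (head G e)"
      using ends \<phi>(1) \<phi>_xt uw g'[of w] g'_u by (auto simp: xs_def xt_def)
    show "g' (tail G a) = g (tail G a) \<and> g' (head G a) = g (head G a)" if "a \<in> A" for a
      using A(3)[OF that] V(3) g'[of "tail G a"] g'[of "head G a"] by metis
    show "g' v = 0" if "v \<notin> insert u V" for v
      using that adm by (simp add: admissible_def g'_def)
  qed
  moreover have "\<theta> v = 0 \<longrightarrow> g' v = 0" if "v \<in> insert u V" for v
  proof (cases "v = u")
    case True
    then show ?thesis using g'_u by simp
  next
    case False
    then show ?thesis
      using that dir[rule_format, of v] g' by (cases "v = w") (simp_all add: merge_angle_def)
  qed
  moreover have "robin_form k (insert u V) (insert e A) \<theta> (f(e := \<phi>)) g' (D(e := d)) \<le> 0"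
  proof -
    have vsum: "(\<Sum>v\<in>insert u V. k * cot (\<theta> v) * (g' v)\<^sup>2) =
        k * (a0\<^sup>2 * sin (\<theta> u) * cos (\<theta> u)) + (\<Sum>v\<in>V. k * cot (\<theta> v) * (g v)\<^sup>2)"
    proof -
      have "(\<Sum>v\<in>V. k * cot (\<theta> v) * (g' v)\<^sup>2) = (\<Sum>v\<in>V. k * cot (\<theta> v) * (g v)\<^sup>2)"
        using V by (intro sum.cong) (auto simp: g'_def)
      moreover have "cot (\<theta> u) * (g' u)\<^sup>2 = a0\<^sup>2 * sin (\<theta> u) * cos (\<theta> u)"
      proof (cases "sin (\<theta> u) = 0")
        case True
        then show ?thesis using g'_u by simp
      next
        case False
        then show ?thesis by (simp add: g'_u cot_def power2_eq_square)
      qed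
      ultimately show ?thesis using V by (simp add: mult.assoc)
    qed
    show ?thesis
      using form unfolding robin_form_def vsum robin_form_edges_update[OF A(1) e(2)] d
        robin_sum_merge[OF V(1,2) dir]
      by (cases "\<rho> = 0") (simp_all add: right_diff_distrib)
  qed
  ultimately have "robin_test k (insert u V) (insert e A) \<theta> (f(e := \<phi>)) g' (D(e := d))"
    by (simp add: robin_test_def)
  moreover have "f(e := \<phi>) \<noteq> 0 \<or> g' \<noteq> 0"
  proof -
    have "g' \<noteq> 0" if g_nz: "g \<noteq> 0"
    proof -
      obtain v where v: "g v \<noteq> 0" using g_nz by (auto simp: fun_eq_iff)
      then have "v \<noteq> u" using f(3) by auto
      then have "g' v \<noteq> 0" using v g' by simp
      then show ?thesis by auto
    qed
    moreover have "f(e := \<phi>) \<noteq> 0" if "f \<noteq> 0 \<or> \<phi> \<noteq> 0"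
      using that f(2) fun_upd_eq_zeroD[of f e \<phi>] by blast
    ultimately show ?thesis using nz by blast
  qed
  moreover have "\<forall>T\<in>set Ts. T (f(e := \<phi>)) g' = 0" using zero unfolding g'_def .
  ultimately show "\<exists>f g D. robin_test k (insert u V) (insert e A) \<theta> f g D \<and> (f \<noteq> 0 \<or> g \<noteq> 0) \<and>
      (\<forall>T\<in>set Ts. T f g = 0)"
    by (intro exI[where x = "f(e := \<phi>)"] exI[where x = g'] exI[where x = "D(e := d)"] conjI)
qed

text \<open>
  The arc is cut at its head. There the wave starts with phase \<open>\<pi> / 2\<close> and hence without energy; continuity at the
  head is restored by one additional functional.
\<close>

lemma test_exists_attach_cut_edge:
  assumes k: "0 < k" and e: "e \<in> arcs G" "e \<notin> A"
    and A: "finite A" "A \<subseteq> arcs G"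
    and V: "finite V" "tail G e \<in> V" "head G e \<in> V"
    and M: "M = nat \<lfloor>(k * l e + pi / 2) / pi\<rfloor>" and \<rho>: "\<rho> = k * l e + pi / 2 - real M * pi"
    and test: "test_exists k V A (\<theta>(tail G e := merge_angle (\<theta> (tail G e)) \<rho>)) b"
  shows "test_exists k V (insert e A) \<theta> (b + real M - 1)"
  unfolding test_exists_def
proof (intro allI impI)
  fix Ts :: "(('e \<Rightarrow> real \<Rightarrow> real) \<Rightarrow> ('v \<Rightarrow> real) \<Rightarrow> real) list"
  assume Ts: "\<forall>T\<in>set Ts. lin_fun T" "real (length Ts) \<le> b + real M - 1"
  define w where "w = tail G e"
  have "lin_fun (\<lambda>f g. f e (l e) - g (head G e))"
    by (simp add: lin_fun_def graph_fun_scale_def algebra_simps)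
  then have Ts': "\<forall>T\<in>set ((\<lambda>f g. f e (l e) - g (head G e)) # Ts). lin_fun T"
    "real (length ((\<lambda>f g. f e (l e) - g (head G e)) # Ts)) \<le> b + real M"
    using Ts by simp_all
  have half_pi: "0 \<le> pi / 2" "pi / 2 < pi" by simp_all
  have ends: "l e = 0 \<and> (0 :: real) = l e \<or> l e = l e \<and> (0 :: real) = 0" by simp
  obtain f g D \<phi> d a0 where R: "robin_test k V A (\<theta>(w := merge_angle (\<theta> w) \<rho>)) f g D"
    and nz: "f \<noteq> 0 \<or> g \<noteq> 0 \<or> \<phi> \<noteq> 0" and out: "\<forall>x. x \<notin> {0..l e} \<longrightarrow> \<phi> x = 0"
    and cont: "continuous_on {0..l e} \<phi>" and "\<phi> (l e) = a0 * sin (pi / 2)" and \<phi>: "\<phi> 0 = (if \<rho> = 0 then 0 else g w)"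
    and deriv: "edge_energy (l e) \<phi> d"
    and d: "d - k\<^sup>2 * integral {0..l e} (\<lambda>x. (\<phi> x)\<^sup>2) =
      k * ((if \<rho> = 0 then 0 else cot \<rho> * (g w)\<^sup>2) - a0\<^sup>2 * sin (pi / 2) * cos (pi / 2))"
    and zero: "\<forall>T\<in>set ((\<lambda>f g. f e (l e) - g (head G e)) # Ts).
      T (f(e := \<phi>)) (\<lambda>v. g v + (if v = w then 0 * a0 else 0)) = 0"
    using attach_branch[OF k e(1) half_pi ends M \<rho> e(2) test[folded w_def] Ts', of w w 0] by (elim exE conjE) (rule that)
  have adm: "admissible V A f g D" and dir: "\<forall>v\<in>V. (\<theta>(w := merge_angle (\<theta> w) \<rho>)) v = 0 \<longrightarrow> g v = 0"
    and form: "robin_form k V A (\<theta>(w := merge_angle (\<theta> w) \<rho>)) f g D \<le> 0"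
    using R by (auto simp: robin_test_def)
  have f: "f \<in> edge_fun" "f e = 0" using adm e by (auto simp: admissible_def)
  have \<phi>_0: "\<phi> 0 = g (tail G e)"
    using \<phi> dir V(2) by (auto simp: merge_angle_def w_def)
  have \<phi>_l: "\<phi> (l e) = g (head G e)" using zero by simp
  have "admissible V (insert e A) (f(e := \<phi>)) g (D(e := d))"
    using adm \<phi>_0 \<phi>_l by (intro admissible_attach[OF adm e cont out deriv]) (simp_all add: admissible_def)
  moreover have "\<theta> v = 0 \<longrightarrow> g v = 0" if "v \<in> V" for v
    using that dir[rule_format, of v] by (cases "v = w") (simp_all add: merge_angle_def)
  moreover have "robin_form k V (insert e A) \<theta> (f(e := \<phi>)) g (D(e := d)) \<le> 0"
  proof -
    have "w \<in> V" using V(2) by (simp add: w_def)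
    then show ?thesis
      using form unfolding robin_form_def robin_form_edges_update[OF A(1) e(2)] d
        robin_sum_merge[OF V(1) \<open>w \<in> V\<close> dir]
      by (cases "\<rho> = 0") simp_all
  qed
  ultimately have "robin_test k V (insert e A) \<theta> (f(e := \<phi>)) g (D(e := d))"
    by (simp add: robin_test_def)
  moreover have "f(e := \<phi>) \<noteq> 0" if "f \<noteq> 0 \<or> \<phi> \<noteq> 0"
    using that f(2) fun_upd_eq_zeroD[of f e \<phi>] by blast
  then have "f(e := \<phi>) \<noteq> 0 \<or> g \<noteq> 0" using nz by blast
  moreover have "\<forall>T\<in>set Ts. T (f(e := \<phi>)) g = 0"
  proof -
    have "(\<lambda>v. g v + (if v = w then 0 * a0 else 0)) = g" by (simp add: fun_eq_iff)
    then show ?thesis using zero by simp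
  qed
  ultimately show "\<exists>f g D. robin_test k V (insert e A) \<theta> f g D \<and> (f \<noteq> 0 \<or> g \<noteq> 0) \<and>
      (\<forall>T\<in>set Ts. T f g = 0)"
    by (intro exI[where x = "f(e := \<phi>)"] exI[where x = g] exI[where x = "D(e := d)"] conjI)
qed

end

section \<open>Building up a connected graph and counting test functions\<close>

context fin_digraph begin

text \<open>
  Connected subgraphs that contain \<open>r\<close>, built up arc by arc. An arc either adds a new vertex or closes a cycle, so the
  Betti number is the number of uses of the last rule.
\<close>

inductive built :: "'a \<Rightarrow> 'a set \<Rightarrow> 'b set \<Rightarrow> bool" for r where
  built_root: "r \<in> verts G \<Longrightarrow> built r {r} {}"
| built_leaf: "built r V A \<Longrightarrow> e \<in> arcs G \<Longrightarrow> e \<notin> A \<Longrightarrow> w \<in> V \<Longrightarrow> u \<notin> V \<Longrightarrow>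
    tail G e = u \<and> head G e = w \<or> tail G e = w \<and> head G e = u \<Longrightarrow> built r (insert u V) (insert e A)"
| built_cycle: "built r V A \<Longrightarrow> e \<in> arcs G \<Longrightarrow> e \<notin> A \<Longrightarrow> tail G e \<in> V \<Longrightarrow> head G e \<in> V \<Longrightarrow>
    built r V (insert e A)"

lemma built_subgraph:
  assumes "built r V A"
  shows "finite V" "finite A" "A \<subseteq> arcs G" "V \<subseteq> verts G" "r \<in> V"
    "e \<in> A \<Longrightarrow> tail G e \<in> V \<and> head G e \<in> V" "card V \<le> card A + 1"
proof -
  have "finite V \<and> finite A \<and> A \<subseteq> arcs G \<and> V \<subseteq> verts G \<and> r \<in> V \<and>
      (\<forall>e\<in>A. tail G e \<in> V \<and> head G e \<in> V) \<and> card V \<le> card A + 1"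
    using assms by induction (auto simp: card_insert_if)
  then show "finite V" "finite A" "A \<subseteq> arcs G" "V \<subseteq> verts G" "r \<in> V"
    "e \<in> A \<Longrightarrow> tail G e \<in> V \<and> head G e \<in> V" "card V \<le> card A + 1" by auto
qed

text \<open>
  Connectedness without reference to a root: every proper nonempty part of \<open>V\<close> is joined to the
  rest. It serves to move the root of a construction to another vertex.
\<close>

definition linked :: "'a set \<Rightarrow> 'b set \<Rightarrow> bool" where
  "linked V A \<longleftrightarrow> (\<forall>S. S \<subseteq> V \<longrightarrow> S \<noteq> {} \<longrightarrow> S \<noteq> V \<longrightarrow>
     (\<exists>e\<in>A. tail G e \<in> S \<and> head G e \<in> V - S \<or> head G e \<in> S \<and> tail G e \<in> V - S))"

lemma built_linked: "built r V A \<Longrightarrow> linked V A"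
proof (induction rule: built.induct)
  case built_root
  then show ?case by (auto simp: linked_def)
next
  case (built_leaf V A e w u)
  show ?case
    unfolding linked_def
  proof (intro allI impI)
    fix S assume S: "S \<subseteq> insert u V" "S \<noteq> {}" "S \<noteq> insert u V"
    consider "S \<inter> V = {}" | "S \<inter> V = V" | "S \<inter> V \<noteq> {}" "S \<inter> V \<noteq> V" by blast
    then show "\<exists>e\<in>insert e A. tail G e \<in> S \<and> head G e \<in> insert u V - S \<or>
        head G e \<in> S \<and> tail G e \<in> insert u V - S"
    proof cases
      case 1
      then have "u \<in> S" "w \<notin> S" using S built_leaf.hyps by auto
      then show ?thesis using built_leaf.hyps by auto
    next
      case 2
      then have "u \<notin> S" "w \<in> S" using S built_leaf.hyps by auto
      then show ?thesis using built_leaf.hyps by auto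
    next
      case 3
      then obtain e' where e': "e' \<in> A" "tail G e' \<in> S \<inter> V \<and> head G e' \<in> V - S \<inter> V \<or>
          head G e' \<in> S \<inter> V \<and> tail G e' \<in> V - S \<inter> V"
        using built_leaf.IH[unfolded linked_def, rule_format, of "S \<inter> V"] by blast
      then show ?thesis by (intro bexI[of _ e']) auto
    qed
  qed
next
  case (built_cycle V A e)
  show ?case
    unfolding linked_def
  proof (intro allI impI)
    fix S assume "S \<subseteq> V" "S \<noteq> {}" "S \<noteq> V"
    then obtain e' where "e' \<in> A" "tail G e' \<in> S \<and> head G e' \<in> V - S \<or> head G e' \<in> S \<and> tail G e' \<in> V - S"
      using built_cycle.IH[unfolded linked_def, rule_format, of S] by blast
    then show "\<exists>e\<in>insert e A. tail G e \<in> S \<and> head G e \<in> V - S \<or> head G e \<in> S \<and> tail G e \<in> V - S"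
      by blast
  qed
qed

text \<open>
  In a maximal connected subgraph around \<open>r\<close> no arc can be missing.
\<close>

lemma linked_built:
  assumes linked: "linked V A" and V: "V \<subseteq> verts G" "r \<in> V" and A: "A \<subseteq> arcs G"
    and ends: "\<And>e. e \<in> A \<Longrightarrow> tail G e \<in> V \<and> head G e \<in> V"
  shows "built r V A"
proof -
  define P where "P = (\<lambda>B. B \<subseteq> A \<and> (\<exists>W. built r W B \<and> W \<subseteq> V))"
  have finA: "finite A" using A finite_arcs finite_subset by blast
  have "P {}" using V by (auto simp: P_def intro!: exI[of _ "{r}"] built_root)
  moreover have "\<forall>B. P B \<longrightarrow> card B < Suc (card A)"
    using finA by (auto simp: P_def less_Suc_eq_le intro: card_mono)
  ultimately have "\<exists>B. P B \<and> (\<forall>B'. P B' \<longrightarrow> card B' \<le> card B)" by (rule ex_has_greatest_nat)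
  then obtain B where B: "P B" and max: "\<And>B'. P B' \<Longrightarrow> card B' \<le> card B" by blast
  obtain W where W: "built r W B" "W \<subseteq> V" "B \<subseteq> A" using B unfolding P_def by blast
  note sub = built_subgraph[OF W(1)]
  have no_larger: "\<not> built r W' (insert e B)" if "e \<in> A" "e \<notin> B" "W' \<subseteq> V" for e W'
  proof
    assume "built r W' (insert e B)"
    then have "P (insert e B)" unfolding P_def using that(1,3) W(3) by blast
    then show False using max[of "insert e B"] that(2) sub(2) by simp
  qed
  have "W = V"
  proof (rule ccontr)
    assume "W \<noteq> V"
    then obtain e where e: "e \<in> A" "tail G e \<in> W \<and> head G e \<in> V - W \<or> head G e \<in> W \<and> tail G e \<in> V - W"
      using linked[unfolded linked_def, rule_format, of W] W sub(5) by blast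
    then have "e \<notin> B" using sub(6) by blast
    have "\<exists>u. u \<in> V \<and> built r (insert u W) (insert e B)"
      using e(2)
    proof
      assume "tail G e \<in> W \<and> head G e \<in> V - W"
      then show ?thesis
        using built_leaf[OF W(1), of e "tail G e" "head G e"] e A \<open>e \<notin> B\<close> by blast
    next
      assume "head G e \<in> W \<and> tail G e \<in> V - W"
      then show ?thesis
        using built_leaf[OF W(1), of e "head G e" "tail G e"] e A \<open>e \<notin> B\<close> by blast
    qed
    then show False using no_larger[OF e(1) \<open>e \<notin> B\<close>] W(2) by blast
  qed
  moreover have "B = A"
  proof (rule ccontr)
    assume "B \<noteq> A"
    then obtain e where e: "e \<in> A" "e \<notin> B" using W(3) by blast
    then have "built r W (insert e B)"
      using A ends[OF e(1)] \<open>W = V\<close> by (intro built_cycle[OF W(1)]) auto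
    then show False using no_larger[OF e] W(2) by blast
  qed
  ultimately show ?thesis using W(1) by simp
qed

lemma connected_linked:
  assumes "Digraph_Component.connected G"
  shows "linked (verts G) (arcs G)"
  unfolding linked_def
proof (intro allI impI)
  fix S assume S: "S \<subseteq> verts G" "S \<noteq> {}" "S \<noteq> verts G"
  then obtain u v where u: "u \<in> S" and v: "v \<in> verts G" "v \<notin> S" by blast
  have "u \<rightarrow>\<^sup>*\<^bsub>with_proj (mk_symmetric G)\<^esub> v"
    using assms u v S by (auto simp: Digraph_Component.connected_def strongly_connected_def)
  then have "(u, v) \<in> rtrancl_on (verts G) (\<Union>e\<in>arcs G. {(tail G e, head G e), (head G e, tail G e)})"
    by (simp add: reachable_def mk_symmetric_def arcs_ends_def arc_to_ends_def)
  then have "v \<in> S \<or> (\<exists>e\<in>arcs G. tail G e \<in> S \<and> head G e \<in> verts G - S \<or> head G e \<in> S \<and> tail G e \<in> verts G - S)"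
    using u by (induction rule: rtrancl_on.induct) auto
  then show "\<exists>e\<in>arcs G. tail G e \<in> S \<and> head G e \<in> verts G - S \<or> head G e \<in> S \<and> tail G e \<in> verts G - S"
    using v by blast
qed

lemma built_remove_cycle_arc:
  "built r V A \<Longrightarrow> card V < card A + 1 \<Longrightarrow> \<exists>e\<in>A. built r V (A - {e})"
proof (induction rule: built.induct)
  case (built_leaf V A e w u)
  note sub = built_subgraph[OF built_leaf.hyps(1)]
  have "card V < card A + 1" using built_leaf.prems built_leaf.hyps sub by simp
  then obtain e' where e': "e' \<in> A" "built r V (A - {e'})" using built_leaf.IH by blast
  have "built r (insert u V) (insert e (A - {e'}))"
    using built_leaf.hyps by (intro built.built_leaf[OF e'(2)]) auto
  moreover have "insert e (A - {e'}) = insert e A - {e'}" using e'(1) built_leaf.hyps by auto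
  ultimately show ?case using e'(1) by auto
next
  case (built_cycle V A e)
  then have "insert e A - {e} = A" by auto
  then show ?case using built_cycle.hyps(1) by auto
qed simp

definition arc_degree :: "'b set \<Rightarrow> 'a \<Rightarrow> nat" where
  "arc_degree A v = card {e \<in> A. tail G e = v} + card {e \<in> A. head G e = v}"

lemma arc_degree_arcs: "arc_degree (arcs G) v = vertex_degree G v"
  by (simp add: arc_degree_def vertex_degree_def out_degree_def in_degree_def out_arcs_def in_arcs_def)

lemma arc_degree_insert:
  assumes "finite A" "e \<notin> A"
  shows "arc_degree (insert e A) v =
    arc_degree A v + (if tail G e = v then 1 else 0) + (if head G e = v then 1 else 0)"
proof -
  have "card {e' \<in> insert e A. t e' = v} = card {e' \<in> A. t e' = v} + (if t e = v then 1 else 0)"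
    for t :: "'b \<Rightarrow> 'a"
  proof -
    have "{e' \<in> insert e A. t e' = v} = (if t e = v then insert e {e' \<in> A. t e' = v} else {e' \<in> A. t e' = v})"
      by auto
    then show ?thesis using assms by simp
  qed
  then show ?thesis by (simp add: arc_degree_def)
qed

lemma arc_degree_outside:
  assumes "\<And>e. e \<in> A \<Longrightarrow> tail G e \<noteq> v \<and> head G e \<noteq> v"
  shows "arc_degree A v = 0"
proof -
  have empty: "{e \<in> A. tail G e = v} = {}" "{e \<in> A. head G e = v} = {}" using assms by auto
  show ?thesis unfolding arc_degree_def empty by simp
qed

lemma built_tree_has_leaf:
  assumes "built r V A" "card V = card A + 1" "A \<noteq> {}"
  shows "\<exists>v\<in>V. arc_degree A v = 1"
  using assms(1)
proof cases
  case (built_leaf V' A' e w u)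
  note sub = built_subgraph[OF built_leaf(3)]
  have "arc_degree A' u = 0" using sub(6) built_leaf by (intro arc_degree_outside) blast
  then have "arc_degree A u = 1"
    using built_leaf sub(2) by (auto simp: arc_degree_insert)
  then show ?thesis using built_leaf by blast
next
  case (built_cycle A' e)
  then show ?thesis using built_subgraph(7)[OF built_cycle(2)] built_subgraph(2)[OF built_cycle(2)] assms(2) by simp
qed (use assms in auto)

end

context metric_graph begin

text \<open>
  The gain in phase attributed to a vertex; \<open>N\<close> is the set of vertices to which nothing has been attached.
  A vertex outside \<open>N\<close> enters with its phase minus the possible loss \<open>\<pi>\<close> of the next merger. In
  \<open>N\<close> the next merger is free of loss, and an end of degree one is itself the start of a branch with phase \<open>\<pi> / 2\<close>. The
  root never starts a branch.
\<close>

definition vertex_weight :: "'v \<Rightarrow> 'e set \<Rightarrow> 'v set \<Rightarrow> ('v \<Rightarrow> real) \<Rightarrow> 'v \<Rightarrow> real" where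
  "vertex_weight r A N \<theta> v =
     (if v \<notin> N then \<theta> v - pi else if v \<noteq> r \<and> arc_degree A v = 1 then - pi / 2 else 0)"

definition count_bound :: "real \<Rightarrow> 'v \<Rightarrow> 'v set \<Rightarrow> 'e set \<Rightarrow> 'v set \<Rightarrow> ('v \<Rightarrow> real) \<Rightarrow> real" where
  "count_bound k r V A N \<theta> =
     (k * (\<Sum>e\<in>A. l e) + (\<Sum>v\<in>V. vertex_weight r A N \<theta> v)) / pi + 1 / 2 -
     2 * (real (card A) - real (card V) + 1)"

definition angles_ok :: "'v set \<Rightarrow> 'v set \<Rightarrow> ('v \<Rightarrow> real) \<Rightarrow> bool" where
  "angles_ok V N \<theta> \<longleftrightarrow> (\<forall>v\<in>V. 0 \<le> \<theta> v \<and> \<theta> v < pi) \<and> N \<subseteq> V \<and> (\<forall>v\<in>N. \<theta> v = pi / 2)"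

text \<open>
  At \<open>w\<close> the new weight is at least the old one plus \<open>\<rho> - \<pi>\<close>: for a used vertex by the bound on the loss, for a fresh
  one because its old weight is at most zero and nothing is lost.
\<close>

lemma vertex_weight_merge:
  assumes ok: "angles_ok V N \<theta>" and w: "w \<in> V" and \<rho>: "0 \<le> \<rho>" "\<rho> < pi"
    and N': "w \<notin> N'"
  shows "vertex_weight r A' N \<theta> w + (\<rho> - pi) \<le> vertex_weight r A N' (\<theta>(w := merge_angle (\<theta> w) \<rho>)) w"
proof (cases "w \<in> N")
  case True
  then have "\<theta> w = pi / 2" using ok unfolding angles_ok_def by blast
  then have "merge_angle (\<theta> w) \<rho> = \<rho>" using \<rho> by (simp only: merge_angle_half_pi)
  then show ?thesis using N' True by (simp add: vertex_weight_def)
next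
  case False
  have "0 \<le> \<theta> w" "\<theta> w < pi" using ok w by (auto simp: angles_ok_def)
  then show ?thesis using False N' merge_angle_ge[of "\<theta> w" \<rho>] \<rho> by (simp add: vertex_weight_def)
qed

text \<open>
  The count ends at the root. If its phase is at least \<open>\<pi> / 2\<close>, the Robin term is nonpositive and the
  value at the root is one last degree of freedom; otherwise the bound is negative.
\<close>

lemma test_exists_single_vertex:
  assumes k: "0 < k" and ok: "angles_ok {r} N \<theta>"
  shows "test_exists k {r} {} \<theta> (count_bound k r {r} {} N \<theta>)"
  unfolding test_exists_def
proof (intro allI impI)
  fix Ts :: "(('e \<Rightarrow> real \<Rightarrow> real) \<Rightarrow> ('v \<Rightarrow> real) \<Rightarrow> real) list"
  assume "real (length Ts) \<le> count_bound k r {r} {} N \<theta>"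
  then have len: "real (length Ts) \<le> vertex_weight r {} N \<theta> r / pi + 1 / 2"
    by (simp add: count_bound_def)
  have \<theta>: "0 \<le> \<theta> r" "\<theta> r < pi" using ok by (auto simp: angles_ok_def)
  have "Ts = [] \<and> pi / 2 \<le> \<theta> r"
  proof (cases "r \<in> N")
    case True
    then have "real (length Ts) \<le> 1 / 2" using len by (simp add: vertex_weight_def)
    then have "length Ts = 0" by linarith
    then show ?thesis using True ok by (auto simp: angles_ok_def)
  next
    case False
    then have le: "real (length Ts) \<le> \<theta> r / pi - 1 / 2" using len by (simp add: vertex_weight_def field_simps)
    moreover have "\<theta> r / pi < 1" using \<theta> by simp
    ultimately have "length Ts = 0" by linarith
    then show ?thesis using le by (simp add: field_simps)
  qed
  then have Ts: "Ts = []" and half: "pi / 2 \<le> \<theta> r" by auto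
  define g where "g = (\<lambda>v. if v = r then 1 else 0 :: real)"
  have "cos (\<theta> r) \<le> 0" using cos_monotone_0_pi_le[of "pi / 2" "\<theta> r"] half \<theta> by simp
  moreover have "0 < sin (\<theta> r)" using half \<theta> pi_gt_zero by (intro sin_gt_zero) linarith+
  ultimately have "k * cot (\<theta> r) \<le> 0"
    using k by (simp add: cot_def mult_le_0_iff divide_le_0_iff)
  moreover have "\<theta> r \<noteq> 0" using half pi_gt_zero by linarith
  ultimately have "robin_test k {r} {} \<theta> 0 g (\<lambda>_. 0)"
    by (simp add: robin_test_def admissible_def robin_form_def zero_edge_fun g_def)
  moreover have "g \<noteq> 0"
  proof
    assume "g = 0"
    then have "g r = 0" by simp
    then show False by (simp add: g_def)
  qed
  ultimately show "\<exists>f g D. robin_test k {r} {} \<theta> f g D \<and> (f \<noteq> 0 \<or> g \<noteq> 0) \<and> (\<forall>T\<in>set Ts. T f g = 0)"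
    unfolding Ts by auto
qed

text \<open>
  A branch of \<open>M\<close> nodal intervals contributes \<open>M\<close> test functions, and \<open>k l e + \<theta> u = M \<pi> + \<rho>\<close>; the rest \<open>\<rho>\<close> is passed on to \<open>w\<close>.
\<close>

lemma test_exists_leaf_step:
  assumes k: "0 < k" and built: "built r V A" and e: "e \<in> arcs G" "e \<notin> A" and w: "w \<in> V" and u: "u \<notin> V"
    and ends: "tail G e = u \<and> head G e = w \<or> tail G e = w \<and> head G e = u"
    and IH: "\<And>N \<theta>. angles_ok V N \<theta> \<Longrightarrow> test_exists k V A \<theta> (count_bound k r V A N \<theta>)"
    and ok: "angles_ok (insert u V) N \<theta>"
  shows "test_exists k (insert u V) (insert e A) \<theta> (count_bound k r (insert u V) (insert e A) N \<theta>)"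
proof -
  note sub = built_subgraph[OF built]
  define M where "M = nat \<lfloor>(k * l e + \<theta> u) / pi\<rfloor>"
  define \<rho> where "\<rho> = k * l e + \<theta> u - real M * pi"
  have \<theta>u: "0 \<le> \<theta> u" "\<theta> u < pi" using ok by (auto simp: angles_ok_def)
  have "0 \<le> k * l e + \<theta> u" using k l_pos[OF e(1)] \<theta>u by simp
  then have \<rho>: "0 \<le> \<rho>" "\<rho> < pi" unfolding \<rho>_def M_def by (rule rest_phase_range)+
  define \<theta>' where "\<theta>' = \<theta>(w := merge_angle (\<theta> w) \<rho>)"
  define N' where "N' = N - {w, u}"
  have ok': "angles_ok V N' \<theta>'"
    using ok merge_angle_range by (auto simp: angles_ok_def \<theta>'_def N'_def)
  have deg_u: "arc_degree (insert e A) u = 1"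
  proof -
    have "arc_degree A u = 0" using sub(6) u by (intro arc_degree_outside) blast
    then show ?thesis using ends w u e sub(2) by (auto simp: arc_degree_insert)
  qed
  have "u \<noteq> r" "u \<noteq> w" using sub(5) u w by auto
  then have weight_u: "vertex_weight r (insert e A) N \<theta> u = \<theta> u - pi"
    using deg_u ok by (auto simp: vertex_weight_def angles_ok_def)
  have "vertex_weight r (insert e A) N \<theta> v + (if v = w then \<rho> - pi else 0) \<le> vertex_weight r A N' \<theta>' v"
    if v: "v \<in> V" for v
  proof (cases "v = w")
    case True
    then show ?thesis
      using vertex_weight_merge[OF ok _ \<rho>, of w N' r "insert e A" A] w by (simp add: \<theta>'_def N'_def)
  next
    case False
    then have "arc_degree (insert e A) v = arc_degree A v"
      using v u ends e sub(2) by (auto simp: arc_degree_insert)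
    then show ?thesis using False v u by (auto simp: vertex_weight_def \<theta>'_def N'_def)
  qed
  then have "(\<Sum>v\<in>V. vertex_weight r (insert e A) N \<theta> v + (if v = w then \<rho> - pi else 0)) \<le>
      (\<Sum>v\<in>V. vertex_weight r A N' \<theta>' v)" by (rule sum_mono)
  then have weights: "(\<Sum>v\<in>V. vertex_weight r (insert e A) N \<theta> v) + (\<rho> - pi) \<le>
      (\<Sum>v\<in>V. vertex_weight r A N' \<theta>' v)"
    using sub(1) w by (simp add: sum.distrib)
  have "test_exists k (insert u V) (insert e A) \<theta> (count_bound k r V A N' \<theta>' + real M)"
    using IH[OF ok'] sub(1-3,6) e w u ends \<theta>u k
    by (intro test_exists_attach_leaf[where \<theta> = \<theta> and u = u and w = w, OF k e _ _ _ _ w u ends \<theta>u M_def \<rho>_def])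
      (auto simp: \<theta>'_def)
  then show ?thesis
  proof (rule test_exists_mono)
    define X where "X = k * (\<Sum>e\<in>A. l e) + (\<Sum>v\<in>V. vertex_weight r (insert e A) N \<theta> v)"
    have "count_bound k r (insert u V) (insert e A) N \<theta> =
        (X + k * l e + \<theta> u - pi) / pi + 1 / 2 - 2 * (real (card A) - real (card V) + 1)"
      using sub(1,2) e u by (simp add: count_bound_def weight_u X_def algebra_simps)
    also have "\<dots> = (X + (\<rho> - pi)) / pi + real M + 1 / 2 - 2 * (real (card A) - real (card V) + 1)"
      by (simp add: \<rho>_def field_simps)
    also have "\<dots> \<le> count_bound k r V A N' \<theta>' + real M"
      using weights unfolding count_bound_def X_def by (simp add: divide_right_mono)
    finally show "count_bound k r (insert u V) (insert e A) N \<theta> \<le> count_bound k r V A N' \<theta>' + real M" .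
  qed
qed

text \<open>
  Closing a cycle costs 2: one unit for the functional, one half for the new end with phase \<open>\<pi> / 2\<close> instead
  of \<open>\<pi>\<close>, and one half if the head becomes an end itself. The last half is saved when the head is the root.
\<close>

lemma test_exists_cycle_step:
  assumes k: "0 < k" and built: "built r V A" and e: "e \<in> arcs G" "e \<notin> A"
    and ends: "tail G e \<in> V" "head G e \<in> V"
    and IH: "\<And>N \<theta>. angles_ok V N \<theta> \<Longrightarrow> test_exists k V A \<theta> (count_bound k r V A N \<theta>)"
    and ok: "angles_ok V N \<theta>"
  shows "test_exists k V (insert e A) \<theta>
    (count_bound k r V (insert e A) N \<theta> + (if head G e = r then 1 / 2 else 0))"
proof -
  note sub = built_subgraph[OF built]
  define w where "w = tail G e"
  define M where "M = nat \<lfloor>(k * l e + pi / 2) / pi\<rfloor>"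
  define \<rho> where "\<rho> = k * l e + pi / 2 - real M * pi"
  have "0 \<le> k * l e + pi / 2" using k l_pos[OF e(1)] by simp
  then have \<rho>: "0 \<le> \<rho>" "\<rho> < pi" unfolding \<rho>_def M_def by (rule rest_phase_range)+
  define \<theta>' where "\<theta>' = \<theta>(w := merge_angle (\<theta> w) \<rho>)"
  define N' where "N' = N - {w}"
  define loss where "loss = (if head G e = r then 0 else pi / 2)"
  have loss: "0 \<le> loss" by (simp add: loss_def)
  have ok': "angles_ok V N' \<theta>'"
    using ok merge_angle_range by (auto simp: angles_ok_def \<theta>'_def N'_def)
  have w: "w \<in> V" using ends by (simp add: w_def)
  have "vertex_weight r (insert e A) N \<theta> v + (if v = w then \<rho> - pi else 0) + (if v = head G e then - loss else 0) \<le>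
      vertex_weight r A N' \<theta>' v" if v: "v \<in> V" for v
  proof (cases "v = w")
    case True
    have "vertex_weight r (insert e A) N \<theta> v + (\<rho> - pi) \<le> vertex_weight r A N' \<theta>' v"
      using vertex_weight_merge[OF ok w \<rho>, of N' r "insert e A" A] unfolding True by (simp add: \<theta>'_def N'_def)
    moreover have "(if v = w then \<rho> - pi else 0) = \<rho> - pi" using True by simp
    moreover have "(if v = head G e then - loss else 0) \<le> 0" using loss by simp
    ultimately show ?thesis by linarith
  next
    case False
    show ?thesis
    proof (cases "v = head G e")
      case True
      then show ?thesis using False by (auto simp: vertex_weight_def \<theta>'_def N'_def loss_def)
    next
      case not_head: False
      then have "arc_degree (insert e A) v = arc_degree A v"
        using False e sub(2) by (auto simp: arc_degree_insert w_def)
      then show ?thesis using False not_head by (auto simp: vertex_weight_def \<theta>'_def N'_def)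
    qed
  qed
  then have "(\<Sum>v\<in>V. vertex_weight r (insert e A) N \<theta> v + (if v = w then \<rho> - pi else 0) +
      (if v = head G e then - loss else 0)) \<le> (\<Sum>v\<in>V. vertex_weight r A N' \<theta>' v)" by (rule sum_mono)
  then have weights: "(\<Sum>v\<in>V. vertex_weight r (insert e A) N \<theta> v) + (\<rho> - pi) - loss \<le>
      (\<Sum>v\<in>V. vertex_weight r A N' \<theta>' v)"
    using sub(1) w ends by (simp add: sum.distrib)
  have "test_exists k V (insert e A) \<theta> (count_bound k r V A N' \<theta>' + real M - 1)"
    using IH[OF ok'] sub(1-3) e ends k
    by (intro test_exists_attach_cut_edge[OF k e _ _ _ _ _ M_def \<rho>_def]) (auto simp: \<theta>'_def w_def)
  then show ?thesis
  proof (rule test_exists_mono)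
    define X where "X = k * (\<Sum>e\<in>A. l e) + (\<Sum>v\<in>V. vertex_weight r (insert e A) N \<theta> v)"
    have "count_bound k r V (insert e A) N \<theta> + (if head G e = r then 1 / 2 else 0) =
        (X + k * l e - loss) / pi + 1 - 2 * (real (card A) - real (card V) + 2)"
      using sub(1,2) e by (simp add: count_bound_def X_def loss_def field_simps)
    also have "\<dots> = (X + (\<rho> - pi) - loss) / pi + real M - 1 + 1 / 2 - 2 * (real (card A) - real (card V) + 1)"
      by (simp add: \<rho>_def field_simps)
    also have "\<dots> \<le> count_bound k r V A N' \<theta>' + real M - 1"
      using weights unfolding count_bound_def X_def by (simp add: divide_right_mono)
    finally show "count_bound k r V (insert e A) N \<theta> + (if head G e = r then 1 / 2 else 0) \<le>
        count_bound k r V A N' \<theta>' + real M - 1" .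
  qed
qed

theorem test_exists_count:
  assumes k: "0 < k" and "built r V A" and "angles_ok V N \<theta>"
  shows "test_exists k V A \<theta> (count_bound k r V A N \<theta>)"
  using assms(2,3)
proof (induction arbitrary: N \<theta> rule: built.induct)
  case built_root
  then show ?case using k by (intro test_exists_single_vertex)
next
  case (built_leaf V A e w u)
  then show ?case using k by (intro test_exists_leaf_step[where w = w]) auto
next
  case (built_cycle V A e)
  have "test_exists k V (insert e A) \<theta>
      (count_bound k r V (insert e A) N \<theta> + (if head G e = r then 1 / 2 else 0))"
    using built_cycle k by (intro test_exists_cycle_step) auto
  then show ?case by (rule test_exists_mono) simp
qed

text \<open>
  Orthogonality to the first \<open>n\<close> eigenfunctions amounts to \<open>n\<close> functionals, and with phase \<open>\<pi> / 2\<close> at all vertices the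
  Robin terms vanish.
\<close>

lemma neumann_ev_le_of_test_exists:
  assumes k: "0 < k" and test: "test_exists k (verts G) (arcs G) (\<lambda>_. pi / 2) (real n)"
  shows "neumann_ev G n l \<le> k\<^sup>2"
proof -
  obtain e where e: "\<And>i. e i \<in> edge_fun"
    and var: "\<And>f f'. piecewise_deriv f f' \<Longrightarrow> (\<And>i. i < n \<Longrightarrow> ip f (e i) = 0) \<Longrightarrow>
      neumann_ev G n l * ip f f \<le> dirichlet f'"
    using neumann_ev_variational[of n] by blast
  have "lin_fun (\<lambda>f g. ip f (e i))" for i
    unfolding lin_fun_def
    using e subspace_edge_fun by (auto simp: ip_add ip_scale graph_fun.subspace_scale)
  then have lin: "\<forall>T\<in>set (map (\<lambda>i f g. ip f (e i)) [0..<n]). lin_fun T" by simp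
  have len: "real (length (map (\<lambda>i f g. ip f (e i)) [0..<n])) \<le> real n" by simp
  obtain f g D where R: "robin_test k (verts G) (arcs G) (\<lambda>_. pi / 2) f g D" and nz: "f \<noteq> 0 \<or> g \<noteq> 0"
    and orth: "\<forall>T\<in>set (map (\<lambda>i f g. ip f (e i)) [0..<n]). T f g = 0"
    using test[unfolded test_exists_def, THEN spec, THEN mp, OF lin, THEN mp, OF len] by (elim exE conjE)
  have adm: "admissible (verts G) (arcs G) f g D" using R by (simp add: robin_test_def)
  have f: "f \<in> edge_fun" using adm by (simp add: admissible_def)
  have ends: "f a 0 = g (tail G a)" "f a (l a) = g (head G a)" if "a \<in> arcs G" for a
    using adm that by (auto simp: admissible_def)
  have f_nz: "f \<noteq> 0"
  proof
    assume "f = 0"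
    have "g v = 0" for v
    proof (cases "v \<in> verts G")
      case True
      then show ?thesis using incident[OF True] ends \<open>f = 0\<close> by auto
    next
      case False
      then show ?thesis using adm by (simp add: admissible_def)
    qed
    then have "g = 0" by (simp add: fun_eq_iff)
    then show False using nz \<open>f = 0\<close> by simp
  qed
  have cont: "continuous_graph_fun G l f" using f ends by (rule continuous_graph_funI)
  have "\<forall>a\<in>arcs G. \<exists>f' S. finite S \<and> (\<forall>x\<in>{0<..<l a} - S. (f a has_real_derivative f' x) (at x)) \<and>
      ((\<lambda>x. (f' x)\<^sup>2) has_integral D a) {0..l a}"
    using adm by (simp add: admissible_def edge_energy_def)
  then obtain f' where f': "\<forall>a\<in>arcs G. \<exists>S. finite S \<and>
      (\<forall>x\<in>{0<..<l a} - S. (f a has_real_derivative f' a x) (at x)) \<and>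
      ((\<lambda>x. (f' a x)\<^sup>2) has_integral D a) {0..l a}"
    by metis
  have "piecewise_deriv f f'"
    unfolding piecewise_deriv_def using cont f' by (blast intro: has_integral_integrable)
  then have "neumann_ev G n l * ip f f \<le> dirichlet f'"
    using orth by (intro var) auto
  also have "\<dots> = (\<Sum>a\<in>arcs G. D a)"
    unfolding dirichlet_def using f' by (intro sum.cong) (auto intro: integral_unique)
  also have "\<dots> \<le> k\<^sup>2 * ip f f"
  proof -
    have "robin_form k (verts G) (arcs G) (\<lambda>_. pi / 2) f g D \<le> 0" using R by (simp add: robin_test_def)
    then show ?thesis
      by (simp add: robin_form_def ip_def cot_def sum_subtractf sum_distrib_left power2_eq_square)
  qed
  finally show ?thesis using ip_pos[OF f f_nz] by simp
qed

lemma graph_length_pos: "0 < graph_length G l"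
  unfolding graph_length_def using l_pos arcs_nonempty by (intro sum_pos) auto

text \<open>
  All vertices are fresh at first. If there is a pendant vertex, it is taken as root and saves its own half, so that
  the count is exactly \<open>j\<close>. Otherwise some arc lies on a cycle, and the half is saved by taking the head of this arc as
  root and cutting the arc there.
\<close>

theorem neumann_ev_bound:
  assumes linked: "linked (verts G) (arcs G)" and j: "j \<ge> 1"
  shows "neumann_ev G j l \<le>
    ((real j - 1 + 2 * real_of_int (betti G) + real (num_pendant G) / 2) * pi / graph_length G l)\<^sup>2"
proof -
  define L where "L = graph_length G l"
  define p where "p = num_pendant G"
  define \<beta> where "\<beta> = real_of_int (betti G)"
  define k where "k = (real j - 1 + 2 * \<beta> + real p / 2) * pi / L"
  have L: "0 < L" unfolding L_def by (rule graph_length_pos)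
  have \<beta>: "\<beta> = real (card (arcs G)) - real (card (verts G)) + 1" by (simp add: \<beta>_def betti_def)
  define ends where "ends = {v \<in> verts G. arc_degree (arcs G) v = 1}"
  have pend: "p = card ends"
    by (simp add: p_def num_pendant_def ends_def arc_degree_arcs)
  obtain a0 where a0: "a0 \<in> arcs G" using arcs_nonempty by blast
  have built: "built r (verts G) (arcs G)" if "r \<in> verts G" for r
    using linked that by (intro linked_built) auto
  have \<beta>_nonneg: "0 \<le> \<beta>"
    using built_subgraph(7)[OF built, of "tail G a0"] a0 by (simp add: \<beta>)
  have ok: "angles_ok (verts G) (verts G) (\<lambda>_. pi / 2)" by (simp add: angles_ok_def)
  have weights: "(\<Sum>v\<in>verts G. vertex_weight r (arcs G) (verts G) (\<lambda>_. pi / 2) v) =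
      - pi / 2 * real (card (ends - {r}))" for r
  proof -
    have "(\<Sum>v\<in>verts G. vertex_weight r (arcs G) (verts G) (\<lambda>_. pi / 2) v) =
        (\<Sum>v\<in>verts G. if v \<in> ends - {r} then - pi / 2 else 0)"
      by (intro sum.cong) (auto simp: vertex_weight_def ends_def)
    also have "\<dots> = (\<Sum>v\<in>ends - {r}. - pi / 2)"
      by (rule sum.mono_neutral_cong_right) (auto simp: ends_def)
    finally show ?thesis by (simp add: mult.commute)
  qed
  have kL: "k * (\<Sum>e\<in>arcs G. l e) = (real j - 1 + 2 * \<beta> + real p / 2) * pi"
    using L by (simp add: k_def L_def graph_length_def[symmetric])
  show ?thesis
  proof (cases "p = 0")
    case False
    then have "ends \<noteq> {}" unfolding pend by auto
    then obtain r where r: "r \<in> verts G" "r \<in> ends" by (auto simp: ends_def)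
    have "p = Suc (card (ends - {r}))"
      unfolding pend using r by (intro card.remove) (simp_all add: ends_def)
    then have card_eq: "real (card (ends - {r})) = real p - 1"
      by linarith
    have bound: "count_bound k r (verts G) (arcs G) (verts G) (\<lambda>_. pi / 2) = real j"
      unfolding count_bound_def weights kL \<beta>[symmetric] card_eq by (simp add: field_simps)
    have k: "0 < k" using False \<beta>_nonneg j L by (auto simp: k_def intro!: divide_pos_pos mult_pos_pos add_nonneg_pos)
    have "test_exists k (verts G) (arcs G) (\<lambda>_. pi / 2) (real j)"
      using test_exists_count[OF k built[OF r(1)] ok] unfolding bound .
    then show ?thesis using neumann_ev_le_of_test_exists[OF k] by (simp add: k_def p_def \<beta>_def L_def)
  next
    case True
    \<comment> \<open>Without pendant vertices the graph has a cycle; rooting at an end of an arc of a cycle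
      saves the missing half.\<close>
    have root: "built (tail G a0) (verts G) (arcs G)" using a0 by (intro built) simp
    have "card (verts G) \<noteq> card (arcs G) + 1"
      using built_tree_has_leaf[OF root] arcs_nonempty True by (auto simp: pend ends_def)
    then have less: "card (verts G) < card (arcs G) + 1" using built_subgraph(7)[OF root] by simp
    then obtain e where e: "e \<in> arcs G" "built (tail G a0) (verts G) (arcs G - {e})"
      using built_remove_cycle_arc[OF root] by blast
    define r where "r = head G e"
    have built_e: "built r (verts G) (arcs G - {e})"
      using built_linked[OF e(2)] e(1) by (intro linked_built) (auto simp: r_def)
    have "\<beta> \<ge> 1" using less by (simp add: \<beta>)
    then have k: "0 < k" using j L by (auto simp: k_def intro!: divide_pos_pos mult_pos_pos)
    have "test_exists k (verts G) (insert e (arcs G - {e})) (\<lambda>_. pi / 2)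
        (count_bound k r (verts G) (insert e (arcs G - {e})) (verts G) (\<lambda>_. pi / 2) + (if head G e = r then 1 / 2 else 0))"
      using e(1) ok by (intro test_exists_cycle_step[OF k built_e] test_exists_count[OF k built_e]) auto
    moreover have "insert e (arcs G - {e}) = arcs G" using e(1) by auto
    moreover have "count_bound k r (verts G) (arcs G) (verts G) (\<lambda>_. pi / 2) + 1 / 2 = real j"
    proof -
      have "ends = {}" using True by (simp add: pend ends_def)
      then show ?thesis
        unfolding count_bound_def weights kL \<beta>[symmetric] using True by (simp add: \<beta> field_simps)
    qed
    ultimately have "test_exists k (verts G) (arcs G) (\<lambda>_. pi / 2) (real j)" by (simp add: r_def)
    then show ?thesis using neumann_ev_le_of_test_exists[OF k] by (simp add: k_def p_def \<beta>_def L_def)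
  qed
qed

end

text \<open>
  The least constant exists, since it is the supremum of \<open>\<lambda>\<^sub>j L\<^sup>2\<close> over all metrics.
\<close>

lemma Lambda_bound_le:
  assumes L: "\<And>l. graph_metric G l \<Longrightarrow> 0 < graph_length G l"
    and le: "\<And>l. graph_metric G l \<Longrightarrow> neumann_ev G j l * (graph_length G l)\<^sup>2 \<le> C"
  shows "Lambda_bound G j \<le> ereal C"
proof -
  define S where "S = (SUP l\<in>{l. graph_metric G l}. ereal (neumann_ev G j l * (graph_length G l)\<^sup>2))"
  have iff: "ereal (neumann_ev G j l) \<le> c / ereal ((graph_length G l)\<^sup>2) \<longleftrightarrow>
      ereal (neumann_ev G j l * (graph_length G l)\<^sup>2) \<le> c" if "graph_metric G l" for c l
    using L[OF that] by (subst ereal_le_divide_pos) (auto simp: mult.commute)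
  have "Lambda_bound G j = S"
    unfolding Lambda_bound_def
  proof (rule Least_equality)
    show "\<forall>l. graph_metric G l \<longrightarrow> ereal (neumann_ev G j l) \<le> S / ereal ((graph_length G l)\<^sup>2)"
      unfolding S_def using iff by (auto intro: SUP_upper)
    show "S \<le> c" if "\<forall>l. graph_metric G l \<longrightarrow> ereal (neumann_ev G j l) \<le> c / ereal ((graph_length G l)\<^sup>2)" for c
      unfolding S_def using that iff by (auto intro: SUP_least)
  qed
  also have "S \<le> ereal C" unfolding S_def using le by (intro SUP_least) simp
  finally show ?thesis .
qed

theorem theorem1p2:
  fixes G :: "('v, 'e) pre_digraph" and j :: nat
  assumes "fin_digraph G"
    and "Digraph_Component.connected G"
    and "arcs G \<noteq> {}"
    and "j \<ge> 1"
  shows "Lambda_bound G j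
    \<le> ereal ((real j - 1 + 2 * real_of_int (betti G) + real (num_pendant G) / 2)\<^sup>2 * pi\<^sup>2)"
proof -
  interpret fin_digraph G by (rule assms)
  have linked: "linked (verts G) (arcs G)" using assms(2) by (rule connected_linked)
  have incident: "\<exists>e\<in>arcs G. tail G e = v \<or> head G e = v" if v: "v \<in> verts G" for v
  proof (cases "verts G = {v}")
    case True
    obtain e where "e \<in> arcs G" using assms(3) by blast
    then show ?thesis using True tail_in_verts[of e] by auto
  next
    case False
    then show ?thesis using linked[unfolded linked_def, rule_format, of "{v}"] v by auto
  qed
  have metric_graph: "metric_graph G l" if "graph_metric G l" for l
    using that assms(3) incident by unfold_locales auto
  show ?thesis
  proof (rule Lambda_bound_le)
    fix l assume "graph_metric G l"
    then interpret metric_graph G l by (rule metric_graph)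
    show pos: "0 < graph_length G l" by (rule graph_length_pos)
    show "neumann_ev G j l * (graph_length G l)\<^sup>2 \<le>
        (real j - 1 + 2 * real_of_int (betti G) + real (num_pendant G) / 2)\<^sup>2 * pi\<^sup>2"
      using neumann_ev_bound[OF linked assms(4)] pos
      by (simp add: power_divide power_mult_distrib pos_le_divide_eq)
  qed
qed

end
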